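(* Let $r\ge1$ be a fixed integer. For every compact product set $\mathcal U=\mathcal U_1\times\cdots\times\mathcal U_r\subset\mathbb R^r$ and every compact set $\mathcal T\subset\mathbb R$, $$\limsup_{N\to\infty}\sup_{(\boldsymbol\gamma,t)\in\mathcal U\times\mathcal T}\frac1N\log\mathbb E\left[|\det(\boldsymbol X_N^{\boldsymbol\gamma}-t\boldsymbol I_N)|\right]\le\sup_{t\in\mathcal T}\Omega(t),$$ $$\liminf_{N\to\infty}\inf_{(\boldsymbol\gamma,t)\in\mathcal U\times\mathcal T}\frac1N\log\mathbb E\left[|\det(\boldsymbol X_N^{\boldsymbol\gamma}-t\boldsymbol I_N)|\right]\ge\inf_{t\in\mathcal T}\Omega(t).$$
   Context: For $\boldsymbol\gamma=(\gamma_1,\ldots,\gamma_r)\in\mathbb R^r$ and $N\ge r$, $\boldsymbol X_N^{\boldsymbol\gamma}=\boldsymbol W_N+\sum_{i=1}^r\gamma_i\boldsymbol e_i\boldsymbol e_i^\top$, where $\boldsymbol e_1,\ldots,\boldsymbol e_r$ are the first $r$ standard basis vectors of $\mathbb R^N$ and $\boldsymbol W_N\sim\mathrm{GOE}(N)$: real symmetric with independent centered Gaussian entries $(\boldsymbol W_N)_{ij}$, $i\le j$, of variance $(1+\delta_{ij})/N$. $\Omega(x)=\int\log|x-\lambda|\,\mu_{\mathrm{sc}}(d\lambda)$ with $\mu_{\mathrm{sc}}(dx)=\frac1{2\pi}\sqrt{4-x^2}\,\mathbf 1_{\{|x|\le2\}}dx$; explicitly $\Omega(x)=\frac{x^2}{4}-\frac12$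 for $|x|\le2$ and $\Omega(x)=\frac{x^2}{4}-\frac12-\left[\frac{|x|}{4}\sqrt{x^2-4}-\log\frac{|x|+\sqrt{x^2-4}}{2}\right]$ for $|x|>2$. Sets $\mathcal U,\mathcal T$ are nonempty. *)

theory Defs
  imports "HOL-Probability.Probability" "Jordan_Normal_Form.Determinant"
begin

text \<open>Matrices are those of \<^theory>\<open>Jordan_Normal_Form.Matrix\<close>, because the dimension \<open>N\<close> tends to
  infinity.  Rows and columns are indexed from \<open>0\<close>, so \<open>e\<^sub>1, \<dots>, e\<^sub>r\<close> become
  \<open>unit_vec N 0, \<dots>, unit_vec N (r - 1)\<close>.\<close>

definition is_GOE :: "'a measure \<Rightarrow> nat \<Rightarrow> ('a \<Rightarrow> real mat) \<Rightarrow> bool" where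
  "is_GOE M N W \<longleftrightarrow>
     prob_space M \<and>
     (\<forall>\<omega>\<in>space M. W \<omega> \<in> carrier_mat N N \<and> transpose_mat (W \<omega>) = W \<omega>) \<and>
     prob_space.indep_vars M (\<lambda>_. borel) (\<lambda>(i, j) \<omega>. W \<omega> $$ (i, j)) {(i, j). i \<le> j \<and> j < N} \<and>
     (\<forall>i j. i \<le> j \<and> j < N \<longrightarrow>
        distributed M lborel (\<lambda>\<omega>. W \<omega> $$ (i, j))
          (\<lambda>x. ennreal (normal_density 0 (sqrt ((1 + (if i = j then 1 else 0)) / real N)) x)))"

text \<open>The finite-rank deformation \<open>W + (\<Sum>k<r. \<gamma>\<^sub>k e\<^sub>k e\<^sub>k\<^sup>T)\<close>; the sum is written entrywise since
  matrices of this type have no sum operator over index sets.\<close>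

definition spiked :: "nat \<Rightarrow> nat \<Rightarrow> (nat \<Rightarrow> real) \<Rightarrow> real mat \<Rightarrow> real mat" where
  "spiked r N \<gamma> W =
     W + mat N N (\<lambda>(i, j). \<Sum>k<r. \<gamma> k * (vec_index (unit_vec N k) i * vec_index (unit_vec N k) j))"

definition mu_sc :: "real measure" where
  "mu_sc = density lborel
     (\<lambda>x. ennreal (1 / (2 * pi) * sqrt (4 - x\<^sup>2) * indicator {x. \<bar>x\<bar> \<le> 2} x))"

text \<open>The value \<open>ln 0 = 0\<close> at \<open>y = x\<close> is immaterial, as \<open>mu_sc\<close> has no atoms.\<close>

definition Omega :: "real \<Rightarrow> real" where
  "Omega x = (\<integral>y. ln \<bar>x - y\<bar> \<partial>mu_sc)"

text \<open>\<open>(1/N) log E |det (X - t I)|\<close>.  For \<open>N \<ge> 1\<close> and a GOE matrix the expectation is finite, since the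
  determinant is polynomial in Gaussian variables, and strictly positive, since the determinant is
  almost surely nonzero; so neither the integral nor the logarithm takes a default value.\<close>

definition log_mean_det ::
  "'a measure \<Rightarrow> ('a \<Rightarrow> real mat) \<Rightarrow> nat \<Rightarrow> nat \<Rightarrow> (nat \<Rightarrow> real) \<Rightarrow> real \<Rightarrow> real" where
  "log_mean_det M W r N \<gamma> t =
     1 / real N * ln (\<integral>\<omega>. \<bar>Determinant.det (spiked r N \<gamma> (W \<omega>) - t \<cdot>\<^sub>m 1\<^sub>m N)\<bar> \<partial>M)"

end

theory Submission
  imports Defs "HOL-Complex_Analysis.Complex_Analysis"
begin

text \<open>
  After multiplication by \<open>sqrt N\<close> the matrix \<open>W\<close> has independent entries of variance \<open>1\<close> off the
  diagonal and \<open>2\<close> on it.  The statement is then a bound, uniform in \<open>t\<close> and in bounded spikes, for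
  \<open>E \<bar>det (X + diag y)\<bar>\<close> with \<open>X\<close> such a matrix and \<open>y\<^sub>i = sqrt N (\<gamma>\<^sub>i - t)\<close>, where \<open>\<gamma>\<^sub>i = 0\<close> from the index \<open>r\<close>
  on; the error obtained is \<open>O(log N / N)\<close> after taking logarithms and dividing by \<open>N\<close>.  Eigenvalues never appear: the proof
  compares the mean absolute determinant with the first two moments of the determinant, both of
  which can be computed exactly.

  \<^bold>\<open>Spikes.\<close>  The determinant is affine in a diagonal entry \<open>g\<close>, say \<open>Y g + Z\<close> with \<open>(Y, Z)\<close> independent
  of \<open>g\<close>.  Testing against \<open>sgn (Y g)\<close> gives \<open>E \<bar>Y g + Z\<bar> \<ge> E \<bar>Y\<bar> E \<bar>g\<bar>\<close> (\<open>abs_affine_ge\<close>).  Hence moving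
  one diagonal shift by \<open>\<delta>\<close> changes the mean absolute determinant by a factor at most \<open>1 + \<bar>\<delta>\<bar>\<close>, and
  \<open>r\<close> spikes cost a factor polynomial in \<open>N\<close> in either direction (\<open>mean_abs_sdet_spikes\<close>).  It remains
  to treat a constant shift \<open>c\<close>, where \<open>c\<^sup>2 = N t\<^sup>2\<close>.

  \<^bold>\<open>Lower bound.\<close>  The mean of the determinant of order \<open>n\<close> is the Hermite polynomial \<open>He\<^sub>n(c)\<close>.  It may
  vanish, but the inequality above also bounds the mean absolute determinant of order \<open>N\<close> below by
  that of order \<open>N - 1\<close>, hence below by both \<open>\<bar>He\<^sub>N(c)\<bar>\<close> and \<open>\<bar>He\<^bsub>N-1\<^esub>(c)\<bar>\<close>.  These two are never small
  together: for \<open>\<bar>t\<bar> \<le> 2\<close> a monotone quantity of Sonin type shows it (\<open>hermite_lower_bulk\<close>), and for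
  \<open>\<bar>t\<bar> > 2\<close> the ratios of consecutive Hermite polynomials stay above the larger root of
  \<open>\<rho>\<^sup>2 - c \<rho> + k = 0\<close> (\<open>hermite_lower_outside\<close>).

  \<^bold>\<open>Upper bound.\<close>  By Cauchy-Schwarz the second moment suffices.  Expanding along a row expresses it
  through cofactors of smaller order, and the expansion closes because diagonal and off-diagonal
  cofactors are tied by one identity (\<open>E_cofactor_isotropy\<close>).  The resulting recursion says that the
  exponential generating function of the second moments is
  \<open>exp (c\<^sup>2 w / (1 + w)) (1 - w)\<^bsup>-5/2\<^esup> (1 + w)\<^bsup>-1/2\<^esup>\<close>, and a Cauchy estimate bounds its coefficients.

  \<^bold>\<open>The rate.\<close>  If \<open>t = v + 1/v\<close> with \<open>\<bar>v\<bar> \<le> 1\<close>, then \<open>Omega t = - ln \<bar>v\<bar> + Re (v\<^sup>2) / 2\<close>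
  (\<open>Omega_eq_semicircle_pot\<close>).  Both Hermite bounds have this rate, and so does the Cauchy estimate on
  a circle of radius slightly below \<open>\<bar>v\<bar>\<^sup>2\<close>.
\<close>

section \<open>Determinants indexed by finite sets\<close>

text \<open>The Leibniz formula over an arbitrary finite index set: removing rows and columns is then
  removing indices, with no renumbering.\<close>
definition pdet :: "(nat \<Rightarrow> nat \<Rightarrow> real) \<Rightarrow> nat set \<Rightarrow> real" where
  "pdet f S = (\<Sum>p | p permutes S. of_int (sign p) * (\<Prod>i\<in>S. f i (p i)))"

text \<open>The cofactor of the entry \<open>(j, i)\<close>, that is, the derivative of \<open>pdet f S\<close> in that entry.\<close>
definition cof :: "(nat \<Rightarrow> nat \<Rightarrow> real) \<Rightarrow> nat set \<Rightarrow> nat \<Rightarrow> nat \<Rightarrow> real" where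
  "cof f S j i = (\<Sum>p | p permutes S \<and> p j = i. of_int (sign p) * (\<Prod>k\<in>S - {j}. f k (p k)))"

lemma pdet_empty [simp]: "pdet f {} = 1"
  by (simp add: pdet_def)

lemma pdet_cong:
  assumes "\<And>i j. i \<in> S \<Longrightarrow> j \<in> S \<Longrightarrow> f i j = g i j"
  shows "pdet f S = pdet g S"
  unfolding pdet_def
  by (intro sum.cong refl arg_cong2[of _ _ _ _ "(*)"] prod.cong) (auto simp: assms permutes_in_image)

lemma cof_cong:
  assumes "\<And>i j. i \<in> S \<Longrightarrow> j \<in> S \<Longrightarrow> f i j = g i j"
  shows "cof f S i j = cof g S i j"
  unfolding cof_def
  by (intro sum.cong refl arg_cong2[of _ _ _ _ "(*)"] prod.cong) (auto simp: assms permutes_in_image)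

lemma sign_transpose_comp:
  assumes "q permutes S" "finite S" "a \<noteq> b"
  shows "sign (Transposition.transpose a b \<circ> q) = - sign q"
  using assms permutes_imp_permutation[of S q]
  by (subst sign_compose) (auto simp: sign_swap_id permutation_swap_id)

lemma sum_perms_filter:
  assumes "finite S"
  shows "(\<Sum>p | p permutes S \<and> P p. h p) = (\<Sum>p | p permutes S. if P p then h p else (0::real))"
  using sum.inter_filter[OF finite_permutations[OF assms], of h P] by simp

text \<open>Cut the new index \<open>a\<close> out of a permutation of \<open>insert a S\<close>.  Either \<open>a\<close> is fixed, or it sits in
  \<open>j \<mapsto> a \<mapsto> i\<close>; cutting then leaves a permutation of \<open>S\<close> with \<open>j \<mapsto> i\<close> and the opposite sign, which is
  a term of the cofactor at \<open>(j, i)\<close>.\<close>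
lemma pdet_insert:
  assumes S: "finite S" "a \<notin> S"
  shows "pdet f (insert a S) = f a a * pdet f S - (\<Sum>j\<in>S. \<Sum>i\<in>S. f j a * f a i * cof f S j i)"
proof -
  let ?t = "\<lambda>q. of_int (sign q) :: real"
  have q_a: "q a = a" if "q permutes S" for q using that S by (auto simp: permutes_def)
  have main: "(\<Sum>q | q permutes S. ?t (Transposition.transpose a b \<circ> q) * (\<Prod>k\<in>insert a S. f k ((Transposition.transpose a b \<circ> q) k)))
     = - (\<Sum>j\<in>S. f j a * f a b * cof f S j b)" if b: "b \<in> S" for b
  proof -
    have ab: "a \<noteq> b" using b S by auto
    have "(\<Sum>q | q permutes S. ?t (Transposition.transpose a b \<circ> q) * (\<Prod>k\<in>insert a S. f k ((Transposition.transpose a b \<circ> q) k)))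
      = (\<Sum>q | q permutes S. \<Sum>j\<in>S. if q j = b then - (f j a * f a b * (?t q * (\<Prod>k\<in>S-{j}. f k (q k)))) else 0)"
    proof (intro sum.cong refl)
      fix q assume "q \<in> {q. q permutes S}"
      then have q: "q permutes S" by simp
      obtain j where j: "j \<in> S" "q j = b" using q b by (metis permutes_inv_eq permutes_in_image permutes_inv)
      have uniq: "q j' = b \<longleftrightarrow> j' = j" for j' using q j by (metis permutes_inv_eq)
      have "(\<Prod>k\<in>S-{j}. f k ((Transposition.transpose a b \<circ> q) k)) = (\<Prod>k\<in>S-{j}. f k (q k))"
      proof (intro prod.cong refl)
        fix k assume k: "k \<in> S - {j}"
        then have "q k \<noteq> b" "q k \<in> S" using uniq q by (auto simp: permutes_in_image)
        then have "q k \<noteq> a" "q k \<noteq> b" using S by auto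
        then show "f k ((Transposition.transpose a b \<circ> q) k) = f k (q k)" by (simp add: Transposition.transpose_def)
      qed
      then have "(\<Prod>k\<in>insert a S. f k ((Transposition.transpose a b \<circ> q) k)) = f a b * (f j a * (\<Prod>k\<in>S-{j}. f k (q k)))"
        using S q_a[OF q] j by (simp add: prod.remove[OF S(1) j(1)])
      moreover have "?t (Transposition.transpose a b \<circ> q) = - ?t q" using sign_transpose_comp[OF q S(1) ab] by simp
      moreover have "(\<Sum>j'\<in>S. if q j' = b then - (f j' a * f a b * (?t q * (\<Prod>k\<in>S-{j'}. f k (q k)))) else 0)
         = - (f j a * f a b * (?t q * (\<Prod>k\<in>S-{j}. f k (q k))))"
        unfolding uniq using S j by simp
      ultimately show "?t (Transposition.transpose a b \<circ> q) * (\<Prod>k\<in>insert a S. f k ((Transposition.transpose a b \<circ> q) k)) =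
        (\<Sum>j'\<in>S. if q j' = b then - (f j' a * f a b * (?t q * (\<Prod>k\<in>S-{j'}. f k (q k)))) else 0)"
        by simp
    qed
    also have "\<dots> = (\<Sum>j\<in>S. \<Sum>q | q permutes S. if q j = b then - (f j a * f a b * (?t q * (\<Prod>k\<in>S-{j}. f k (q k)))) else 0)"
      by (rule sum.swap)
    also have "\<dots> = (\<Sum>j\<in>S. - (f j a * f a b * cof f S j b))"
      unfolding cof_def sum_distrib_left sum_negf[symmetric] sum_perms_filter[OF S(1)]
      by (intro sum.cong refl) simp
    finally show ?thesis by (simp add: sum_negf)
  qed
  have zero: "(\<Sum>q | q permutes S. ?t (Transposition.transpose a a \<circ> q) * (\<Prod>k\<in>insert a S. f k ((Transposition.transpose a a \<circ> q) k)))
     = f a a * pdet f S"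
    unfolding pdet_def sum_distrib_left using S by (intro sum.cong refl) (simp add: q_a)
  have "pdet f (insert a S) = (\<Sum>b\<in>insert a S. \<Sum>q | q permutes S.
      ?t (Transposition.transpose a b \<circ> q) * (\<Prod>k\<in>insert a S. f k ((Transposition.transpose a b \<circ> q) k)))"
    unfolding pdet_def by (rule sum_over_permutations_insert[OF S])
  also have "\<dots> = f a a * pdet f S + (\<Sum>b\<in>S. - (\<Sum>j\<in>S. f j a * f a b * cof f S j b))"
    using S zero main by simp
  also have "\<dots> = f a a * pdet f S - (\<Sum>j\<in>S. \<Sum>i\<in>S. f j a * f a i * cof f S j i)"
    by (subst sum.swap) (simp add: sum_negf)
  finally show ?thesis .
qed

lemma cof_diag:
  assumes "finite S" "i \<in> S"
  shows "cof f S i i = pdet f (S - {i})"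
proof -
  have "{p. p permutes S \<and> p i = i} = {p. p permutes (S - {i})}"
    using assms by (auto simp: permutes_def)
  then show ?thesis by (simp add: cof_def pdet_def)
qed

text \<open>In a permutation with \<open>j \<mapsto> i\<close> the index \<open>j\<close> can be cut out as well: its predecessor, which used
  the column \<open>j\<close>, now points to \<open>i\<close>.  So an off-diagonal cofactor is again a determinant over a set
  one smaller, with one column replaced, and \<open>pdet_insert\<close> applies to it.\<close>
lemma cof_offdiag:
  assumes S: "finite S" "j \<in> S" "i \<in> S" "i \<noteq> j"
  shows "cof f S j i = - pdet (\<lambda>k l. f k (if l = i then j else l)) (S - {j})"
proof -
  let ?R = "S - {j}"
  let ?h = "\<lambda>p. if p j = i then of_int (sign p) * (\<Prod>k\<in>?R. f k (p k)) else (0::real)"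
  have ins: "insert j ?R = S" using S by auto
  have fR: "finite ?R" "j \<notin> ?R" using S by auto
  have q_j: "q j = j" if "q permutes ?R" for q using that by (auto simp: permutes_def)
  have "cof f S j i = sum ?h {p. p permutes (insert j ?R)}"
    unfolding cof_def ins sum_perms_filter[OF S(1)] ..
  also have "\<dots> = (\<Sum>b\<in>insert j ?R. \<Sum>q | q permutes ?R. ?h (Transposition.transpose j b \<circ> q))"
    by (rule sum_over_permutations_insert[OF fR])
  also have "\<dots> = (\<Sum>b\<in>insert j ?R. if b = i then
      (\<Sum>q | q permutes ?R. - (of_int (sign q) * (\<Prod>k\<in>?R. f k (if q k = i then j else q k)))) else 0)"
  proof (intro sum.cong refl)
    fix b assume "b \<in> insert j ?R"
    have "?h (Transposition.transpose j b \<circ> q) = (if b = i then - (of_int (sign q) * (\<Prod>k\<in>?R. f k (if q k = i then j else q k))) else 0)"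
      if q: "q permutes ?R" for q
    proof -
      have 1: "(Transposition.transpose j b \<circ> q) j = b" using q_j[OF q] by simp
      have 2: "q k \<noteq> j" if "k \<in> ?R" for k using q that by (metis Diff_iff insertI1 permutes_in_image)
      have 3: "(\<Prod>k\<in>?R. f k ((Transposition.transpose j i \<circ> q) k)) = (\<Prod>k\<in>?R. f k (if q k = i then j else q k))"
        by (intro prod.cong refl) (use 2 in \<open>auto simp: Transposition.transpose_def\<close>)
      show ?thesis using 1 3 sign_transpose_comp[OF q fR(1), of j i] S by auto
    qed
    then show "(\<Sum>q | q permutes ?R. ?h (Transposition.transpose j b \<circ> q)) = (if b = i then
      (\<Sum>q | q permutes ?R. - (of_int (sign q) * (\<Prod>k\<in>?R. f k (if q k = i then j else q k)))) else 0)"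
      by (auto intro!: sum.neutral sum.cong)
  qed
  also have "\<dots> = - pdet (\<lambda>k l. f k (if l = i then j else l)) ?R"
    using S by (simp add: pdet_def sum_negf)
  finally show ?thesis .
qed

lemma cof_sym:
  assumes S: "finite S" "i \<in> S" and f: "\<And>i j. i \<in> S \<Longrightarrow> j \<in> S \<Longrightarrow> f i j = f j i"
  shows "cof f S i j = cof f S j i"
  unfolding cof_def
proof (rule sum.reindex_bij_witness[of _ Hilbert_Choice.inv Hilbert_Choice.inv])
  fix p assume "p \<in> {p. p permutes S \<and> p i = j}"
  then have p: "p permutes S" "p i = j" by auto
  show "Hilbert_Choice.inv (Hilbert_Choice.inv p) = p" using p by (simp add: permutes_inv_inv)
  show "Hilbert_Choice.inv p \<in> {p. p permutes S \<and> p j = i}" using p by (auto simp: permutes_inv permutes_inv_eq)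
  have "(\<Prod>k\<in>S - {j}. f k (Hilbert_Choice.inv p k)) = (\<Prod>k\<in>S - {i}. f (p k) (Hilbert_Choice.inv p (p k)))"
  proof (rule prod.reindex_bij_betw[symmetric])
    have "bij_betw p S S" using p(1) by (rule permutes_imp_bij)
    then show "bij_betw p (S - {i}) (S - {j})" using p S
      by (metis bij_betw_DiffI bij_betw_singletonI empty_subsetI insert_subset permutes_in_image)
  qed
  also have "\<dots> = (\<Prod>k\<in>S - {i}. f k (p k))"
    using p f by (intro prod.cong refl) (auto simp: permutes_inverses(2)[OF p(1)] permutes_in_image)
  finally show "of_int (sign (Hilbert_Choice.inv p)) * (\<Prod>k\<in>S - {j}. f k (Hilbert_Choice.inv p k)) =
      of_int (sign p) * (\<Prod>k\<in>S - {i}. f k (p k))"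
    using sign_inverse[OF permutes_imp_permutation[OF S(1) p(1)]] by simp
next
  fix p assume "p \<in> {p. p permutes S \<and> p j = i}"
  then have p: "p permutes S" "p j = i" by auto
  show "Hilbert_Choice.inv (Hilbert_Choice.inv p) = p" using p by (simp add: permutes_inv_inv)
  show "Hilbert_Choice.inv p \<in> {p. p permutes S \<and> p i = j}" using p by (auto simp: permutes_inv permutes_inv_eq)
qed

lemma pdet_scale: "finite S \<Longrightarrow> pdet (\<lambda>i j. c * f i j) S = c ^ card S * pdet f S"
  by (simp add: pdet_def prod.distrib sum_distrib_left algebra_simps)

lemma det_eq_pdet:
  assumes "A \<in> carrier_mat n n"
  shows "Determinant.det A = pdet (\<lambda>i j. A $$ (i,j)) {..<n}"
  using assms unfolding Determinant.det_def pdet_def by (auto simp: atLeast0LessThan intro!: sum.cong)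

section \<open>Lower bounds for Hermite polynomials\<close>

text \<open>The probabilists' Hermite polynomials.\<close>
fun hermite :: "nat \<Rightarrow> real \<Rightarrow> real" where
  "hermite 0 x = 1"
| "hermite (Suc 0) x = x"
| "hermite (Suc (Suc n)) x = x * hermite (Suc n) x - real (Suc n) * hermite n x"

lemma hermite_Suc: "hermite (Suc n) x = x * hermite n x - real n * hermite (n - 1) x"
  by (cases n) auto

lemma hermite_minus: "hermite n (- x) = (-1) ^ n * hermite n x"
  by (induction n x rule: hermite.induct) (auto simp: algebra_simps)

lemma hermite_deriv: "(hermite n has_real_derivative (real n * hermite (n - 1) x)) (at x)"
proof (induction n arbitrary: x rule: less_induct)
  case (less n)
  have He0: "hermite 0 = (\<lambda>x. 1)" and He1: "hermite (Suc 0) = (\<lambda>x. x)"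
    and He2: "hermite (Suc (Suc m)) = (\<lambda>x. x * hermite (Suc m) x - real (Suc m) * hermite m x)" for m by (auto simp: fun_eq_iff)
  consider "n = 0" | "n = 1" | m where "n = Suc (Suc m)" by (metis One_nat_def not0_implies_Suc)
  then show ?case
  proof cases
    case 1 then show ?thesis by (simp add: He0)
  next
    case 2 then show ?thesis by (simp add: He1)
  next
    case (3 m)
    have "(hermite (Suc (Suc m)) has_real_derivative
       (hermite (Suc m) x + (real (Suc m) * hermite m x) * x - real (Suc m) * (real m * hermite (m-1) x))) (at x)"
      unfolding He2 by (rule derivative_eq_intros less[of "Suc m", simplified 3] less[of "m", simplified 3] refl | simp add: 3)+
    also have "hermite (Suc m) x + (real (Suc m) * hermite m x) * x - real (Suc m) * (real m * hermite (m-1) x)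
       = hermite (Suc m) x + real (Suc m) * hermite (Suc m) x" by (simp add: hermite_Suc[of m] algebra_simps)
    finally show ?thesis by (simp add: 3 algebra_simps)
  qed
qed

text \<open>The quantity \<open>\<psi>\<^sup>2 + \<psi>'\<^sup>2 / q\<close> for the Hermite function \<open>\<psi> = exp (- x\<^sup>2 / 4) He\<^sub>n\<close>, which
  solves \<open>\<psi>'' + q \<psi> = 0\<close> with \<open>q = n + 1/2 - x\<^sup>2 / 4\<close>.\<close>
definition sonin :: "nat \<Rightarrow> real \<Rightarrow> real" where
  "sonin n x = exp (- (x\<^sup>2 / 2)) * ((hermite n x)\<^sup>2 + (real n * hermite (n - 1) x - x / 2 * hermite n x)\<^sup>2 / (real n + 1/2 - x\<^sup>2 / 4))"

text \<open>From \<open>\<psi>'' = - q \<psi>\<close> the derivative of \<open>\<psi>\<^sup>2 + \<psi>'\<^sup>2 / q\<close> is \<open>- \<psi>'\<^sup>2 q' / q\<^sup>2\<close>, and \<open>q\<close> decreases for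
  \<open>x \<ge> 0\<close>.\<close>
lemma sonin_mono:
  assumes "0 \<le> x" "x\<^sup>2 < 4 * real n + 2" "n \<ge> 1"
  shows "sonin n 0 \<le> sonin n x"
proof (rule DERIV_nonneg_imp_nondecreasing[OF assms(1)])
  fix t assume t: "0 \<le> t" "t \<le> x"
  have tx: "t\<^sup>2 \<le> x\<^sup>2" using t by (simp add: power_mono)
  define q where "q = real n + 1/2 - t\<^sup>2 / 4"
  have q: "q > 0" using tx assms(2) by (simp add: q_def)
  obtain m where m: "n = Suc m" using assms by (cases n) auto
  define D where "D = real n * hermite (n - 1) t - t / 2 * hermite n t"
  define H where "H = hermite n t"
  define K where "K = hermite (n-1) t"
  have d1: "(hermite n has_real_derivative real n * K) (at t)" unfolding K_def by (rule hermite_deriv)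
  have d2: "(hermite (n-1) has_real_derivative (t * K - H)) (at t)"
  proof -
    have "real m * hermite (m - 1) t = t * K - H" by (simp add: m K_def H_def hermite_Suc[of m])
    then show ?thesis using hermite_deriv[of m t] by (simp add: m)
  qed
  have "(sonin n has_real_derivative
     (exp (- (t\<^sup>2 / 2)) * (- t)) * (H\<^sup>2 + D\<^sup>2 / q) + exp (- (t\<^sup>2 / 2)) *
       (2 * H * (real n * K) + (2 * D * (real n * (t * K - H) - (1/2 * H + t / 2 * (real n * K))) * q - D\<^sup>2 * (- t / 2)) / q\<^sup>2)) (at t)"
  proof -
    define D' where "D' = real n * (t * K - H) - (1/2 * H + t / 2 * (real n * K))"
    have d3: "((\<lambda>x. real n * hermite (n - 1) x - x / 2 * hermite n x) has_real_derivative D') (at t)"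
    proof -
      have dx: "((\<lambda>x. x / 2) has_real_derivative 1 / 2) (at t)" by (auto intro!: derivative_eq_intros)
      show ?thesis
        using DERIV_diff[OF DERIV_cmult[OF d2, of "real n"] DERIV_mult[OF dx d1]]
        by (simp add: H_def D'_def mult_ac)
    qed
    have d4: "((\<lambda>x. (real n * hermite (n - 1) x - x / 2 * hermite n x)\<^sup>2) has_real_derivative 2 * D * D') (at t)"
      using DERIV_mult[OF d3 d3] unfolding power2_eq_square D_def[symmetric] by (simp add: mult_ac)
    have d5: "((\<lambda>x. real n + 1/2 - x\<^sup>2 / 4) has_real_derivative - t / 2) (at t)"
      by (auto intro!: derivative_eq_intros)
    have d6: "((\<lambda>x. (real n * hermite (n - 1) x - x / 2 * hermite n x)\<^sup>2 / (real n + 1/2 - x\<^sup>2 / 4)) has_real_derivative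
        (2 * D * D' * q - D\<^sup>2 * (- t / 2)) / q\<^sup>2) (at t)"
      using DERIV_divide[OF d4 d5] q unfolding q_def[symmetric] D_def[symmetric] by (simp add: power2_eq_square)
    have d7: "((\<lambda>x. (hermite n x)\<^sup>2) has_real_derivative 2 * H * (real n * K)) (at t)"
      using DERIV_mult[OF d1 d1] unfolding power2_eq_square H_def[symmetric] by (simp add: mult_ac)
    have d8: "((\<lambda>x. exp (- (x\<^sup>2 / 2))) has_real_derivative exp (- (t\<^sup>2 / 2)) * (- t)) (at t)"
      by (auto intro!: derivative_eq_intros)
    show ?thesis
      unfolding sonin_def[abs_def]
      by (rule DERIV_cong[OF DERIV_mult[OF d8 DERIV_add[OF d7 d6]]])
        (simp only: D'_def q_def D_def H_def K_def mult.commute)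
  qed
  moreover have "(exp (- (t\<^sup>2 / 2)) * (- t)) * (H\<^sup>2 + D\<^sup>2 / q) + exp (- (t\<^sup>2 / 2)) *
       (2 * H * (real n * K) + (2 * D * (real n * (t * K - H) - (1/2 * H + t / 2 * (real n * K))) * q - D\<^sup>2 * (- t / 2)) / q\<^sup>2)
     = exp (- (t\<^sup>2 / 2)) * (D\<^sup>2 * t / (2 * q\<^sup>2))"
  proof -
    have nK: "real n * K = D + t / 2 * H" by (simp add: D_def K_def H_def)
    have a: "real n * (t * K - H) - (1/2 * H + t / 2 * (real n * K)) = t / 2 * D - q * H"
    proof -
      have "real n * (t * K - H) - (1/2 * H + t / 2 * (real n * K)) = t/2 * (real n * K) - (real n + 1/2) * H"
        by (simp add: algebra_simps)
      also have "\<dots> = t / 2 * D - q * H" unfolding nK by (simp add: q_def algebra_simps power2_eq_square)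
      finally show ?thesis .
    qed
    have "(- t) * (H\<^sup>2 + D\<^sup>2 / q) +
       (2 * H * (D + t / 2 * H) + (2 * D * (t / 2 * D - q * H) * q - D\<^sup>2 * (- t / 2)) / q\<^sup>2) = D\<^sup>2 * t / (2 * q\<^sup>2)"
      using q by (simp add: field_simps power2_eq_square)
    then show ?thesis unfolding a unfolding nK by (simp add: algebra_simps)
  qed
  ultimately show "\<exists>y. DERIV (sonin n) t :> y \<and> 0 \<le> y"
    using t q by (metis divide_nonneg_nonneg exp_ge_zero mult_nonneg_nonneg zero_le_power2 zero_le_numeral)
qed

lemma hermite_zero_even: "even n \<Longrightarrow> fact n \<le> (hermite n 0)\<^sup>2 * real (n + 1)"
proof (induction n rule: less_induct)
  case (less n)
  consider "n = 0" | m where "n = Suc (Suc m)" using less.prems by (metis not0_implies_Suc odd_one One_nat_def)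
  then show ?case
  proof cases
    case (2 m)
    have IH: "fact m \<le> (hermite m 0)\<^sup>2 * real (m + 1)" using less 2 by auto
    have "fact n = (real m + 2) * ((real m + 1) * fact m)" by (simp add: 2 algebra_simps)
    also have "\<dots> \<le> (real m + 3) * ((real m + 1) * ((hermite m 0)\<^sup>2 * real (m + 1)))"
      by (intro mult_mono) (use IH in auto)
    also have "\<dots> = (hermite n 0)\<^sup>2 * real (n + 1)" by (simp add: 2 algebra_simps power2_eq_square)
    finally show ?thesis .
  qed simp
qed

lemma sonin_zero: "n \<ge> 1 \<Longrightarrow> fact n \<le> sonin n 0 * real (n + 1)"
proof (cases "even n")
  case True
  have "sonin n 0 \<ge> (hermite n 0)\<^sup>2" by (simp add: sonin_def)
  then show ?thesis using hermite_zero_even[OF True] by (meson mult_right_mono of_nat_0_le_iff order_trans)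
next
  case False
  then obtain m where m: "n = Suc m" "even m" by (cases n) auto
  have "fact n = (real m + 1) * fact m" by (simp add: m)
  also have "\<dots> \<le> (real m + 1) * ((hermite m 0)\<^sup>2 * real (m + 1))"
    by (intro mult_left_mono) (use hermite_zero_even[OF m(2)] in auto)
  also have "\<dots> = (real n * hermite m 0)\<^sup>2 / (real n + 1) * real (n + 1)"
    by (simp add: m power2_eq_square field_simps)
  also have "\<dots> \<le> sonin n 0 * real (n + 1)"
  proof (intro mult_right_mono)
    have "(real n * hermite m 0)\<^sup>2 / (real n + 1) \<le> (real n * hermite m 0)\<^sup>2 / (real n + 1/2)"
      by (intro divide_left_mono) auto
    then show "(real n * hermite m 0)\<^sup>2 / (real n + 1) \<le> sonin n 0" by (simp add: sonin_def m add_increasing)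
  qed auto
  finally show ?thesis .
qed

text \<open>The value at \<open>x\<close> of the Sonin quantity is at least its value at \<open>0\<close>, which is at least \<open>n! / (n + 1)\<close>.  Since
  it is a quadratic form in \<open>He\<^sub>n(x)\<close> and \<open>He\<^bsub>n-1\<^esub>(x)\<close> with polynomially bounded coefficients, a common
  bound \<open>B\<close> for both cannot be much below \<open>sqrt (n!) exp (x\<^sup>2 / 4)\<close>.\<close>
lemma hermite_lower_bulk:
  assumes n: "n \<ge> 1" and x: "x\<^sup>2 \<le> 4 * real n" and B: "\<bar>hermite n x\<bar> \<le> B" "\<bar>hermite (n - 1) x\<bar> \<le> B"
  shows "fact n * exp (x\<^sup>2 / 2) \<le> B\<^sup>2 * (9 * (real n)\<^sup>2) * (real n + 1)"
proof -
  have pos: "fact n * exp (x\<^sup>2 / 2) \<le> B\<^sup>2 * (9 * (real n)\<^sup>2) * (real n + 1)"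
    if x0: "x \<ge> 0" and x: "x\<^sup>2 \<le> 4 * real n" and B: "\<bar>hermite n x\<bar> \<le> B" "\<bar>hermite (n - 1) x\<bar> \<le> B" for x
  proof -
    have B0: "B \<ge> 0" using B by linarith
    have n1: "real n \<ge> 1" using n by simp
    have x2n: "x \<le> 2 * real n"
    proof (rule power2_le_imp_le)
      show "x\<^sup>2 \<le> (2 * real n)\<^sup>2" using x mult_left_mono[OF n1, of "4 * real n"] by (simp add: power2_eq_square)
    qed simp
    have "\<bar>real n * hermite (n - 1) x - x / 2 * hermite n x\<bar> \<le> real n * B + x / 2 * B"
      using B x0 n1 by (intro order_trans[OF abs_triangle_ineq4] add_mono) (auto simp: abs_mult intro!: mult_left_mono)
    also have "\<dots> \<le> real n * B + real n * B" by (intro add_mono mult_right_mono) (use x2n B0 in auto)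
    finally have D: "\<bar>real n * hermite (n - 1) x - x / 2 * hermite n x\<bar> \<le> 2 * real n * B"
      by (simp add: mult_ac)
    have q: "real n + 1/2 - x\<^sup>2 / 4 \<ge> 1/2" using x by simp
    have "(real n * hermite (n - 1) x - x / 2 * hermite n x)\<^sup>2 / (real n + 1/2 - x\<^sup>2 / 4) \<le> (2 * real n * B)\<^sup>2 / (1/2)"
      by (intro frac_le) (use q D B0 in \<open>auto simp: abs_le_square_iff[symmetric] abs_mult\<close>)
    moreover have "(hermite n x)\<^sup>2 \<le> B\<^sup>2" using B B0 by (auto simp: abs_le_square_iff[symmetric])
    ultimately have "(hermite n x)\<^sup>2 + (real n * hermite (n - 1) x - x / 2 * hermite n x)\<^sup>2 / (real n + 1/2 - x\<^sup>2 / 4)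
        \<le> B\<^sup>2 + 8 * (real n)\<^sup>2 * B\<^sup>2" by (simp add: power_mult_distrib)
    also have "\<dots> \<le> (real n)\<^sup>2 * B\<^sup>2 + 8 * (real n)\<^sup>2 * B\<^sup>2"
      using mult_right_mono[OF one_le_power[OF n1, of 2], of "B\<^sup>2"] by (simp add: mult.commute)
    finally have "sonin n x \<le> exp (- (x\<^sup>2 / 2)) * (B\<^sup>2 * (9 * (real n)\<^sup>2))"
      unfolding sonin_def by (intro mult_left_mono) (auto simp: algebra_simps)
    moreover have "sonin n 0 \<le> sonin n x" using x by (intro sonin_mono x0 n) simp
    ultimately have "sonin n 0 \<le> exp (- (x\<^sup>2 / 2)) * (B\<^sup>2 * (9 * (real n)\<^sup>2))" by linarith
    from mult_right_mono[OF this, of "real n + 1"]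
    have "sonin n 0 * (real n + 1) \<le> exp (- (x\<^sup>2 / 2)) * (B\<^sup>2 * (9 * (real n)\<^sup>2)) * (real n + 1)"
      by simp
    with sonin_zero[OF n, unfolded of_nat_add of_nat_1]
    have "fact n \<le> exp (- (x\<^sup>2 / 2)) * (B\<^sup>2 * (9 * (real n)\<^sup>2)) * (real n + 1)" by (rule order_trans)
    then have "fact n * exp (x\<^sup>2 / 2) \<le> (exp (- (x\<^sup>2 / 2)) * (B\<^sup>2 * (9 * (real n)\<^sup>2)) * (real n + 1)) * exp (x\<^sup>2 / 2)"
      by (intro mult_right_mono) auto
    also have "\<dots> = B\<^sup>2 * (9 * (real n)\<^sup>2) * (real n + 1)" by (simp add: exp_minus field_simps)
    finally show ?thesis .
  qed
  show ?thesis
  proof (cases "x \<ge> 0")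
    case True then show ?thesis using pos[OF _ x B] by simp
  next
    case False
    have "\<bar>hermite k (- x)\<bar> = \<bar>hermite k x\<bar>" for k by (simp add: hermite_minus abs_mult)
    then show ?thesis using False pos[of "-x"] x B by simp
  qed
qed

text \<open>The larger root of \<open>\<rho>\<^sup>2 - x \<rho> + s = 0\<close>, the value at which the recursion
  \<open>\<rho> = x - s / \<rho>\<close> for ratios of Hermite polynomials is stationary.\<close>
definition large_root :: "real \<Rightarrow> real \<Rightarrow> real" where "large_root x s = (x + sqrt (x\<^sup>2 - 4 * s)) / 2"

lemma large_root_quad: assumes "4 * s \<le> x\<^sup>2" shows "large_root x s * (x - large_root x s) = s"
proof -
  have "sqrt (x\<^sup>2 - 4 * s) ^ 2 = x\<^sup>2 - 4 * s" using assms by simp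
  then show ?thesis unfolding large_root_def by (simp add: field_simps power2_eq_square)
qed

lemma large_root_antimono: "s \<le> s' \<Longrightarrow> large_root x s' \<le> large_root x s"
  by (simp add: large_root_def)

lemma large_root_pos: "x > 0 \<Longrightarrow> 4 * s \<le> x\<^sup>2 \<Longrightarrow> large_root x s > 0"
  by (simp add: large_root_def add_pos_nonneg)

text \<open>The ratio \<open>r\<close> of consecutive polynomials follows \<open>r \<mapsto> x - k / r\<close>.  This map is increasing and fixes
  the larger root for the current \<open>k\<close>; that root only decreases with \<open>k\<close>, so the ratio stays above
  it.\<close>
lemma hermite_ratio:
  assumes x: "x > 0" "4 * real n \<le> x\<^sup>2"
  shows "hermite n x > 0 \<and> hermite (Suc n) x \<ge> large_root x (real n) * hermite n x"
  using x(2)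
proof (induction n)
  case 0 show ?case using x(1) by (simp add: large_root_def)
next
  case (Suc n)
  let ?r = "large_root x (real n)" and ?r' = "large_root x (real (Suc n))"
  have n4: "4 * real n \<le> x\<^sup>2" using Suc.prems by simp
  have IH: "hermite n x > 0" "hermite (Suc n) x \<ge> ?r * hermite n x" using Suc.IH n4 by auto
  have r: "?r > 0" "?r' > 0" using large_root_pos x(1) n4 Suc.prems by auto
  have "?r' \<le> ?r" by (rule large_root_antimono) simp
  have H1: "hermite (Suc n) x > 0" using IH r by (meson less_le_trans mult_pos_pos)
  have r'': "real (Suc n) = ?r' * (x - ?r')" using large_root_quad[of "real (Suc n)" x] Suc.prems by simp
  have "?r' * hermite n x \<le> hermite (Suc n) x" using IH \<open>?r' \<le> ?r\<close> by (smt (verit) mult_right_mono)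
  have xr: "x - ?r' > 0" using r'' r by (metis of_nat_0_less_iff zero_less_Suc zero_less_mult_pos)
  have "real (Suc n) * hermite n x = (x - ?r') * (?r' * hermite n x)" using r'' by (metis mult.assoc mult.commute)
  also have "\<dots> \<le> (x - ?r') * hermite (Suc n) x"
    using xr \<open>?r' * hermite n x \<le> hermite (Suc n) x\<close> by (intro mult_left_mono) auto
  finally have "hermite (Suc (Suc n)) x \<ge> ?r' * hermite (Suc n) x" by (simp add: algebra_simps)
  then show ?case using H1 by simp
qed

text \<open>An antiderivative of \<open>s \<mapsto> ln (large_root x s)\<close>.\<close>
definition hermite_rate :: "real \<Rightarrow> real \<Rightarrow> real" where
  "hermite_rate x s = s * ln (large_root x s) - x * large_root x s + (large_root x s)\<^sup>2 / 2"

lemma hermite_rate_deriv: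
  assumes x: "x > 0" "4 * s < x\<^sup>2"
  shows "(hermite_rate x has_real_derivative ln (large_root x s)) (at s)"
proof -
  let ?d = "- (1 / sqrt (x\<^sup>2 - 4 * s))"
  have r: "large_root x s > 0" using large_root_pos x by simp
  have sq: "sqrt (x\<^sup>2 - 4 * s) > 0" using x by simp
  have d: "(large_root x has_real_derivative ?d) (at s)"
    unfolding large_root_def[abs_def] by (rule derivative_eq_intros refl | use x sq in \<open>simp add: field_simps\<close>)+
  have "(hermite_rate x has_real_derivative (1 * ln (large_root x s) + s * (?d / large_root x s)) - x * ?d + 2 * large_root x s * ?d / 2) (at s)"
    unfolding hermite_rate_def[abs_def]
    by (rule derivative_eq_intros d refl | use r in \<open>simp add: field_simps\<close>)+
  moreover have "s * (?d / large_root x s) = (x - large_root x s) * ?d"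
    using large_root_quad[of s x] x r by (simp add: field_simps)
  then have "(1 * ln (large_root x s) + s * (?d / large_root x s)) - x * ?d + 2 * large_root x s * ?d / 2 = ln (large_root x s)"
    by (simp add: algebra_simps diff_divide_distrib)
  ultimately show ?thesis by (simp only:)
qed

lemma hermite_rate_cont:
  assumes x: "x > 0" "4 * t \<le> x\<^sup>2"
  shows "continuous_on {s..t} (hermite_rate x)"
proof -
  have "large_root x u \<noteq> 0" if "u \<in> {s..t}" for u using large_root_pos[of x u] x that by fastforce
  then show ?thesis unfolding hermite_rate_def[abs_def] by (intro continuous_intros) (auto simp: large_root_def intro!: continuous_intros)
qed

text \<open>By \<open>hermite_ratio\<close> the logarithm of \<open>He\<^sub>n(x)\<close> is at least the left Riemann sum of the decreasing
  function \<open>s \<mapsto> ln (large_root x s)\<close>, hence at least its integral over \<open>[0, n]\<close>.  The term \<open>x\<^sup>2 / 2\<close> is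
  minus the antiderivative at \<open>0\<close>.\<close>
lemma hermite_lower_outside:
  assumes x: "x > 0" "4 * real n \<le> x\<^sup>2"
  shows "exp (hermite_rate x (real n) + x\<^sup>2 / 2) \<le> hermite n x"
  using x(2)
proof (induction n)
  case 0 show ?case using x(1) by (simp add: hermite_rate_def large_root_def power2_eq_square)
next
  case (Suc n)
  have n4: "4 * real n < x\<^sup>2" using Suc.prems by simp
  have r: "large_root x (real n) > 0" using large_root_pos x(1) n4 by auto
  have "\<exists>l z. real n < z \<and> z < real (Suc n) \<and> (hermite_rate x has_real_derivative l) (at z) \<and> hermite_rate x (real (Suc n)) - hermite_rate x (real n) = (real (Suc n) - real n) * l"
  proof (rule MVT)
    show "continuous_on {real n..real (Suc n)} (hermite_rate x)" using hermite_rate_cont x(1) Suc.prems by blast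
    fix u assume "real n < u" "u < real (Suc n)"
    then show "hermite_rate x differentiable (at u)"
      using hermite_rate_deriv[of x u] x(1) Suc.prems by (auto simp: real_differentiable_def)
  qed simp
  then obtain l u where u: "real n < u" "u < real (Suc n)" "(hermite_rate x has_real_derivative l) (at u)"
    "hermite_rate x (real (Suc n)) - hermite_rate x (real n) = l" by auto
  have u4: "4 * u < x\<^sup>2" using u Suc.prems by auto
  have "l = ln (large_root x u)" using hermite_rate_deriv[OF x(1) u4] u(3) DERIV_unique by blast
  also have "\<dots> \<le> ln (large_root x (real n))" using large_root_pos[OF x(1), of u] u4 large_root_antimono[of "real n" u x] u r by simp
  finally have "hermite_rate x (real (Suc n)) + x\<^sup>2/2 \<le> ln (large_root x (real n)) + (hermite_rate x (real n) + x\<^sup>2/2)" using u by simp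
  then have "exp (hermite_rate x (real (Suc n)) + x\<^sup>2/2) \<le> large_root x (real n) * exp (hermite_rate x (real n) + x\<^sup>2/2)"
    using r by (metis exp_add exp_le_cancel_iff exp_ln)
  also have "\<dots> \<le> large_root x (real n) * hermite n x" using r Suc n4 by (intro mult_left_mono) auto
  also have "\<dots> \<le> hermite (Suc n) x" using hermite_ratio[OF x(1), of n] n4 by auto
  finally show ?case .
qed

section \<open>Random variables built from independent Gaussian entries\<close>

text \<open>Only the entries on and above the diagonal are listed; the normalisation is that of \<open>sqrt N W\<close>
  for \<open>W\<close> from the Gaussian orthogonal ensemble.\<close>
locale gaussian_matrix = prob_space M for M :: "'a measure" +
  fixes g :: "nat \<times> nat \<Rightarrow> 'a \<Rightarrow> real" and N :: nat
  assumes indep: "indep_vars (\<lambda>_. borel) g {(i, j). i \<le> j \<and> j < N}"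
    and normal: "\<And>i j. i \<le> j \<Longrightarrow> j < N \<Longrightarrow> distributed M lborel (g (i, j))
      (\<lambda>x. ennreal (normal_density 0 (sqrt (1 + (if i = j then 1 else 0))) x))"
begin

definition entries :: "(nat \<times> nat) set" where "entries = {(i, j). i \<le> j \<and> j < N}"

text \<open>A random variable is tame over \<open>J\<close> if it is a measurable function of the entries in \<open>J\<close> and has
  all absolute moments.  The class is closed under ring operations and under \<open>sgn\<close>, and products of
  tame variables over disjoint sets factorise in the mean, so neither integrability nor independence
  needs a separate argument later.\<close>
definition tame :: "(nat \<times> nat) set \<Rightarrow> ('a \<Rightarrow> real) \<Rightarrow> bool" where
  "tame J Y \<longleftrightarrow> J \<subseteq> entries \<and>
     (\<exists>F \<in> borel_measurable (Pi\<^sub>M J (\<lambda>_. borel)). \<forall>\<omega>\<in>space M. Y \<omega> = F (restrict (\<lambda>e. g e \<omega>) J)) \<and>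
     (\<forall>k. integrable M (\<lambda>\<omega>. \<bar>Y \<omega>\<bar> ^ k))"

lemma g_measurable: "e \<in> entries \<Longrightarrow> g e \<in> borel_measurable M"
  using indep by (auto simp: indep_vars_def entries_def)

lemma restrict_measurable: "J \<subseteq> entries \<Longrightarrow> (\<lambda>\<omega>. restrict (\<lambda>e. g e \<omega>) J) \<in> measurable M (Pi\<^sub>M J (\<lambda>_. borel))"
  by (intro measurable_restrict) (use g_measurable in auto)

lemma tame_measurable: assumes "tame J Y" shows "Y \<in> borel_measurable M"
proof -
  obtain F where F: "F \<in> borel_measurable (Pi\<^sub>M J (\<lambda>_. borel))" "\<forall>\<omega>\<in>space M. Y \<omega> = F (restrict (\<lambda>e. g e \<omega>) J)"
    and J: "J \<subseteq> entries" using assms by (auto simp: tame_def)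
  have "(\<lambda>\<omega>. F (restrict (\<lambda>e. g e \<omega>) J)) \<in> borel_measurable M"
    by (rule measurable_compose[OF restrict_measurable[OF J] F(1)])
  then show ?thesis using F(2) by (subst measurable_cong) auto
qed

lemma tame_integrable: assumes "tame J Y" shows "integrable M Y"
proof -
  have "integrable M (\<lambda>\<omega>. \<bar>Y \<omega>\<bar>)" using assms by (auto simp: tame_def dest: spec[of _ 1])
  then show ?thesis using tame_measurable[OF assms] integrable_abs_cancel by blast
qed

lemma tame_mono: assumes "tame J Y" "J \<subseteq> K" "K \<subseteq> entries" shows "tame K Y"
proof -
  obtain F where F: "F \<in> borel_measurable (Pi\<^sub>M J (\<lambda>_. borel))" "\<forall>\<omega>\<in>space M. Y \<omega> = F (restrict (\<lambda>e. g e \<omega>) J)"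
    using assms by (auto simp: tame_def)
  have "(\<lambda>h. F (restrict h J)) \<in> borel_measurable (Pi\<^sub>M K (\<lambda>_. borel))"
    by (rule measurable_compose[OF measurable_restrict_subset[OF assms(2)] F(1)])
  moreover have "Y \<omega> = F (restrict (restrict (\<lambda>e. g e \<omega>) K) J)" if "\<omega> \<in> space M" for \<omega>
    using assms(2) F(2) that by (simp add: Int_absorb1)
  moreover have "integrable M (\<lambda>\<omega>. \<bar>Y \<omega>\<bar> ^ k)" for k using assms(1) by (simp add: tame_def)
  ultimately show ?thesis using assms(3) unfolding tame_def
    by (intro conjI bexI[of _ "\<lambda>h. F (restrict h J)"]) auto
qed

lemma tame_const: "J \<subseteq> entries \<Longrightarrow> tame J (\<lambda>_. c)"
  unfolding tame_def by auto

text \<open>Covers sums, products and signs at once: each is dominated by \<open>1 + a\<^sup>2 + b\<^sup>2\<close>, whose powers are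
  integrable.\<close>
lemma tame_combine:
  assumes Y: "tame J Y" and Z: "tame J Z" and h: "(\<lambda>p. h (fst p) (snd p)) \<in> borel_measurable (borel \<Otimes>\<^sub>M borel)"
    and bd: "\<And>a b. \<bar>h a b\<bar> \<le> 1 + a\<^sup>2 + b\<^sup>2"
  shows "tame J (\<lambda>\<omega>. h (Y \<omega>) (Z \<omega>))"
proof -
  obtain F where F: "F \<in> borel_measurable (Pi\<^sub>M J (\<lambda>_. borel))" "\<forall>\<omega>\<in>space M. Y \<omega> = F (restrict (\<lambda>e. g e \<omega>) J)"
    using Y by (auto simp: tame_def)
  obtain G where G: "G \<in> borel_measurable (Pi\<^sub>M J (\<lambda>_. borel))" "\<forall>\<omega>\<in>space M. Z \<omega> = G (restrict (\<lambda>e. g e \<omega>) J)"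
    using Z by (auto simp: tame_def)
  have "(\<lambda>x. (F x, G x)) \<in> measurable (Pi\<^sub>M J (\<lambda>_. borel)) (borel \<Otimes>\<^sub>M borel)"
    by (rule measurable_Pair[OF F(1) G(1)])
  from measurable_compose[OF this h]
  have FG: "(\<lambda>x. h (F x) (G x)) \<in> borel_measurable (Pi\<^sub>M J (\<lambda>_. borel))" by simp
  have "(\<lambda>x. (Y x, Z x)) \<in> measurable M (borel \<Otimes>\<^sub>M borel)"
    by (rule measurable_Pair[OF tame_measurable[OF Y] tame_measurable[OF Z]])
  from measurable_compose[OF this h]
  have m: "(\<lambda>x. h (Y x) (Z x)) \<in> borel_measurable M" by simp
  have "integrable M (\<lambda>\<omega>. \<bar>h (Y \<omega>) (Z \<omega>)\<bar> ^ k)" for k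
  proof (rule Bochner_Integration.integrable_bound)
    show "integrable M (\<lambda>\<omega>. 3 ^ k * (1 + \<bar>Y \<omega>\<bar> ^ (2 * k) + \<bar>Z \<omega>\<bar> ^ (2 * k)))"
      using Y Z by (auto simp: tame_def)
    have "\<bar>h a b\<bar> ^ k \<le> 3 ^ k * (1 + \<bar>a\<bar> ^ (2 * k) + \<bar>b\<bar> ^ (2 * k))" for a b
    proof -
      define m where "m = max 1 (max (a\<^sup>2) (b\<^sup>2))"
      have "\<bar>h a b\<bar> \<le> 3 * m" using bd[of a b] unfolding m_def by linarith
      then have "\<bar>h a b\<bar> ^ k \<le> (3 * m) ^ k" by (intro power_mono) auto
      also have "\<dots> = 3 ^ k * m ^ k" by (simp add: power_mult_distrib)
      also have "m ^ k \<le> 1 + \<bar>a\<bar> ^ (2 * k) + \<bar>b\<bar> ^ (2 * k)"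
        by (auto simp: m_def max_def power_mult)
      finally show ?thesis by simp
    qed
    then show "AE \<omega> in M. norm (\<bar>h (Y \<omega>) (Z \<omega>)\<bar> ^ k) \<le> norm (3 ^ k * (1 + \<bar>Y \<omega>\<bar> ^ (2 * k) + \<bar>Z \<omega>\<bar> ^ (2 * k)))"
      by (auto simp: abs_mult)
  qed (use m in measurable)
  moreover have "J \<subseteq> entries" using Y by (simp add: tame_def)
  ultimately show ?thesis unfolding tame_def
    by (intro conjI bexI[OF _ FG]) (auto simp: F(2) G(2))
qed

lemma tame_add: "tame J Y \<Longrightarrow> tame J Z \<Longrightarrow> tame J (\<lambda>\<omega>. Y \<omega> + Z \<omega>)"
proof (rule tame_combine[where h = "(+)"])
  fix a b :: real
  have "\<bar>c\<bar> \<le> 1 / 2 + c\<^sup>2" for c :: real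
    using sum_squares_bound[of "1 / 2" "\<bar>c\<bar>"] zero_le_power2[of c] by (simp add: power2_eq_square)
  from this[of a] this[of b] show "\<bar>a + b\<bar> \<le> 1 + a\<^sup>2 + b\<^sup>2" by linarith
qed measurable

lemma tame_mult: "tame J Y \<Longrightarrow> tame J Z \<Longrightarrow> tame J (\<lambda>\<omega>. Y \<omega> * Z \<omega>)"
proof (rule tame_combine[where h = "(*)"])
  fix a b :: real
  have "2 * (\<bar>a\<bar> * \<bar>b\<bar>) \<le> a\<^sup>2 + b\<^sup>2" using sum_squares_bound[of "\<bar>a\<bar>" "\<bar>b\<bar>"] by simp
  then show "\<bar>a * b\<bar> \<le> 1 + a\<^sup>2 + b\<^sup>2" unfolding abs_mult using zero_le_power2[of a] zero_le_power2[of b] by linarith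
qed measurable

lemma tame_sgn: "tame J Y \<Longrightarrow> tame J (\<lambda>\<omega>. sgn (Y \<omega>))"
  by (rule tame_combine[where h = "\<lambda>a b. sgn a" and Z = Y]) (simp_all add: sgn_if add_nonneg_nonneg)

lemma tame_uminus: "tame J Y \<Longrightarrow> tame J (\<lambda>\<omega>. - Y \<omega>)"
  using tame_mult[OF tame_const[of J "-1"], of Y] by (auto simp: tame_def)

lemma tame_diff: "tame J Y \<Longrightarrow> tame J Z \<Longrightarrow> tame J (\<lambda>\<omega>. Y \<omega> - Z \<omega>)"
  using tame_add[OF _ tame_uminus, of J Y Z] by simp

lemma tame_abs: "tame J Y \<Longrightarrow> tame J (\<lambda>\<omega>. \<bar>Y \<omega>\<bar>)"
  using tame_mult[OF _ tame_sgn, of J Y Y] by (simp add: abs_sgn mult.commute)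

lemma tame_sum: "J \<subseteq> entries \<Longrightarrow> (\<And>i. i \<in> A \<Longrightarrow> tame J (Y i)) \<Longrightarrow> tame J (\<lambda>\<omega>. \<Sum>i\<in>A. Y i \<omega>)"
  by (induction A rule: infinite_finite_induct) (auto intro!: tame_const tame_add)

lemma tame_prod: "J \<subseteq> entries \<Longrightarrow> (\<And>i. i \<in> A \<Longrightarrow> tame J (Y i)) \<Longrightarrow> tame J (\<lambda>\<omega>. \<Prod>i\<in>A. Y i \<omega>)"
  by (induction A rule: infinite_finite_induct) (auto intro!: tame_const tame_mult)

lemma tame_power: "tame J Y \<Longrightarrow> tame J (\<lambda>\<omega>. Y \<omega> ^ k)"
  by (induction k) (auto intro!: tame_const tame_mult simp: tame_def[of J Y])

lemma g_moment:
  assumes "i \<le> j" "j < N" and h: "h \<in> borel_measurable borel"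
  shows "expectation (\<lambda>\<omega>. h (g (i, j) \<omega>)) = (\<integral>x. normal_density 0 (sqrt (1 + (if i = j then 1 else 0))) x * h x \<partial>lborel)"
  by (rule distributed_integral[OF normal[OF assms(1,2)], symmetric]) (use h in auto)

lemma tame_g: assumes "e \<in> entries" shows "tame {e} (g e)"
proof -
  obtain i j where e: "e = (i, j)" "i \<le> j" "j < N" using assms by (auto simp: entries_def)
  have "integrable M (\<lambda>\<omega>. \<bar>g e \<omega>\<bar> ^ k)" for k
    using distributed_integrable[OF normal[OF e(2,3)], of "\<lambda>x. \<bar>x\<bar> ^ k"] integrable_normal_moment_abs[of "sqrt (1 + (if i = j then 1 else 0))" 0 k]
    by (auto simp: e)
  moreover have "(\<lambda>h. h e) \<in> borel_measurable (Pi\<^sub>M {e} (\<lambda>_. borel))" by measurable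
  ultimately show ?thesis using assms unfolding tame_def by (auto intro!: bexI[of _ "\<lambda>h. h e"])
qed

lemma tame_indep:
  assumes Y: "tame J Y" and Z: "tame K Z" and disj: "J \<inter> K = {}"
  shows "expectation (\<lambda>\<omega>. Y \<omega> * Z \<omega>) = expectation Y * expectation Z"
proof -
  obtain F where F: "F \<in> borel_measurable (Pi\<^sub>M J (\<lambda>_. borel))" "\<forall>\<omega>\<in>space M. Y \<omega> = F (restrict (\<lambda>e. g e \<omega>) J)"
    using Y by (auto simp: tame_def)
  obtain G where G: "G \<in> borel_measurable (Pi\<^sub>M K (\<lambda>_. borel))" "\<forall>\<omega>\<in>space M. Z \<omega> = G (restrict (\<lambda>e. g e \<omega>) K)"
    using Z by (auto simp: tame_def)
  let ?Y = "F \<circ> (\<lambda>\<omega>. restrict (\<lambda>e. g e \<omega>) J)" and ?Z = "G \<circ> (\<lambda>\<omega>. restrict (\<lambda>e. g e \<omega>) K)"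
  have "indep_var (Pi\<^sub>M J (\<lambda>_. borel)) (\<lambda>\<omega>. restrict (\<lambda>e. g e \<omega>) J) (Pi\<^sub>M K (\<lambda>_. borel)) (\<lambda>\<omega>. restrict (\<lambda>e. g e \<omega>) K)"
    by (rule indep_var_restrict[OF indep disj]) (use Y Z in \<open>auto simp: tame_def entries_def\<close>)
  then have ind: "indep_var borel ?Y borel ?Z"
    by (rule indep_var_compose) (use F G in auto)
  have "expectation (\<lambda>\<omega>. Y \<omega> * Z \<omega>) = expectation (\<lambda>\<omega>. ?Y \<omega> * ?Z \<omega>)"
    by (intro Bochner_Integration.integral_cong) (use F G in auto)
  also have "\<dots> = expectation ?Y * expectation ?Z"
  proof (rule indep_var_lebesgue_integral[OF ind])
    show "integrable M ?Y" using tame_integrable[OF Y] F by (subst Bochner_Integration.integrable_cong[of M M _ Y]) auto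
    show "integrable M ?Z" using tame_integrable[OF Z] G by (subst Bochner_Integration.integrable_cong[of M M _ Z]) auto
  qed
  also have "expectation ?Y = expectation Y" by (intro Bochner_Integration.integral_cong) (use F in auto)
  also have "expectation ?Z = expectation Z" by (intro Bochner_Integration.integral_cong) (use G in auto)
  finally show ?thesis .
qed

lemma g_odd_moment:
  assumes "(i, j) \<in> entries" and h: "h \<in> borel_measurable borel" "\<And>x. h (- x) = - (h x :: real)"
  shows "expectation (\<lambda>\<omega>. h (g (i, j) \<omega>)) = 0"
proof -
  let ?f = "\<lambda>x. normal_density 0 (sqrt (1 + (if i = j then 1 else 0))) x * h x"
  have "integral\<^sup>L lborel ?f = \<bar>- 1\<bar> *\<^sub>R (\<integral>x. ?f (0 + (- 1) * x) \<partial>lborel)"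
    by (rule lborel_integral_real_affine) simp
  also have "(\<lambda>x. ?f (0 + (- 1) * x)) = (\<lambda>x. - ?f x)" by (auto simp: h(2) normal_density_def)
  finally have "integral\<^sup>L lborel ?f = 0" by simp
  then show ?thesis using g_moment[of i j h] assms by (auto simp: entries_def)
qed

lemma g_mean: "e \<in> entries \<Longrightarrow> expectation (g e) = 0"
  using g_odd_moment[of "fst e" "snd e" "\<lambda>x. x"] by simp

lemma g_cube: "e \<in> entries \<Longrightarrow> expectation (\<lambda>\<omega>. g e \<omega> ^ 3) = 0"
  using g_odd_moment[of "fst e" "snd e" "\<lambda>x. x ^ 3"] by simp

lemma g_sgn: "e \<in> entries \<Longrightarrow> expectation (\<lambda>\<omega>. sgn (g e \<omega>)) = 0"
  using g_odd_moment[of "fst e" "snd e" sgn] by (simp add: sgn_minus)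

lemma g_square: "i \<le> j \<Longrightarrow> j < N \<Longrightarrow> expectation (\<lambda>\<omega>. (g (i, j) \<omega>)\<^sup>2) = 1 + (if i = j then 1 else 0)"
  using g_moment[of i j "\<lambda>x. x ^ 2"] integral_normal_moment_even[of "sqrt (1 + (if i = j then 1 else 0))" 0 1]
  by (auto simp: fact_numeral)

lemma g_fourth: "i < j \<Longrightarrow> j < N \<Longrightarrow> expectation (\<lambda>\<omega>. g (i, j) \<omega> ^ 4) = 3"
  using g_moment[of i j "\<lambda>x. x ^ 4"] integral_normal_moment_even[of 1 0 2]
  by (auto simp: fact_numeral)

lemma g_abs_diag: "i < N \<Longrightarrow> 1 \<le> expectation (\<lambda>\<omega>. \<bar>g (i, i) \<omega>\<bar>)"
proof -
  assume i: "i < N"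
  have "expectation (\<lambda>\<omega>. \<bar>g (i, i) \<omega>\<bar>) = sqrt 2 * sqrt (2 / pi)"
    using g_moment[of i i "\<lambda>x. \<bar>x\<bar>"] i integral_normal_moment_abs_odd[of "sqrt 2" 0 0] by auto
  also have "\<dots> = sqrt (4 / pi)" by (simp flip: real_sqrt_mult)
  finally show ?thesis using pi_less_4 by simp
qed

text \<open>Test \<open>Y g + Z\<close> against \<open>sgn Y sgn g\<close>: the term with \<open>Z\<close> has mean zero because \<open>g\<close> is symmetric and
  independent of \<open>(Y, Z)\<close>.\<close>
lemma abs_affine_ge:
  assumes Y: "tame K Y" and Z: "tame K Z" and e: "e \<in> entries" "e \<notin> K"
  shows "expectation (\<lambda>\<omega>. \<bar>Y \<omega>\<bar>) * expectation (\<lambda>\<omega>. \<bar>g e \<omega>\<bar>) \<le> expectation (\<lambda>\<omega>. \<bar>Y \<omega> * g e \<omega> + Z \<omega>\<bar>)"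
proof -
  have K: "K \<subseteq> entries" using Y by (simp add: tame_def)
  have g: "tame {e} (g e)" by (rule tame_g[OF e(1)])
  have up: "tame entries T" if "tame J T" for J T using tame_mono[OF that, of entries] that by (auto simp: tame_def)
  note ups = up[OF Y] up[OF Z] up[OF g]
  have "expectation (\<lambda>\<omega>. \<bar>Y \<omega>\<bar>) * expectation (\<lambda>\<omega>. \<bar>g e \<omega>\<bar>) = expectation (\<lambda>\<omega>. \<bar>Y \<omega>\<bar> * \<bar>g e \<omega>\<bar>)"
    by (rule tame_indep[symmetric, OF tame_abs[OF Y] tame_abs[OF g]]) (use e in auto)
  also have "\<dots> = expectation (\<lambda>\<omega>. \<bar>Y \<omega>\<bar> * \<bar>g e \<omega>\<bar>) + expectation (\<lambda>\<omega>. (Z \<omega> * sgn (Y \<omega>)) * sgn (g e \<omega>))"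
    by (subst tame_indep[OF tame_mult[OF Z tame_sgn[OF Y]] tame_sgn[OF g]]) (use e g_sgn in auto)
  also have "\<dots> = expectation (\<lambda>\<omega>. \<bar>Y \<omega>\<bar> * \<bar>g e \<omega>\<bar> + (Z \<omega> * sgn (Y \<omega>)) * sgn (g e \<omega>))"
    by (intro Bochner_Integration.integral_add[symmetric] tame_integrable[of entries] tame_mult tame_abs tame_sgn ups)
  also have "\<dots> \<le> expectation (\<lambda>\<omega>. \<bar>Y \<omega> * g e \<omega> + Z \<omega>\<bar>)"
  proof (intro integral_mono tame_integrable[of entries] tame_mult tame_abs tame_sgn tame_add ups)
    fix \<omega>
    have "\<bar>Y \<omega>\<bar> * \<bar>g e \<omega>\<bar> + (Z \<omega> * sgn (Y \<omega>)) * sgn (g e \<omega>) = (Y \<omega> * g e \<omega> + Z \<omega>) * (sgn (Y \<omega>) * sgn (g e \<omega>))"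
      by (simp add: abs_sgn algebra_simps)
    also have "\<dots> \<le> \<bar>(Y \<omega> * g e \<omega> + Z \<omega>) * (sgn (Y \<omega>) * sgn (g e \<omega>))\<bar>" by simp
    also have "\<dots> \<le> \<bar>Y \<omega> * g e \<omega> + Z \<omega>\<bar>"
      by (simp add: abs_mult sgn_if)
    finally show "\<bar>Y \<omega>\<bar> * \<bar>g e \<omega>\<bar> + (Z \<omega> * sgn (Y \<omega>)) * sgn (g e \<omega>) \<le> \<bar>Y \<omega> * g e \<omega> + Z \<omega>\<bar>" .
  qed
  finally show ?thesis .
qed

end

section \<open>Quadratic forms in a fresh Gaussian row\<close>

context gaussian_matrix begin

lemma tame_up: "tame J Y \<Longrightarrow> tame entries Y"
  using tame_mono[of J Y entries] by (auto simp: tame_def)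

lemma tame_ent: "tame J Y \<Longrightarrow> J \<subseteq> entries"
  by (auto simp: tame_def)

lemma tame_g_in: "e \<in> J \<Longrightarrow> J \<subseteq> entries \<Longrightarrow> tame J (g e)"
  by (rule tame_mono[OF tame_g]) auto

definition offdiag :: "(nat \<times> nat) set" where "offdiag = {(i, j). i < j \<and> j < N}"

lemma offdiag_entries: "offdiag \<subseteq> entries"
  by (auto simp: offdiag_def entries_def)

lemma E_mean_zero: "tame K Z \<Longrightarrow> e \<in> entries \<Longrightarrow> e \<notin> K \<Longrightarrow> expectation (\<lambda>\<omega>. g e \<omega> * Z \<omega>) = 0"
  by (subst tame_indep[OF tame_g]) (auto simp: g_mean)

lemma E_cube_zero: "tame K Z \<Longrightarrow> e \<in> entries \<Longrightarrow> e \<notin> K \<Longrightarrow> expectation (\<lambda>\<omega>. g e \<omega> ^ 3 * Z \<omega>) = 0"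
  by (subst tame_indep[OF tame_power[OF tame_g]]) (auto simp: g_cube)

lemma E_square_one: "tame K Z \<Longrightarrow> e \<in> offdiag \<Longrightarrow> e \<notin> K \<Longrightarrow> expectation (\<lambda>\<omega>. (g e \<omega>)\<^sup>2 * Z \<omega>) = expectation Z"
  using offdiag_entries by (subst tame_indep[OF tame_power[OF tame_g]]) (auto simp: offdiag_def g_square)

lemma E_fourth_three: "tame K Z \<Longrightarrow> e \<in> offdiag \<Longrightarrow> e \<notin> K \<Longrightarrow> expectation (\<lambda>\<omega>. g e \<omega> ^ 4 * Z \<omega>) = 3 * expectation Z"
  using offdiag_entries by (subst tame_indep[OF tame_power[OF tame_g]]) (auto simp: offdiag_def g_fourth)

lemma E_pair:
  assumes Z: "tame K Z" and e: "e \<in> offdiag" "e \<notin> K" "e' \<in> offdiag" "e' \<notin> K"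
  shows "expectation (\<lambda>\<omega>. g e \<omega> * g e' \<omega> * Z \<omega>) = (if e = e' then expectation Z else 0)"
proof (cases "e = e'")
  case True
  then show ?thesis using E_square_one[OF Z e(1,2)] by (simp add: power2_eq_square)
next
  case False
  have "tame (insert e' K) (\<lambda>\<omega>. g e' \<omega> * Z \<omega>)"
    using offdiag_entries e tame_ent[OF Z] by (intro tame_mult tame_g_in tame_mono[OF Z]) auto
  from E_mean_zero[OF this, of e] show ?thesis using False e offdiag_entries by (auto simp: mult.assoc)
qed

lemmas tame_intros = tame_mult tame_add tame_diff tame_sum tame_power tame_uminus

lemma E_sum: "(\<And>i. i \<in> A \<Longrightarrow> tame entries (Y i)) \<Longrightarrow> expectation (\<lambda>\<omega>. \<Sum>i\<in>A. Y i \<omega>) = (\<Sum>i\<in>A. expectation (Y i))"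
  by (intro Bochner_Integration.integral_sum tame_integrable)

lemma E_add: "tame entries Y \<Longrightarrow> tame entries Z \<Longrightarrow> expectation (\<lambda>\<omega>. Y \<omega> + Z \<omega>) = expectation Y + expectation Z"
  by (intro Bochner_Integration.integral_add tame_integrable)

lemma E_diff: "tame entries Y \<Longrightarrow> tame entries Z \<Longrightarrow> expectation (\<lambda>\<omega>. Y \<omega> - Z \<omega>) = expectation Y - expectation Z"
  by (intro Bochner_Integration.integral_diff tame_integrable)

lemma tame_g_off: "e \<in> offdiag \<Longrightarrow> tame entries (g e)"
  by (metis offdiag_entries subsetD subset_refl tame_g_in)

lemma E_linear_square:
  assumes S: "inj_on e S" "e ` S \<subseteq> offdiag" "e ` S \<inter> K = {}"
    and A: "\<And>i. i \<in> S \<Longrightarrow> tame K (A i)"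
  shows "expectation (\<lambda>\<omega>. (\<Sum>i\<in>S. g (e i) \<omega> * A i \<omega>)\<^sup>2) = (\<Sum>i\<in>S. expectation (\<lambda>\<omega>. (A i \<omega>)\<^sup>2))"
proof (cases "finite S")
  case True
  have gi: "tame entries (g (e i))" if "i \<in> S" for i using that S by (auto intro: tame_g_off)
  have Ai: "tame entries (A i)" if "i \<in> S" for i using that A tame_up by blast
  have "expectation (\<lambda>\<omega>. (\<Sum>i\<in>S. g (e i) \<omega> * A i \<omega>)\<^sup>2)
    = expectation (\<lambda>\<omega>. \<Sum>i\<in>S. \<Sum>j\<in>S. g (e i) \<omega> * g (e j) \<omega> * (A i \<omega> * A j \<omega>))"
    by (simp add: power2_eq_square sum_product mult_ac)
  also have "\<dots> = (\<Sum>i\<in>S. \<Sum>j\<in>S. expectation (\<lambda>\<omega>. g (e i) \<omega> * g (e j) \<omega> * (A i \<omega> * A j \<omega>)))"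
    by (subst E_sum, intro tame_intros gi Ai order_refl; assumption?) (intro sum.cong refl E_sum tame_intros gi Ai)
  also have "\<dots> = (\<Sum>i\<in>S. \<Sum>j\<in>S. if i = j then expectation (\<lambda>\<omega>. (A i \<omega>)\<^sup>2) else 0)"
  proof (intro sum.cong refl)
    fix i j assume ij: "i \<in> S" "j \<in> S"
    have "expectation (\<lambda>\<omega>. g (e i) \<omega> * g (e j) \<omega> * (A i \<omega> * A j \<omega>)) = (if e i = e j then expectation (\<lambda>\<omega>. A i \<omega> * A j \<omega>) else 0)"
      by (rule E_pair[OF tame_mult[OF A A]]) (use ij S in auto)
    then show "expectation (\<lambda>\<omega>. g (e i) \<omega> * g (e j) \<omega> * (A i \<omega> * A j \<omega>)) = (if i = j then expectation (\<lambda>\<omega>. (A i \<omega>)\<^sup>2) else 0)"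
      using ij S(1) by (auto simp: inj_on_def power2_eq_square)
  qed
  also have "\<dots> = (\<Sum>i\<in>S. expectation (\<lambda>\<omega>. (A i \<omega>)\<^sup>2))" using True by simp
  finally show ?thesis .
qed simp

lemma E_quad:
  assumes S: "inj_on e S" "e ` S \<subseteq> offdiag" "e ` S \<inter> K = {}"
    and C: "\<And>i j. i \<in> S \<Longrightarrow> j \<in> S \<Longrightarrow> tame K (C i j)" and Z: "tame K Z"
  shows "expectation (\<lambda>\<omega>. (\<Sum>i\<in>S. \<Sum>j\<in>S. g (e i) \<omega> * g (e j) \<omega> * C i j \<omega>) * Z \<omega>) = (\<Sum>i\<in>S. expectation (\<lambda>\<omega>. C i i \<omega> * Z \<omega>))"
proof (cases "finite S")
  case True
  have gi: "tame entries (g (e i))" if "i \<in> S" for i using that S by (auto intro: tame_g_off)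
  have Cij: "tame entries (C i j)" if "i \<in> S" "j \<in> S" for i j using that C tame_up by blast
  have "expectation (\<lambda>\<omega>. (\<Sum>i\<in>S. \<Sum>j\<in>S. g (e i) \<omega> * g (e j) \<omega> * C i j \<omega>) * Z \<omega>)
    = expectation (\<lambda>\<omega>. \<Sum>i\<in>S. \<Sum>j\<in>S. g (e i) \<omega> * g (e j) \<omega> * (C i j \<omega> * Z \<omega>))"
    by (simp add: sum_distrib_right mult.assoc)
  also have "\<dots> = (\<Sum>i\<in>S. \<Sum>j\<in>S. expectation (\<lambda>\<omega>. g (e i) \<omega> * g (e j) \<omega> * (C i j \<omega> * Z \<omega>)))"
    by (subst E_sum, intro tame_intros gi Cij tame_up[OF Z] order_refl; assumption?) (intro sum.cong refl E_sum tame_intros gi Cij tame_up[OF Z])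
  also have "\<dots> = (\<Sum>i\<in>S. \<Sum>j\<in>S. if i = j then expectation (\<lambda>\<omega>. C i i \<omega> * Z \<omega>) else 0)"
  proof (intro sum.cong refl)
    fix i j assume ij: "i \<in> S" "j \<in> S"
    have "expectation (\<lambda>\<omega>. g (e i) \<omega> * g (e j) \<omega> * (C i j \<omega> * Z \<omega>)) = (if e i = e j then expectation (\<lambda>\<omega>. C i j \<omega> * Z \<omega>) else 0)"
      by (rule E_pair[OF tame_mult[OF C Z]]) (use ij S in auto)
    then show "expectation (\<lambda>\<omega>. g (e i) \<omega> * g (e j) \<omega> * (C i j \<omega> * Z \<omega>)) = (if i = j then expectation (\<lambda>\<omega>. C i i \<omega> * Z \<omega>) else 0)"
      using ij S(1) by (auto simp: inj_on_def)
  qed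
  also have "\<dots> = (\<Sum>i\<in>S. expectation (\<lambda>\<omega>. C i i \<omega> * Z \<omega>))" using True by simp
  finally show ?thesis .
qed simp

text \<open>The fourth moment formula for a Gaussian vector with independent standard coordinates \<open>u\<^sub>i\<close> and
  independent symmetric coefficients: \<open>E (u\<^sup>T C u)\<^sup>2 = E (tr C)\<^sup>2 + 2 E tr (C\<^sup>2)\<close>.  Induction on the index
  set avoids the case analysis on coincidences among four indices: only the power of one coordinate
  has to be integrated at a time.\<close>
lemma E_quad_square:
  assumes S: "finite S" "inj_on e S" "e ` S \<subseteq> offdiag" "e ` S \<inter> K = {}"
    and C: "\<And>i j. i \<in> S \<Longrightarrow> j \<in> S \<Longrightarrow> tame K (C i j)" and sym: "\<And>i j \<omega>. i \<in> S \<Longrightarrow> j \<in> S \<Longrightarrow> C i j \<omega> = C j i \<omega>"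
  shows "expectation (\<lambda>\<omega>. (\<Sum>i\<in>S. \<Sum>j\<in>S. g (e i) \<omega> * g (e j) \<omega> * C i j \<omega>)\<^sup>2)
    = (\<Sum>i\<in>S. \<Sum>k\<in>S. expectation (\<lambda>\<omega>. C i i \<omega> * C k k \<omega>)) + 2 * (\<Sum>i\<in>S. \<Sum>j\<in>S. expectation (\<lambda>\<omega>. (C i j \<omega>)\<^sup>2))"
  using assms
proof (induction S)
  case (insert a S)
  define u where "u = g (e a)"
  define L where "L \<omega> = (\<Sum>j\<in>S. g (e j) \<omega> * C a j \<omega>)" for \<omega>
  define Q where "Q \<omega> = (\<Sum>i\<in>S. \<Sum>j\<in>S. g (e i) \<omega> * g (e j) \<omega> * C i j \<omega>)" for \<omega>
  define A where "A = C a a"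
  define K' where "K' = K \<union> e ` S"
  have Kent: "K \<subseteq> entries" using insert.prems(4)[of a a] tame_ent by blast
  have off: "e ` S \<subseteq> offdiag" "e a \<in> offdiag" and disj: "e ` S \<inter> K = {}" "e a \<notin> K" and inj: "inj_on e S"
    using insert.prems by auto
  have K': "K \<subseteq> K'" "K' \<subseteq> entries" "e ` S \<subseteq> K'" using Kent off offdiag_entries by (auto simp: K'_def)
  have ea: "e a \<notin> K'" using disj insert by (auto simp: K'_def)
  have C': "tame K' (C i j)" if "i \<in> insert a S" "j \<in> insert a S" for i j
    using tame_mono[OF insert.prems(4)[OF that] K'(1,2)] .
  have gS: "tame K' (g (e i))" if "i \<in> S" for i using K' that by (intro tame_g_in) auto
  have tL: "tame K' L" unfolding L_def by (intro tame_intros K' gS C') auto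
  have tQ: "tame K' Q" unfolding Q_def by (intro tame_intros K' gS C') auto
  have tA: "tame K' A" unfolding A_def by (intro C') auto
  have tu: "tame entries u" unfolding u_def by (rule tame_g_off[OF off(2)])
  note tt = tame_up[OF tL] tame_up[OF tQ] tame_up[OF tA] tu
  have ex: "(\<Sum>i\<in>insert a S. \<Sum>j\<in>insert a S. g (e i) \<omega> * g (e j) \<omega> * C i j \<omega>) = (u \<omega>)\<^sup>2 * A \<omega> + 2 * u \<omega> * L \<omega> + Q \<omega>" for \<omega>
  proof -
    have "(\<Sum>i\<in>S. g (e i) \<omega> * g (e a) \<omega> * C i a \<omega>) = u \<omega> * L \<omega>"
      unfolding L_def u_def sum_distrib_left using insert.prems(5) by (intro sum.cong refl) auto
    moreover have "(\<Sum>j\<in>S. g (e a) \<omega> * g (e j) \<omega> * C a j \<omega>) = u \<omega> * L \<omega>"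
      unfolding L_def u_def sum_distrib_left by (intro sum.cong refl) auto
    ultimately show ?thesis using insert.hyps
      by (simp add: sum.distrib Q_def u_def A_def power2_eq_square)
  qed
  have "expectation (\<lambda>\<omega>. (\<Sum>i\<in>insert a S. \<Sum>j\<in>insert a S. g (e i) \<omega> * g (e j) \<omega> * C i j \<omega>)\<^sup>2)
     = expectation (\<lambda>\<omega>. u \<omega> ^ 4 * (A \<omega>)\<^sup>2 + (u \<omega>)\<^sup>2 * (4 * (L \<omega>)\<^sup>2) + (Q \<omega>)\<^sup>2 + u \<omega> ^ 3 * (4 * (A \<omega> * L \<omega>))
         + (u \<omega>)\<^sup>2 * (2 * (A \<omega> * Q \<omega>)) + u \<omega> * (4 * (L \<omega> * Q \<omega>)))"
    unfolding ex by (intro Bochner_Integration.integral_cong refl) (simp add: algebra_simps power2_eq_square power3_eq_cube power4_eq_xxxx)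
  also have "\<dots> = expectation (\<lambda>\<omega>. u \<omega> ^ 4 * (A \<omega>)\<^sup>2) + expectation (\<lambda>\<omega>. (u \<omega>)\<^sup>2 * (4 * (L \<omega>)\<^sup>2)) + expectation (\<lambda>\<omega>. (Q \<omega>)\<^sup>2)
      + expectation (\<lambda>\<omega>. u \<omega> ^ 3 * (4 * (A \<omega> * L \<omega>))) + expectation (\<lambda>\<omega>. (u \<omega>)\<^sup>2 * (2 * (A \<omega> * Q \<omega>))) + expectation (\<lambda>\<omega>. u \<omega> * (4 * (L \<omega> * Q \<omega>)))"
    by (subst E_add, (intro tame_intros tame_const tt order_refl)+)+ (rule refl)
  also have "expectation (\<lambda>\<omega>. u \<omega> ^ 4 * (A \<omega>)\<^sup>2) = 3 * expectation (\<lambda>\<omega>. (A \<omega>)\<^sup>2)"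
    unfolding u_def by (rule E_fourth_three[OF tame_power[OF tA] off(2) ea])
  also have "expectation (\<lambda>\<omega>. (u \<omega>)\<^sup>2 * (4 * (L \<omega>)\<^sup>2)) = 4 * expectation (\<lambda>\<omega>. (L \<omega>)\<^sup>2)"
    unfolding u_def by (subst E_square_one[OF _ off(2) ea]) (intro tame_intros tame_const K' tL, simp)
  also have "expectation (\<lambda>\<omega>. u \<omega> ^ 3 * (4 * (A \<omega> * L \<omega>))) = 0"
    unfolding u_def by (rule E_cube_zero[of K']) (use ea off offdiag_entries in \<open>auto intro!: tame_intros tame_const K' tL tA\<close>)
  also have "expectation (\<lambda>\<omega>. (u \<omega>)\<^sup>2 * (2 * (A \<omega> * Q \<omega>))) = 2 * expectation (\<lambda>\<omega>. Q \<omega> * A \<omega>)"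
    unfolding u_def by (subst E_square_one[OF _ off(2) ea]) (intro tame_intros tame_const K' tA tQ, simp add: mult.commute)
  also have "expectation (\<lambda>\<omega>. u \<omega> * (4 * (L \<omega> * Q \<omega>))) = 0"
    unfolding u_def by (rule E_mean_zero[of K']) (use ea off offdiag_entries in \<open>auto intro!: tame_intros tame_const K' tL tQ\<close>)
  also have "expectation (\<lambda>\<omega>. (L \<omega>)\<^sup>2) = (\<Sum>j\<in>S. expectation (\<lambda>\<omega>. (C a j \<omega>)\<^sup>2))"
    unfolding L_def by (rule E_linear_square[OF inj off(1) disj(1)]) (use insert.prems in auto)
  also have "expectation (\<lambda>\<omega>. Q \<omega> * A \<omega>) = (\<Sum>i\<in>S. expectation (\<lambda>\<omega>. C i i \<omega> * A \<omega>))"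
    unfolding Q_def A_def by (rule E_quad[OF inj off(1) disj(1)]) (use insert.prems in auto)
  also have "expectation (\<lambda>\<omega>. (Q \<omega>)\<^sup>2) = (\<Sum>i\<in>S. \<Sum>k\<in>S. expectation (\<lambda>\<omega>. C i i \<omega> * C k k \<omega>)) + 2 * (\<Sum>i\<in>S. \<Sum>j\<in>S. expectation (\<lambda>\<omega>. (C i j \<omega>)\<^sup>2))"
    unfolding Q_def by (rule insert.IH[OF inj off(1) disj(1)]) (use insert.prems in auto)
  finally have main: "expectation (\<lambda>\<omega>. (\<Sum>i\<in>insert a S. \<Sum>j\<in>insert a S. g (e i) \<omega> * g (e j) \<omega> * C i j \<omega>)\<^sup>2)
    = 3 * expectation (\<lambda>\<omega>. (A \<omega>)\<^sup>2) + 4 * (\<Sum>j\<in>S. expectation (\<lambda>\<omega>. (C a j \<omega>)\<^sup>2))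
      + ((\<Sum>i\<in>S. \<Sum>k\<in>S. expectation (\<lambda>\<omega>. C i i \<omega> * C k k \<omega>)) + 2 * (\<Sum>i\<in>S. \<Sum>j\<in>S. expectation (\<lambda>\<omega>. (C i j \<omega>)\<^sup>2)))
      + 2 * (\<Sum>i\<in>S. expectation (\<lambda>\<omega>. C i i \<omega> * A \<omega>))" by simp
  have s1: "(\<Sum>i\<in>S. expectation (\<lambda>\<omega>. (C i a \<omega>)\<^sup>2)) = (\<Sum>j\<in>S. expectation (\<lambda>\<omega>. (C a j \<omega>)\<^sup>2))"
    using insert.prems(5) by (intro sum.cong refl) auto
  have s2: "(\<Sum>k\<in>S. expectation (\<lambda>\<omega>. C a a \<omega> * C k k \<omega>)) = (\<Sum>k\<in>S. expectation (\<lambda>\<omega>. C k k \<omega> * C a a \<omega>))"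
    by (simp add: mult.commute)
  show ?case unfolding main using insert.hyps s1
    by (simp add: sum.distrib A_def power2_eq_square s2)
qed simp

end

section \<open>The mean absolute determinant: spikes, minors and first moment\<close>

context gaussian_matrix begin

definition edge :: "nat \<Rightarrow> nat \<Rightarrow> nat \<times> nat" where "edge i j = (min i j, max i j)"

definition entry :: "(nat \<Rightarrow> real) \<Rightarrow> 'a \<Rightarrow> nat \<Rightarrow> nat \<Rightarrow> real" where
  "entry y \<omega> i j = (if i = j then y i else 0) + g (edge i j) \<omega>"

text \<open>The entries that a determinant over \<open>S\<close> depends on.\<close>
definition core :: "nat set \<Rightarrow> (nat \<times> nat) set" where "core S = {(i, j). i \<in> S \<and> j \<in> S \<and> i \<le> j}"

text \<open>The determinant of the principal submatrix on \<open>S\<close> of \<open>X + diag y\<close>, and its cofactors.\<close>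
definition sdet :: "(nat \<Rightarrow> real) \<Rightarrow> nat set \<Rightarrow> 'a \<Rightarrow> real" where "sdet y S \<omega> = pdet (entry y \<omega>) S"

definition scof :: "(nat \<Rightarrow> real) \<Rightarrow> nat set \<Rightarrow> nat \<Rightarrow> nat \<Rightarrow> 'a \<Rightarrow> real" where "scof y S i j \<omega> = cof (entry y \<omega>) S i j"

lemma edge_sym: "edge i j = edge j i" by (simp add: edge_def min.commute max.commute)
lemma edge_diag [simp]: "edge i i = (i, i)" by (simp add: edge_def)

lemma entry_sym: "entry y \<omega> i j = entry y \<omega> j i"
  by (simp add: entry_def edge_sym)

lemma core_entries: "S \<subseteq> {..<N} \<Longrightarrow> core S \<subseteq> entries"
  by (auto simp: core_def entries_def)

lemma core_mono: "S \<subseteq> T \<Longrightarrow> core S \<subseteq> core T"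
  by (auto simp: core_def)

lemma edge_core: "i \<in> S \<Longrightarrow> j \<in> S \<Longrightarrow> edge i j \<in> core S"
  by (auto simp: core_def edge_def min_def max_def)

lemma edge_row:
  assumes "a \<notin> S" "insert a S \<subseteq> {..<N}"
  shows "inj_on (edge a) S" "edge a ` S \<subseteq> offdiag" "edge a ` S \<inter> core S = {}"
  using assms by (auto simp: inj_on_def edge_def offdiag_def core_def min_def max_def split: if_splits intro!: le_neq_implies_less)

lemma tame_entry: "S \<subseteq> {..<N} \<Longrightarrow> i \<in> S \<Longrightarrow> j \<in> S \<Longrightarrow> tame (core S) (\<lambda>\<omega>. entry y \<omega> i j)"
  unfolding entry_def by (intro tame_add tame_const tame_g_in edge_core core_entries)

lemma tame_sdet: "S \<subseteq> {..<N} \<Longrightarrow> tame (core S) (sdet y S)"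
  unfolding sdet_def[abs_def] pdet_def
  by (intro tame_sum tame_mult tame_const tame_prod core_entries tame_entry) (auto simp: permutes_in_image)

lemma tame_scof: "S \<subseteq> {..<N} \<Longrightarrow> tame (core S) (scof y S i j)"
  unfolding scof_def[abs_def] cof_def
  by (intro tame_sum tame_mult tame_const tame_prod core_entries tame_entry) (auto simp: permutes_in_image)

lemma scof_sym: "finite S \<Longrightarrow> i \<in> S \<Longrightarrow> scof y S i j \<omega> = scof y S j i \<omega>"
  unfolding scof_def by (intro cof_sym entry_sym)

lemma scof_diag: "finite S \<Longrightarrow> i \<in> S \<Longrightarrow> scof y S i i \<omega> = sdet y (S - {i}) \<omega>"
  unfolding scof_def sdet_def by (rule cof_diag)

lemma sdet_empty [simp]: "sdet y {} \<omega> = 1" by (simp add: sdet_def)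

lemma sdet_insert:
  assumes "finite S" "a \<notin> S"
  shows "sdet y (insert a S) \<omega> = (y a + g (a, a) \<omega>) * sdet y S \<omega>
     - (\<Sum>i\<in>S. \<Sum>j\<in>S. g (edge a i) \<omega> * g (edge a j) \<omega> * scof y S i j \<omega>)"
proof -
  have "entry y \<omega> a i = g (edge a i) \<omega>" "entry y \<omega> i a = g (edge a i) \<omega>" if "i \<in> S" for i
    using that assms by (auto simp: entry_def edge_sym)
  then show ?thesis unfolding sdet_def scof_def pdet_insert[OF assms]
    by (auto simp: entry_def intro!: sum.cong)
qed

lemma scof_offdiag:
  assumes S: "finite R" "i \<notin> R" "k \<notin> R" "i \<noteq> k"
  shows "scof y (insert i (insert k R)) i k \<omega>
    = (\<Sum>j\<in>R. \<Sum>l\<in>R. g (edge i j) \<omega> * g (edge k l) \<omega> * scof y R j l \<omega>) - g (edge k i) \<omega> * sdet y R \<omega>"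
proof -
  let ?f = "entry y \<omega>" let ?f' = "\<lambda>m l. ?f m (if l = k then i else l)"
  have "insert i (insert k R) - {i} = insert k R" using S by auto
  then have "scof y (insert i (insert k R)) i k \<omega> = - pdet ?f' (insert k R)"
    unfolding scof_def using cof_offdiag[of "insert i (insert k R)" i k ?f] S by simp
  also have "pdet ?f' (insert k R) = ?f' k k * pdet ?f' R - (\<Sum>j\<in>R. \<Sum>l\<in>R. ?f' j k * ?f' k l * cof ?f' R j l)"
    using S by (intro pdet_insert) auto
  also have "pdet ?f' R = sdet y R \<omega>" unfolding sdet_def by (rule pdet_cong) (use S in auto)
  also have "(\<Sum>j\<in>R. \<Sum>l\<in>R. ?f' j k * ?f' k l * cof ?f' R j l) =
     (\<Sum>j\<in>R. \<Sum>l\<in>R. g (edge i j) \<omega> * g (edge k l) \<omega> * scof y R j l \<omega>)"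
  proof (intro sum.cong refl)
    fix j l assume jl: "j \<in> R" "l \<in> R"
    have "cof ?f' R j l = scof y R j l \<omega>" unfolding scof_def by (rule cof_cong) (use S in auto)
    then show "?f' j k * ?f' k l * cof ?f' R j l = g (edge i j) \<omega> * g (edge k l) \<omega> * scof y R j l \<omega>"
      using jl S by (auto simp: entry_def edge_sym[of j i])
  qed
  also have "?f' k k = g (edge k i) \<omega>" using S by (simp add: entry_def)
  finally show ?thesis by simp
qed

text \<open>The rest \<open>Z\<close> does not depend on the shift \<open>c\<close> at \<open>a\<close>, so one decomposition serves to compare
  different shifts.\<close>
lemma sdet_affine:
  assumes S: "a \<notin> S" "insert a S \<subseteq> {..<N}"
  obtains Z where "tame (core (insert a S) - {(a, a)}) Z"
    "\<And>c \<omega>. sdet (y(a := c)) (insert a S) \<omega> = sdet y S \<omega> * g (a, a) \<omega> + (c * sdet y S \<omega> + Z \<omega>)"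
proof
  let ?K = "core (insert a S) - {(a, a)}"
  have fin: "finite S" using S by (auto intro: finite_subset)
  have K: "?K \<subseteq> entries" using core_entries[OF S(2)] by auto
  have sub: "core S \<subseteq> ?K" using S by (auto simp: core_def)
  have row: "edge a i \<in> ?K" if "i \<in> S" for i
    using that S edge_core[of a "insert a S" i] by (auto simp: edge_def min_def max_def split: if_splits)
  show "tame ?K (\<lambda>\<omega>. - (\<Sum>i\<in>S. \<Sum>j\<in>S. g (edge a i) \<omega> * g (edge a j) \<omega> * scof y S i j \<omega>))"
    by (intro tame_intros K tame_g_in row tame_mono[OF tame_scof sub]) (use S in auto)
  fix c \<omega>
  have "sdet (y(a := c)) S \<omega> = sdet y S \<omega>" "scof (y(a := c)) S i j \<omega> = scof y S i j \<omega>" for i j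
    unfolding sdet_def scof_def by (intro pdet_cong cof_cong; use S in \<open>auto simp: entry_def\<close>)+
  then show "sdet (y(a := c)) (insert a S) \<omega> = sdet y S \<omega> * g (a, a) \<omega> + (c * sdet y S \<omega> + -(\<Sum>i\<in>S. \<Sum>j\<in>S. g (edge a i) \<omega> * g (edge a j) \<omega> * scof y S i j \<omega>))"
    unfolding sdet_insert[OF fin S(1)] by (simp add: algebra_simps)
qed

text \<open>This is \<open>abs_affine_ge\<close> for the entry \<open>(a, a)\<close>; variance \<open>2\<close> makes its mean absolute value at least
  \<open>1\<close>.\<close>
lemma mean_abs_sdet_minor:
  assumes S: "a \<notin> S" "insert a S \<subseteq> {..<N}"
  shows "expectation (\<lambda>\<omega>. \<bar>sdet y S \<omega>\<bar>) \<le> expectation (\<lambda>\<omega>. \<bar>sdet y (insert a S) \<omega>\<bar>)"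
proof -
  let ?K = "core (insert a S) - {(a, a)}"
  obtain Z where Z: "tame ?K Z"
    "\<And>c \<omega>. sdet (y(a := c)) (insert a S) \<omega> = sdet y S \<omega> * g (a, a) \<omega> + (c * sdet y S \<omega> + Z \<omega>)"
    using sdet_affine[OF S] by blast
  have tD: "tame ?K (sdet y S)" by (rule tame_mono[OF tame_sdet]) (use S core_entries[OF S(2)] in \<open>auto simp: core_def\<close>)
  have a: "a < N" using S by auto
  have "expectation (\<lambda>\<omega>. \<bar>sdet y S \<omega>\<bar>) * 1 \<le> expectation (\<lambda>\<omega>. \<bar>sdet y S \<omega>\<bar>) * expectation (\<lambda>\<omega>. \<bar>g (a, a) \<omega>\<bar>)"
    by (intro mult_left_mono g_abs_diag a integral_nonneg_AE) auto
  also have "\<dots> \<le> expectation (\<lambda>\<omega>. \<bar>sdet y S \<omega> * g (a, a) \<omega> + (y a * sdet y S \<omega> + Z \<omega>)\<bar>)"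
    by (rule abs_affine_ge[OF tD]) (use a tame_ent[OF Z(1)] in \<open>auto intro!: tame_intros tame_const tD Z(1) simp: entries_def\<close>)
  also have "\<dots> = expectation (\<lambda>\<omega>. \<bar>sdet y (insert a S) \<omega>\<bar>)" using Z(2)[of "y a"] by simp
  finally show ?thesis by simp
qed

text \<open>The change of the determinant is \<open>(c - y a)\<close> times the minor without \<open>a\<close>, which
  \<open>mean_abs_sdet_minor\<close> bounds by the determinant itself.\<close>
lemma mean_abs_sdet_shift:
  assumes a: "a \<in> T" and T: "T \<subseteq> {..<N}"
  shows "expectation (\<lambda>\<omega>. \<bar>sdet (y(a := c)) T \<omega>\<bar>) \<le> (1 + \<bar>c - y a\<bar>) * expectation (\<lambda>\<omega>. \<bar>sdet y T \<omega>\<bar>)"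
proof -
  define S where "S = T - {a}"
  have S: "a \<notin> S" "insert a S \<subseteq> {..<N}" "T = insert a S" using a T by (auto simp: S_def)
  obtain Z where Z: "\<And>c \<omega>. sdet (y(a := c)) (insert a S) \<omega> = sdet y S \<omega> * g (a, a) \<omega> + (c * sdet y S \<omega> + Z \<omega>)"
    using sdet_affine[OF S(1,2)] by blast
  have tT: "tame entries (sdet y T)" for y using tame_up[OF tame_sdet[OF T]] .
  have tS: "tame entries (sdet y S)" using tame_up[OF tame_sdet[of S]] S by auto
  have "expectation (\<lambda>\<omega>. \<bar>sdet (y(a := c)) T \<omega>\<bar>) \<le> expectation (\<lambda>\<omega>. \<bar>sdet y T \<omega>\<bar> + \<bar>c - y a\<bar> * \<bar>sdet y S \<omega>\<bar>)"
  proof (intro integral_mono tame_integrable[of entries] tame_intros tame_abs tame_const tT tS order_refl)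
    fix \<omega>
    have "sdet (y(a := c)) T \<omega> = sdet y T \<omega> + (c - y a) * sdet y S \<omega>"
      using Z[of c \<omega>] Z[of "y a" \<omega>] S(3) by (simp add: algebra_simps)
    then show "\<bar>sdet (y(a := c)) T \<omega>\<bar> \<le> \<bar>sdet y T \<omega>\<bar> + \<bar>c - y a\<bar> * \<bar>sdet y S \<omega>\<bar>"
      by (simp flip: abs_mult)
  qed
  also have "\<dots> = expectation (\<lambda>\<omega>. \<bar>sdet y T \<omega>\<bar>) + \<bar>c - y a\<bar> * expectation (\<lambda>\<omega>. \<bar>sdet y S \<omega>\<bar>)"
    by (subst E_add) (auto intro!: tame_intros tame_abs tame_const tT tS)
  also have "\<dots> \<le> expectation (\<lambda>\<omega>. \<bar>sdet y T \<omega>\<bar>) + \<bar>c - y a\<bar> * expectation (\<lambda>\<omega>. \<bar>sdet y T \<omega>\<bar>)"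
    unfolding S(3) by (intro add_left_mono mult_left_mono mean_abs_sdet_minor S) auto
  finally show ?thesis by (simp add: algebra_simps)
qed

lemma mean_abs_sdet_spikes:
  assumes T: "T \<subseteq> {..<N}" "{..<r} \<subseteq> T" and B: "\<And>i. i < r \<Longrightarrow> \<bar>z i - y i\<bar> \<le> B"
  shows "expectation (\<lambda>\<omega>. \<bar>sdet (\<lambda>i. if i < r then z i else y i) T \<omega>\<bar>) \<le> (1 + B) ^ r * expectation (\<lambda>\<omega>. \<bar>sdet y T \<omega>\<bar>)"
  using T(2) B
proof (induction r)
  case (Suc r)
  let ?y = "\<lambda>i. if i < r then z i else y i"
  have "(\<lambda>i. if i < Suc r then z i else y i) = ?y(r := z r)" by (auto simp: less_Suc_eq)
  then have "expectation (\<lambda>\<omega>. \<bar>sdet (\<lambda>i. if i < Suc r then z i else y i) T \<omega>\<bar>) = expectation (\<lambda>\<omega>. \<bar>sdet (?y(r := z r)) T \<omega>\<bar>)" by simp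
  also have "\<dots> \<le> (1 + \<bar>z r - ?y r\<bar>) * expectation (\<lambda>\<omega>. \<bar>sdet ?y T \<omega>\<bar>)"
    by (rule mean_abs_sdet_shift) (use Suc.prems T in auto)
  also have "\<dots> \<le> (1 + B) * ((1 + B) ^ r * expectation (\<lambda>\<omega>. \<bar>sdet y T \<omega>\<bar>))"
  proof (intro mult_mono)
    show "1 + \<bar>z r - ?y r\<bar> \<le> 1 + B" using Suc.prems(2)[of r] by simp
    show "expectation (\<lambda>\<omega>. \<bar>sdet ?y T \<omega>\<bar>) \<le> (1 + B) ^ r * expectation (\<lambda>\<omega>. \<bar>sdet y T \<omega>\<bar>)"
      by (rule Suc.IH) (use Suc.prems in auto)
    show "0 \<le> 1 + B" using Suc.prems(2)[of r] by simp
  qed (auto intro!: integral_nonneg_AE)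
  finally show ?case by (simp add: mult.assoc)
qed simp

lemma E_quad_sdet:
  assumes S: "a \<notin> S" "insert a S \<subseteq> {..<N}" and Z: "tame K Z" "core S \<subseteq> K" "edge a ` S \<inter> K = {}"
  shows "expectation (\<lambda>\<omega>. (\<Sum>i\<in>S. \<Sum>j\<in>S. g (edge a i) \<omega> * g (edge a j) \<omega> * scof y S i j \<omega>) * Z \<omega>)
    = (\<Sum>i\<in>S. expectation (\<lambda>\<omega>. sdet y (S - {i}) \<omega> * Z \<omega>))"
proof -
  have fin: "finite S" using S by (auto intro: finite_subset)
  show ?thesis
    by (subst E_quad[OF edge_row(1,2)[OF S] Z(3) tame_mono[OF tame_scof Z(2)] Z(1)])
      (use S Z tame_ent[OF Z(1)] in \<open>auto simp: scof_diag fin\<close>)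
qed

text \<open>In the expansion along a row only the squares \<open>X\<^bsub>ai\<^esub>\<^sup>2\<close> have nonzero mean, so each index \<open>i\<close>
  contributes the minor without \<open>i\<close>: the three-term recursion of the Hermite polynomials.\<close>
lemma mean_sdet:
  assumes "S \<subseteq> {..<N}"
  shows "expectation (sdet (\<lambda>_. c) S) = hermite (card S) c"
proof -
  have "finite S" using assms by (auto intro: finite_subset)
  then show ?thesis using assms
  proof (induction "card S" arbitrary: S rule: less_induct)
    case less
    show ?case
    proof (cases "S = {}")
      case True then show ?thesis by (simp add: sdet_def[abs_def] prob_space)
    next
      case False
      then obtain a where a: "a \<in> S" by auto
      define R where "R = S - {a}"
      have R: "a \<notin> R" "insert a R \<subseteq> {..<N}" "S = insert a R" "finite R" using a less.prems by (auto simp: R_def)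
      have cS: "card S = Suc (card R)" using R by simp
      have IH: "expectation (sdet (\<lambda>_. c) R) = hermite (card R) c" using less.hyps[of R] R cS by auto
      have IH2: "expectation (sdet (\<lambda>_. c) (R - {i})) = hermite (card R - 1) c" if "i \<in> R" for i
      proof -
        have "card (R - {i}) = card R - 1" using that R by simp
        moreover have "card R > 0" using that R by (auto simp: card_gt_0_iff)
        ultimately show ?thesis using less.hyps[of "R - {i}"] R cS by (auto simp: subset_iff)
      qed
      have aN: "(a, a) \<in> entries" "(a, a) \<notin> core R" using R by (auto simp: entries_def core_def)
      have tR: "tame (core R) (sdet (\<lambda>_. c) R)" using R by (intro tame_sdet) auto
      have tQ: "tame entries (\<lambda>\<omega>. \<Sum>i\<in>R. \<Sum>j\<in>R. g (edge a i) \<omega> * g (edge a j) \<omega> * scof (\<lambda>_. c) R i j \<omega>)"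
        by (intro tame_intros tame_up[OF tame_scof] tame_g_off order_refl) (use edge_row(2)[OF R(1,2)] R in auto)
      have "expectation (sdet (\<lambda>_. c) S) = expectation (\<lambda>\<omega>. c * sdet (\<lambda>_. c) R \<omega> + g (a,a) \<omega> * sdet (\<lambda>_. c) R \<omega>
         - (\<Sum>i\<in>R. \<Sum>j\<in>R. g (edge a i) \<omega> * g (edge a j) \<omega> * scof (\<lambda>_. c) R i j \<omega>))"
        unfolding R(3) sdet_insert[OF R(4,1)] by (intro Bochner_Integration.integral_cong refl) (simp add: algebra_simps sdet_insert[OF R(4,1)])
      also have "\<dots> = expectation (\<lambda>\<omega>. c * sdet (\<lambda>_. c) R \<omega>) + expectation (\<lambda>\<omega>. g (a,a) \<omega> * sdet (\<lambda>_. c) R \<omega>)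
         - expectation (\<lambda>\<omega>. (\<Sum>i\<in>R. \<Sum>j\<in>R. g (edge a i) \<omega> * g (edge a j) \<omega> * scof (\<lambda>_. c) R i j \<omega>))"
        by (subst E_diff E_add; (intro tame_intros tame_const tame_up[OF tR] tame_g_in aN order_refl tQ)?)+ (rule refl)
      also have "expectation (\<lambda>\<omega>. g (a,a) \<omega> * sdet (\<lambda>_. c) R \<omega>) = 0"
        by (rule E_mean_zero[OF tR aN])
      also have "expectation (\<lambda>\<omega>. (\<Sum>i\<in>R. \<Sum>j\<in>R. g (edge a i) \<omega> * g (edge a j) \<omega> * scof (\<lambda>_. c) R i j \<omega>))
         = (\<Sum>i\<in>R. expectation (sdet (\<lambda>_. c) (R - {i})))"
        using E_quad_sdet[OF R(1,2) tame_const[of "core R" 1] order_refl] edge_row(3)[OF R(1,2)] core_entries[of R] R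
        by auto
      also have "\<dots> = real (card R) * hermite (card R - 1) c" using IH2 by simp
      finally show ?thesis by (simp add: cS hermite_Suc IH)
    qed
  qed
qed

lemma hermite_le_mean_abs_sdet:
  assumes n: "n \<ge> 1" "n \<le> N"
  shows "\<bar>hermite n c\<bar> \<le> expectation (\<lambda>\<omega>. \<bar>sdet (\<lambda>_. c) {..<n} \<omega>\<bar>)"
    "\<bar>hermite (n - 1) c\<bar> \<le> expectation (\<lambda>\<omega>. \<bar>sdet (\<lambda>_. c) {..<n} \<omega>\<bar>)"
proof -
  show "\<bar>hermite n c\<bar> \<le> expectation (\<lambda>\<omega>. \<bar>sdet (\<lambda>_. c) {..<n} \<omega>\<bar>)"
    using mean_sdet[of "{..<n}" c] n integral_abs_bound[of M "sdet (\<lambda>_. c) {..<n}"] by simp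
  have ins: "{..<n} = insert (n - 1) {..<n-1}" using n by auto
  have "\<bar>hermite (n - 1) c\<bar> \<le> expectation (\<lambda>\<omega>. \<bar>sdet (\<lambda>_. c) {..<n-1} \<omega>\<bar>)"
    using mean_sdet[of "{..<n-1}" c] n integral_abs_bound[of M "sdet (\<lambda>_. c) {..<n-1}"] by simp
  also have "\<dots> \<le> expectation (\<lambda>\<omega>. \<bar>sdet (\<lambda>_. c) {..<n} \<omega>\<bar>)"
    unfolding ins by (rule mean_abs_sdet_minor) (use n in auto)
  finally show "\<bar>hermite (n - 1) c\<bar> \<le> expectation (\<lambda>\<omega>. \<bar>sdet (\<lambda>_. c) {..<n} \<omega>\<bar>)" .
qed

end

section \<open>The second moment of the determinant\<close>

text \<open>For order \<open>n\<close> and constant shift \<open>c\<close>, the mean of the squared determinant and the mean of its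
  product with a principal minor of order \<open>n - 1\<close>.  The value of \<open>mixed_moment\<close> at \<open>0\<close> is a
  convention; it only enters multiplied by \<open>0\<close>.\<close>
fun second_moment :: "real \<Rightarrow> nat \<Rightarrow> real" and mixed_moment :: "real \<Rightarrow> nat \<Rightarrow> real" where
  "second_moment c 0 = 1"
| "mixed_moment c 0 = 0"
| "second_moment c (Suc n) = (c\<^sup>2 + 2) * second_moment c n - 2 * c * real n * mixed_moment c n + real n * (real n + 2) * second_moment c (n - 1)"
| "mixed_moment c (Suc n) = c * second_moment c n - real n * mixed_moment c n"

context gaussian_matrix begin

lemma E_square_insert:
  assumes S: "a \<notin> S" "insert a S \<subseteq> {..<N}" and y: "y = (\<lambda>_. c)"
  shows "expectation (\<lambda>\<omega>. (sdet y (insert a S) \<omega>)\<^sup>2) =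
     (c\<^sup>2 + 2) * expectation (\<lambda>\<omega>. (sdet y S \<omega>)\<^sup>2) - 2 * c * (\<Sum>j\<in>S. expectation (\<lambda>\<omega>. sdet y S \<omega> * sdet y (S - {j}) \<omega>))
     + ((\<Sum>i\<in>S. \<Sum>k\<in>S. expectation (\<lambda>\<omega>. scof y S i i \<omega> * scof y S k k \<omega>)) + 2 * (\<Sum>i\<in>S. \<Sum>j\<in>S. expectation (\<lambda>\<omega>. (scof y S i j \<omega>)\<^sup>2)))"
proof -
  have fin: "finite S" using S by (auto intro: finite_subset)
  have yc: "y x = c" for x by (simp add: y)
  define u where "u = g (a, a)"
  define d where "d = sdet y S"
  define Q where "Q \<omega> = (\<Sum>i\<in>S. \<Sum>j\<in>S. g (edge a i) \<omega> * g (edge a j) \<omega> * scof y S i j \<omega>)" for \<omega>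
  define K where "K = core (insert a S) - {(a, a)}"
  have aN: "(a, a) \<in> entries" "(a, a) \<notin> K" "(a, a) \<notin> core S" using S by (auto simp: entries_def K_def core_def)
  have K: "K \<subseteq> entries" using core_entries[OF S(2)] by (auto simp: K_def)
  have sub: "core S \<subseteq> K" using S by (auto simp: K_def core_def)
  have row: "edge a i \<in> K" if "i \<in> S" for i
    using that S edge_core[of a "insert a S" i] by (auto simp: K_def edge_def min_def max_def split: if_splits)
  have tdc: "tame (core S) d" unfolding d_def using S by (intro tame_sdet) auto
  have td: "tame K d" by (rule tame_mono[OF tdc sub K])
  have tQ: "tame K Q" unfolding Q_def by (intro tame_intros K tame_g_in row tame_mono[OF tame_scof sub]) (use S in auto)
  have tu: "tame entries u" unfolding u_def by (intro tame_g_in aN order_refl)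
  note tt = tame_up[OF td] tame_up[OF tQ] tu
  have usq: "expectation (\<lambda>\<omega>. (u \<omega>)\<^sup>2 * (d \<omega>)\<^sup>2) = 2 * expectation (\<lambda>\<omega>. (d \<omega>)\<^sup>2)"
    unfolding u_def
    by (subst tame_indep[OF tame_power[OF tame_g[OF aN(1)]] tame_power[OF td]]) (use aN S in \<open>auto simp: g_square\<close>)
  have "expectation (\<lambda>\<omega>. (sdet y (insert a S) \<omega>)\<^sup>2) =
    expectation (\<lambda>\<omega>. c\<^sup>2 * (d \<omega>)\<^sup>2 + (u \<omega>)\<^sup>2 * (d \<omega>)\<^sup>2 + u \<omega> * (2 * c * (d \<omega>)\<^sup>2 - 2 * (d \<omega> * Q \<omega>)) + (Q \<omega>)\<^sup>2 - 2 * c * (Q \<omega> * d \<omega>))"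
    unfolding sdet_insert[OF fin S(1)] Q_def[symmetric] d_def[symmetric] u_def[symmetric]
    by (intro Bochner_Integration.integral_cong refl) (simp add: yc power2_eq_square algebra_simps)
  also have "\<dots> = expectation (\<lambda>\<omega>. c\<^sup>2 * (d \<omega>)\<^sup>2) + expectation (\<lambda>\<omega>. (u \<omega>)\<^sup>2 * (d \<omega>)\<^sup>2)
      + expectation (\<lambda>\<omega>. u \<omega> * (2 * c * (d \<omega>)\<^sup>2 - 2 * (d \<omega> * Q \<omega>))) + expectation (\<lambda>\<omega>. (Q \<omega>)\<^sup>2) - expectation (\<lambda>\<omega>. 2 * c * (Q \<omega> * d \<omega>))"
    by (subst E_diff E_add; (intro tame_intros tame_const tt order_refl)?)+ (rule refl)
  also have "expectation (\<lambda>\<omega>. u \<omega> * (2 * c * (d \<omega>)\<^sup>2 - 2 * (d \<omega> * Q \<omega>))) = 0"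
    unfolding u_def by (rule E_mean_zero[OF _ aN(1,2)]) (intro tame_intros tame_const td tQ K)
  also have "expectation (\<lambda>\<omega>. (Q \<omega>)\<^sup>2) = (\<Sum>i\<in>S. \<Sum>k\<in>S. expectation (\<lambda>\<omega>. scof y S i i \<omega> * scof y S k k \<omega>)) + 2 * (\<Sum>i\<in>S. \<Sum>j\<in>S. expectation (\<lambda>\<omega>. (scof y S i j \<omega>)\<^sup>2))"
    unfolding Q_def by (rule E_quad_square[OF fin edge_row[OF S]]) (use S in \<open>auto intro!: tame_scof scof_sym fin\<close>)
  also have "expectation (\<lambda>\<omega>. 2 * c * (Q \<omega> * d \<omega>)) = 2 * c * (\<Sum>i\<in>S. expectation (\<lambda>\<omega>. sdet y S \<omega> * sdet y (S - {i}) \<omega>))"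
  proof -
    have "expectation (\<lambda>\<omega>. Q \<omega> * d \<omega>) = (\<Sum>i\<in>S. expectation (\<lambda>\<omega>. sdet y (S - {i}) \<omega> * d \<omega>))"
      unfolding Q_def by (rule E_quad_sdet[OF S tdc order_refl edge_row(3)[OF S]])
    then show ?thesis by (simp add: d_def mult.commute)
  qed
  finally show ?thesis using usq by (simp add: d_def algebra_simps)
qed

text \<open>For a matrix invariant under rotations, \<open>E C\<^bsub>ii\<^esub> C\<^bsub>kk\<^esub> + 2 E C\<^bsub>ik\<^esub>\<^sup>2 = E C\<^bsub>kk\<^esub>\<^sup>2\<close>.  Here it comes out
  of the expansions: with \<open>R\<close> the remaining indices, \<open>C\<^bsub>ii\<^esub>\<close> and \<open>C\<^bsub>kk\<^esub>\<close> are quadratic forms in two independent rows over \<open>R\<close>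
  and \<open>C\<^bsub>ik\<^esub>\<close> is the corresponding bilinear form.  Integrating the rows yields on the left exactly the
  expression that \<open>E_square_insert\<close> gives for a squared determinant over one index more than \<open>R\<close>.\<close>
lemma E_cofactor_isotropy:
  assumes R: "i \<notin> R" "k \<notin> R" "i \<noteq> k" "insert i (insert k R) \<subseteq> {..<N}" and y: "y = (\<lambda>_. c)"
  shows "expectation (\<lambda>\<omega>. sdet y (insert k R) \<omega> * sdet y (insert i R) \<omega>)
     + 2 * expectation (\<lambda>\<omega>. (scof y (insert i (insert k R)) i k \<omega>)\<^sup>2)
     = expectation (\<lambda>\<omega>. (sdet y (insert i R) \<omega>)\<^sup>2)"
proof -
  have fin: "finite R" using R by (auto intro: finite_subset)
  have yc: "y x = c" for x by (simp add: y)
  have Ri: "insert i R \<subseteq> {..<N}" and Rk: "insert k R \<subseteq> {..<N}" and RN: "R \<subseteq> {..<N}" using R by auto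
  define d where "d = sdet y R"
  define Qi where "Qi \<omega> = (\<Sum>j\<in>R. \<Sum>l\<in>R. g (edge i j) \<omega> * g (edge i l) \<omega> * scof y R j l \<omega>)" for \<omega>
  define Qk where "Qk \<omega> = (\<Sum>j\<in>R. \<Sum>l\<in>R. g (edge k j) \<omega> * g (edge k l) \<omega> * scof y R j l \<omega>)" for \<omega>
  define B where "B \<omega> = (\<Sum>j\<in>R. \<Sum>l\<in>R. g (edge i j) \<omega> * g (edge k l) \<omega> * scof y R j l \<omega>)" for \<omega>
  define K where "K = core (insert i (insert k R)) - {(i, i), (k, k), edge k i}"
  define p where "p = expectation (\<lambda>\<omega>. (d \<omega>)\<^sup>2)"
  define q where "q = (\<Sum>j\<in>R. expectation (\<lambda>\<omega>. sdet y R \<omega> * sdet y (R - {j}) \<omega>))"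
  define CC where "CC = (\<Sum>i\<in>R. \<Sum>k\<in>R. expectation (\<lambda>\<omega>. scof y R i i \<omega> * scof y R k k \<omega>))"
  define C2 where "C2 = (\<Sum>i\<in>R. \<Sum>j\<in>R. expectation (\<lambda>\<omega>. (scof y R i j \<omega>)\<^sup>2))"
  have K: "K \<subseteq> entries" using core_entries[OF R(4)] by (auto simp: K_def)
  have sub: "core R \<subseteq> K" using R by (auto simp: K_def core_def edge_def min_def max_def)
  have rowi: "edge i j \<in> K" and rowk: "edge k j \<in> K" if "j \<in> R" for j
    using that R edge_core[of i "insert i (insert k R)" j] edge_core[of k "insert i (insert k R)" j]
    by (auto simp: K_def edge_def min_def max_def split: if_splits)
  have ii: "(i, i) \<in> entries" "(i, i) \<notin> K" "(i, i) \<noteq> (k, k)" and kk: "(k, k) \<in> entries" "(k, k) \<notin> K"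
    and ki: "edge k i \<in> offdiag" "edge k i \<notin> K"
    using R by (auto simp: entries_def K_def offdiag_def edge_def min_def max_def)
  have tdc: "tame (core R) d" unfolding d_def by (rule tame_sdet[OF RN])
  have td: "tame K d" by (rule tame_mono[OF tdc sub K])
  have tC: "tame K (scof y R j l)" for j l by (rule tame_mono[OF tame_scof[OF RN] sub K])
  have tQi: "tame K Qi" and tQk: "tame K Qk" and tB: "tame K B"
    unfolding Qi_def Qk_def B_def by (intro tame_intros K tame_g_in rowi rowk tC; assumption)+
  have tui: "tame entries (g (i, i))" and tuk: "tame entries (g (k, k))" and tuki: "tame entries (g (edge k i))"
    using ii kk ki offdiag_entries by (auto intro!: tame_g_in)
  note tt = tame_up[OF td] tame_up[OF tQi] tame_up[OF tQk] tame_up[OF tB] tui tuk tuki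
  have disj: "edge i ` R \<inter> edge k ` R = {}" using R by (auto simp: edge_def min_def max_def split: if_splits)
  define Ki where "Ki = core R \<union> edge i ` R"
  define Kk where "Kk = core R \<union> edge k ` R"
  have Ki: "core R \<subseteq> Ki" "Ki \<subseteq> entries" "edge k ` R \<inter> Ki = {}" and Kk: "core R \<subseteq> Kk" "Kk \<subseteq> entries" "edge i ` R \<inter> Kk = {}"
    using disj edge_row[OF R(1) Ri] edge_row[OF R(2) Rk] core_entries[OF RN] offdiag_entries by (auto simp: Ki_def Kk_def)
  have EQi: "expectation (\<lambda>\<omega>. Qi \<omega> * d \<omega>) = q"
    using E_quad_sdet[OF R(1) Ri tdc order_refl edge_row(3)[OF R(1) Ri]]
    by (simp add: Qi_def q_def d_def mult.commute)
  have EQk: "expectation (\<lambda>\<omega>. Qk \<omega> * d \<omega>) = q"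
    using E_quad_sdet[OF R(2) Rk tdc order_refl edge_row(3)[OF R(2) Rk]]
    by (simp add: Qk_def q_def d_def mult.commute)
  \<comment> \<open>Integrate row \<open>k\<close> first, with the form in row \<open>i\<close> as a factor independent of it.\<close>
  have EQQ: "expectation (\<lambda>\<omega>. Qk \<omega> * Qi \<omega>) = CC"
  proof -
    have "tame Ki Qi" unfolding Qi_def
      by (intro tame_intros Ki tame_g_in tame_mono[OF tame_scof[OF RN]]) (auto simp: Ki_def)
    then have "expectation (\<lambda>\<omega>. Qk \<omega> * Qi \<omega>) = (\<Sum>j\<in>R. expectation (\<lambda>\<omega>. sdet y (R - {j}) \<omega> * Qi \<omega>))"
      unfolding Qk_def by (rule E_quad_sdet[OF R(2) Rk _ Ki(1,3)])
    also have "\<dots> = (\<Sum>j\<in>R. \<Sum>l\<in>R. expectation (\<lambda>\<omega>. sdet y (R - {l}) \<omega> * sdet y (R - {j}) \<omega>))"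
    proof (intro sum.cong refl)
      fix j assume "j \<in> R"
      have "tame (core R) (sdet y (R - {j}))"
        by (rule tame_mono[OF tame_sdet core_mono core_entries]) (use RN in auto)
      from E_quad_sdet[OF R(1) Ri this order_refl edge_row(3)[OF R(1) Ri]]
      show "expectation (\<lambda>\<omega>. sdet y (R - {j}) \<omega> * Qi \<omega>) = (\<Sum>l\<in>R. expectation (\<lambda>\<omega>. sdet y (R - {l}) \<omega> * sdet y (R - {j}) \<omega>))"
        unfolding Qi_def by (simp add: mult.commute)
    qed
    also have "\<dots> = CC" unfolding CC_def
      by (intro sum.cong refl) (simp add: scof_diag fin mult.commute)
    finally show ?thesis .
  qed
  \<comment> \<open>Row \<open>i\<close> first, with coefficients that are linear in row \<open>k\<close>.\<close>
  have EBB: "expectation (\<lambda>\<omega>. (B \<omega>)\<^sup>2) = C2"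
  proof -
    define A where "A j \<omega> = (\<Sum>l\<in>R. g (edge k l) \<omega> * scof y R j l \<omega>)" for j \<omega>
    have tA: "tame Kk (A j)" for j unfolding A_def
      by (intro tame_intros Kk tame_g_in tame_mono[OF tame_scof[OF RN]]) (auto simp: Kk_def)
    have "B \<omega> = (\<Sum>j\<in>R. g (edge i j) \<omega> * A j \<omega>)" for \<omega>
      by (simp add: B_def A_def sum_distrib_left mult.assoc)
    then have "expectation (\<lambda>\<omega>. (B \<omega>)\<^sup>2) = (\<Sum>j\<in>R. expectation (\<lambda>\<omega>. (A j \<omega>)\<^sup>2))"
      using E_linear_square[OF edge_row(1,2)[OF R(1) Ri] Kk(3) tA] by simp
    also have "\<dots> = C2" unfolding C2_def A_def
      by (intro sum.cong refl E_linear_square[OF edge_row[OF R(2) Rk]] tame_scof RN)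
    finally show ?thesis .
  qed
  have "expectation (\<lambda>\<omega>. sdet y (insert k R) \<omega> * sdet y (insert i R) \<omega>)
    = expectation (\<lambda>\<omega>. c\<^sup>2 * (d \<omega>)\<^sup>2 + Qk \<omega> * Qi \<omega> + g (k, k) \<omega> * (g (i, i) \<omega> * (d \<omega>)\<^sup>2 + c * (d \<omega>)\<^sup>2 - d \<omega> * Qi \<omega>)
       + g (i, i) \<omega> * (c * (d \<omega>)\<^sup>2 - d \<omega> * Qk \<omega>) - c * (Qi \<omega> * d \<omega>) - c * (Qk \<omega> * d \<omega>))"
    unfolding sdet_insert[OF fin R(1)] sdet_insert[OF fin R(2)] Qi_def[symmetric] Qk_def[symmetric] d_def[symmetric]
    by (intro Bochner_Integration.integral_cong refl) (simp add: yc power2_eq_square algebra_simps)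
  also have "\<dots> = expectation (\<lambda>\<omega>. c\<^sup>2 * (d \<omega>)\<^sup>2) + expectation (\<lambda>\<omega>. Qk \<omega> * Qi \<omega>)
      + expectation (\<lambda>\<omega>. g (k, k) \<omega> * (g (i, i) \<omega> * (d \<omega>)\<^sup>2 + c * (d \<omega>)\<^sup>2 - d \<omega> * Qi \<omega>))
      + expectation (\<lambda>\<omega>. g (i, i) \<omega> * (c * (d \<omega>)\<^sup>2 - d \<omega> * Qk \<omega>)) - expectation (\<lambda>\<omega>. c * (Qi \<omega> * d \<omega>)) - expectation (\<lambda>\<omega>. c * (Qk \<omega> * d \<omega>))"
    by (subst E_diff E_add; (intro tame_intros tame_const tt order_refl)?)+ (rule refl)
  also have "expectation (\<lambda>\<omega>. g (k, k) \<omega> * (g (i, i) \<omega> * (d \<omega>)\<^sup>2 + c * (d \<omega>)\<^sup>2 - d \<omega> * Qi \<omega>)) = 0"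
  proof (rule E_mean_zero[of "insert (i, i) K"])
    have "tame (insert (i, i) K) d" "tame (insert (i, i) K) Qi" "tame (insert (i, i) K) (g (i, i))"
      using td tQi K ii by (auto intro!: tame_mono[of K] tame_g_in)
    then show "tame (insert (i, i) K) (\<lambda>\<omega>. g (i, i) \<omega> * (d \<omega>)\<^sup>2 + c * (d \<omega>)\<^sup>2 - d \<omega> * Qi \<omega>)"
      using K ii by (intro tame_intros tame_const) auto
  qed (use ii kk in auto)
  also have "expectation (\<lambda>\<omega>. g (i, i) \<omega> * (c * (d \<omega>)\<^sup>2 - d \<omega> * Qk \<omega>)) = 0"
    by (rule E_mean_zero[OF _ ii(1,2)]) (intro tame_intros tame_const td tQk K)
  finally have 1: "expectation (\<lambda>\<omega>. sdet y (insert k R) \<omega> * sdet y (insert i R) \<omega>) = c\<^sup>2 * p + CC - 2 * c * q"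
    by (simp add: EQQ EQi EQk p_def)
  have "expectation (\<lambda>\<omega>. (scof y (insert i (insert k R)) i k \<omega>)\<^sup>2)
    = expectation (\<lambda>\<omega>. (g (edge k i) \<omega>)\<^sup>2 * (d \<omega>)\<^sup>2 + (B \<omega>)\<^sup>2 + g (edge k i) \<omega> * ((- 2) * (d \<omega> * B \<omega>)))"
    unfolding scof_offdiag[OF fin R(1,2,3)] B_def[symmetric] d_def[symmetric]
    by (intro Bochner_Integration.integral_cong refl) (simp add: yc power2_eq_square algebra_simps)
  also have "\<dots> = expectation (\<lambda>\<omega>. (g (edge k i) \<omega>)\<^sup>2 * (d \<omega>)\<^sup>2) + expectation (\<lambda>\<omega>. (B \<omega>)\<^sup>2) + expectation (\<lambda>\<omega>. g (edge k i) \<omega> * ((- 2) * (d \<omega> * B \<omega>)))"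
    by (subst E_add; (intro tame_intros tame_const tt order_refl)?)+ (rule refl)
  also have "expectation (\<lambda>\<omega>. g (edge k i) \<omega> * ((- 2) * (d \<omega> * B \<omega>))) = 0"
    by (rule E_mean_zero[OF _ _ ki(2)]) (use ki offdiag_entries in \<open>auto intro!: tame_intros tame_const td tB K\<close>)
  also have "expectation (\<lambda>\<omega>. (g (edge k i) \<omega>)\<^sup>2 * (d \<omega>)\<^sup>2) = p"
    unfolding p_def by (rule E_square_one[OF tame_power[OF td] ki])
  finally have 2: "expectation (\<lambda>\<omega>. (scof y (insert i (insert k R)) i k \<omega>)\<^sup>2) = p + C2" by (simp add: EBB)
  have 3: "expectation (\<lambda>\<omega>. (sdet y (insert i R) \<omega>)\<^sup>2) = (c\<^sup>2 + 2) * p - 2 * c * q + (CC + 2 * C2)"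
    unfolding E_square_insert[OF R(1) Ri y] p_def q_def CC_def C2_def d_def ..
  show ?thesis unfolding 1 2 3 by (simp add: algebra_simps)
qed

text \<open>By isotropy a pair \<open>i \<noteq> k\<close> contributes the squared minor without \<open>k\<close>, and a pair \<open>i = k\<close> three times
  that; summing over \<open>i\<close> gives the factor \<open>card S + 2\<close>.\<close>
lemma E_square_recursion:
  assumes S: "a \<notin> S" "insert a S \<subseteq> {..<N}" and y: "y = (\<lambda>_. c)"
  shows "expectation (\<lambda>\<omega>. (sdet y (insert a S) \<omega>)\<^sup>2) =
     (c\<^sup>2 + 2) * expectation (\<lambda>\<omega>. (sdet y S \<omega>)\<^sup>2) - 2 * c * (\<Sum>j\<in>S. expectation (\<lambda>\<omega>. sdet y S \<omega> * sdet y (S - {j}) \<omega>))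
     + (real (card S) + 2) * (\<Sum>k\<in>S. expectation (\<lambda>\<omega>. (sdet y (S - {k}) \<omega>)\<^sup>2))"
proof -
  have fin: "finite S" using S by (auto intro: finite_subset)
  have yc: "y x = c" for x by (simp add: y)
  let ?p = "\<lambda>k. expectation (\<lambda>\<omega>. (sdet y (S - {k}) \<omega>)\<^sup>2)"
  have "expectation (\<lambda>\<omega>. scof y S i i \<omega> * scof y S k k \<omega>) + 2 * expectation (\<lambda>\<omega>. (scof y S i k \<omega>)\<^sup>2)
     = (if i = k then 3 * ?p k else ?p k)" if ik: "i \<in> S" "k \<in> S" for i k
  proof (cases "i = k")
    case True
    then show ?thesis using ik by (simp add: scof_diag fin power2_eq_square)
  next
    case False
    define R where "R = S - {i, k}"
    have e: "S = insert i (insert k R)" "S - {i} = insert k R" "S - {k} = insert i R" using ik False by (auto simp: R_def)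
    have "expectation (\<lambda>\<omega>. sdet y (insert k R) \<omega> * sdet y (insert i R) \<omega>)
     + 2 * expectation (\<lambda>\<omega>. (scof y (insert i (insert k R)) i k \<omega>)\<^sup>2)
     = expectation (\<lambda>\<omega>. (sdet y (insert i R) \<omega>)\<^sup>2)"
      by (rule E_cofactor_isotropy[OF _ _ False _ y]) (use S ik in \<open>auto simp: R_def\<close>)
    then show ?thesis using False ik by (simp add: scof_diag fin e(2,3) flip: e(1))
  qed
  then have "(\<Sum>i\<in>S. \<Sum>k\<in>S. expectation (\<lambda>\<omega>. scof y S i i \<omega> * scof y S k k \<omega>) + 2 * expectation (\<lambda>\<omega>. (scof y S i k \<omega>)\<^sup>2))
    = (\<Sum>i\<in>S. \<Sum>k\<in>S. ?p k + (if i = k then 2 * ?p k else 0))"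
    by (intro sum.cong refl) auto
  also have "\<dots> = (real (card S) + 2) * (\<Sum>k\<in>S. ?p k)"
    using fin by (simp add: sum.distrib sum_distrib_left distrib_right)
  finally show ?thesis unfolding E_square_insert[OF S y]
    by (simp add: sum.distrib sum_distrib_left)
qed

lemma E_mixed_recursion:
  assumes S: "a \<notin> S" "insert a S \<subseteq> {..<N}" and y: "y = (\<lambda>_. c)"
  shows "expectation (\<lambda>\<omega>. sdet y (insert a S) \<omega> * sdet y S \<omega>) =
     c * expectation (\<lambda>\<omega>. (sdet y S \<omega>)\<^sup>2) - (\<Sum>j\<in>S. expectation (\<lambda>\<omega>. sdet y S \<omega> * sdet y (S - {j}) \<omega>))"
proof -
  have fin: "finite S" using S by (auto intro: finite_subset)
  have yc: "y x = c" for x by (simp add: y)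
  have aN: "(a, a) \<in> entries" "(a, a) \<notin> core S" using S by (auto simp: entries_def core_def)
  have td: "tame (core S) (sdet y S)" using S by (intro tame_sdet) auto
  let ?Q = "\<lambda>\<omega>. \<Sum>i\<in>S. \<Sum>j\<in>S. g (edge a i) \<omega> * g (edge a j) \<omega> * scof y S i j \<omega>"
  have tQ: "tame entries ?Q"
    by (intro tame_intros tame_up[OF tame_scof] tame_g_off order_refl) (use edge_row(2)[OF S] S in auto)
  have "expectation (\<lambda>\<omega>. sdet y (insert a S) \<omega> * sdet y S \<omega>) =
    expectation (\<lambda>\<omega>. c * (sdet y S \<omega>)\<^sup>2 + g (a, a) \<omega> * (sdet y S \<omega>)\<^sup>2 - ?Q \<omega> * sdet y S \<omega>)"
    unfolding sdet_insert[OF fin S(1)] by (intro Bochner_Integration.integral_cong refl) (simp add: yc power2_eq_square algebra_simps)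
  also have "\<dots> = expectation (\<lambda>\<omega>. c * (sdet y S \<omega>)\<^sup>2) + expectation (\<lambda>\<omega>. g (a, a) \<omega> * (sdet y S \<omega>)\<^sup>2) - expectation (\<lambda>\<omega>. ?Q \<omega> * sdet y S \<omega>)"
    by (subst E_diff E_add; (intro tame_mult tame_add tame_power tame_const tame_up[OF td] tame_g_in aN order_refl tQ)?)+ (rule refl)
  also have "expectation (\<lambda>\<omega>. g (a, a) \<omega> * (sdet y S \<omega>)\<^sup>2) = 0"
    by (rule E_mean_zero[OF tame_power[OF td] aN])
  also have "expectation (\<lambda>\<omega>. ?Q \<omega> * sdet y S \<omega>) = (\<Sum>j\<in>S. expectation (\<lambda>\<omega>. sdet y S \<omega> * sdet y (S - {j}) \<omega>))"
    using E_quad_sdet[OF S td order_refl edge_row(3)[OF S]] by (simp add: mult.commute)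
  finally show ?thesis by simp
qed

text \<open>The recursions never look at which indices were removed, so by induction both means depend on
  \<open>S\<close> only through its size.\<close>
lemma second_moments:
  assumes "S \<subseteq> {..<N}"
  shows "expectation (\<lambda>\<omega>. (sdet (\<lambda>_. c) S \<omega>)\<^sup>2) = second_moment c (card S) \<and>
    (\<forall>j\<in>S. expectation (\<lambda>\<omega>. sdet (\<lambda>_. c) S \<omega> * sdet (\<lambda>_. c) (S - {j}) \<omega>) = mixed_moment c (card S))"
proof -
  have "finite S" using assms by (auto intro: finite_subset)
  then show ?thesis using assms
  proof (induction "card S" arbitrary: S rule: less_induct)
    case less
    let ?y = "\<lambda>_. c"
    have step: "expectation (\<lambda>\<omega>. (sdet ?y (insert a R) \<omega>)\<^sup>2) = second_moment c (Suc (card R))"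
      "expectation (\<lambda>\<omega>. sdet ?y (insert a R) \<omega> * sdet ?y R \<omega>) = mixed_moment c (Suc (card R))"
      if S: "S = insert a R" and a: "a \<notin> R" for a R
    proof -
      have R: "finite R" "insert a R \<subseteq> {..<N}" "R \<subseteq> {..<N}" using S less.prems by auto
      have cR: "card R < card S" using S a R by simp
      have P: "expectation (\<lambda>\<omega>. (sdet ?y R \<omega>)\<^sup>2) = second_moment c (card R)"
        and Q: "expectation (\<lambda>\<omega>. sdet ?y R \<omega> * sdet ?y (R - {j}) \<omega>) = mixed_moment c (card R)" if "j \<in> R" for j
        using less.hyps[OF cR R(1,3)] that by auto
      have P: "expectation (\<lambda>\<omega>. (sdet ?y R \<omega>)\<^sup>2) = second_moment c (card R)"
        using less.hyps[OF cR R(1,3)] by auto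
      have P': "expectation (\<lambda>\<omega>. (sdet ?y (R - {j}) \<omega>)\<^sup>2) = second_moment c (card R - 1)" if "j \<in> R" for j
      proof -
        have cj: "card (R - {j}) = card R - 1" using that R by simp
        then have "card (R - {j}) < card S" using cR by simp
        from less.hyps[OF this] show ?thesis using R cj by auto
      qed
      show "expectation (\<lambda>\<omega>. (sdet ?y (insert a R) \<omega>)\<^sup>2) = second_moment c (Suc (card R))"
        unfolding E_square_recursion[OF a R(2) refl] using P Q P' by simp
      show "expectation (\<lambda>\<omega>. sdet ?y (insert a R) \<omega> * sdet ?y R \<omega>) = mixed_moment c (Suc (card R))"
        unfolding E_mixed_recursion[OF a R(2) refl] using P Q by simp
    qed
    show ?case
    proof (cases "S = {}")
      case True then show ?thesis by (simp add: prob_space)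
    next
      case False
      have "expectation (\<lambda>\<omega>. (sdet ?y S \<omega>)\<^sup>2) = second_moment c (card S) \<and> expectation (\<lambda>\<omega>. sdet ?y S \<omega> * sdet ?y (S - {j}) \<omega>) = mixed_moment c (card S)" if j: "j \<in> S" for j
      proof -
        have e: "S = insert j (S - {j})" using j by auto
        have nj: "j \<notin> S - {j}" by simp
        have cj: "card S = Suc (card (S - {j}))" by (rule card.remove[OF less.prems(1) j])
        show ?thesis using step[OF e nj] unfolding insert_Diff[OF j] cj[symmetric] by (rule conjI)
      qed
      then show ?thesis using False by auto
    qed
  qed
qed

lemma mean_abs_sdet_upper:
  assumes "n \<le> N"
  shows "(expectation (\<lambda>\<omega>. \<bar>sdet (\<lambda>_. c) {..<n} \<omega>\<bar>))\<^sup>2 \<le> second_moment c n"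
proof -
  have t: "tame entries (sdet (\<lambda>_. c) {..<n})" using tame_up[OF tame_sdet[of "{..<n}"]] assms by auto
  have "0 \<le> variance (\<lambda>\<omega>. \<bar>sdet (\<lambda>_. c) {..<n} \<omega>\<bar>)" by (rule variance_positive)
  also have "\<dots> = expectation (\<lambda>\<omega>. \<bar>sdet (\<lambda>_. c) {..<n} \<omega>\<bar>\<^sup>2) - (expectation (\<lambda>\<omega>. \<bar>sdet (\<lambda>_. c) {..<n} \<omega>\<bar>))\<^sup>2"
    using t by (intro variance_eq tame_integrable[of entries] tame_power tame_abs)
  finally show ?thesis using second_moments[of "{..<n}" c] assms by simp
qed

end

section \<open>Growth of the second moment\<close>

text \<open>If \<open>P\<close> and \<open>Q\<close> are the generating functions \<open>\<Sum> second_moment c n w\<^sup>n / n!\<close> and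
  \<open>\<Sum> mixed_moment c (n + 1) w\<^sup>n / n!\<close>, the recursions become \<open>(1 + w) Q = c P\<close> and
  \<open>(1 - w\<^sup>2) P' = (c\<^sup>2 + 2 + 3 w) P - 2 c w Q\<close>.  Eliminating \<open>Q\<close> leaves a linear equation of first order
  with the solution below.\<close>
definition moment_egf :: "real \<Rightarrow> complex \<Rightarrow> complex" where
  "moment_egf c w = exp (of_real (c\<^sup>2) * (w / (1 + w))) * exp (- (5/2) * Ln (1 - w)) * exp (- (1/2) * Ln (1 + w))"

lemma unit_disc_nonpos:
  assumes "norm (w :: complex) < 1"
  shows "1 + w \<notin> \<real>\<^sub>\<le>\<^sub>0" "1 - w \<notin> \<real>\<^sub>\<le>\<^sub>0" "1 + w \<noteq> 0" "1 - w \<noteq> 0"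
proof -
  have "\<bar>Re w\<bar> < 1" using abs_Re_le_cmod[of w] assms by linarith
  then show "1 + w \<notin> \<real>\<^sub>\<le>\<^sub>0" "1 - w \<notin> \<real>\<^sub>\<le>\<^sub>0" by (auto simp: complex_nonpos_Reals_iff)
  then show "1 + w \<noteq> 0" "1 - w \<noteq> 0" by (metis nonpos_Reals_zero_I)+
qed

lemma moment_egf_holomorphic: "moment_egf c holomorphic_on ball 0 1"
  unfolding moment_egf_def by (intro holomorphic_intros) (auto simp: unit_disc_nonpos)

lemma moment_egf_deriv:
  assumes w: "norm w < 1"
  shows "(1 - w\<^sup>2) * deriv (moment_egf c) w = (of_real (c\<^sup>2) + 2 + 3 * w) * moment_egf c w - 2 * of_real c * w * (of_real c * moment_egf c w / (1 + w))"
proof -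
  note nz = unit_disc_nonpos[OF w]
  let ?h = "of_real (c\<^sup>2) / (1 + w)\<^sup>2 + (5/2) / (1 - w) - (1/2) / (1 + w)"
  have d1: "((\<lambda>w. of_real (c\<^sup>2) * (w / (1 + w))) has_field_derivative of_real (c\<^sup>2) / (1 + w)\<^sup>2) (at w)"
    by (rule derivative_eq_intros refl | use nz in \<open>simp add: power2_eq_square\<close>)+
  have l2: "((\<lambda>w. Ln (1 - w)) has_field_derivative - 1 / (1 - w)) (at w)"
    by (rule derivative_eq_intros refl nz | simp add: divide_inverse)+
  have l3: "((\<lambda>w. Ln (1 + w)) has_field_derivative 1 / (1 + w)) (at w)"
    by (rule derivative_eq_intros refl nz | simp add: divide_inverse)+
  have d2: "((\<lambda>w. - (5/2) * Ln (1 - w)) has_field_derivative (5/2) / (1 - w)) (at w)"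
    using DERIV_cmult[OF l2, of "- (5/2)"] by simp
  have d3: "((\<lambda>w. - (1/2) * Ln (1 + w)) has_field_derivative - (1/2) / (1 + w)) (at w)"
    using DERIV_cmult[OF l3, of "- (1/2)"] by simp
  have "(moment_egf c has_field_derivative moment_egf c w * ?h) (at w)"
    unfolding moment_egf_def[abs_def]
    by (rule DERIV_cong[OF DERIV_mult[OF DERIV_mult[OF DERIV_fun_exp[OF d1] DERIV_fun_exp[OF d2]] DERIV_fun_exp[OF d3]]])
      (simp add: algebra_simps)
  then have d: "deriv (moment_egf c) w = moment_egf c w * ?h" by (rule DERIV_imp_deriv)
  have k: "(1 - w\<^sup>2) * ?h = of_real (c\<^sup>2) + 2 + 3 * w - 2 * of_real c * w * (of_real c / (1 + w))"
  proof -
    have e: "1 - w\<^sup>2 = (1 - w) * (1 + w)" by (simp add: power2_eq_square algebra_simps)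
    have "(P * Q) * (C / Q\<^sup>2 + a / P - b / Q) = C * P / Q + a * Q - b * P"
      if "P \<noteq> 0" "Q \<noteq> 0" for P Q C a b :: complex
      using that by (simp add: field_simps power2_eq_square)
    from this[OF nz(4,3)] have "(1 - w\<^sup>2) * ?h = of_real (c\<^sup>2) * (1 - w) / (1 + w) + (5/2) * (1 + w) - (1/2) * (1 - w)"
      unfolding e .
    also have "of_real (c\<^sup>2) * (1 - w) / (1 + w) = of_real (c\<^sup>2) - 2 * of_real c * w * (of_real c / (1 + w))"
      using nz by (simp add: field_simps power2_eq_square)
    also have "(C - T) + (5/2) * (1 + w) - (1/2) * (1 - w) = C + 2 + 3 * w - T" for C T by (simp add: field_simps)
    finally show ?thesis .
  qed
  have "(1 - w\<^sup>2) * deriv (moment_egf c) w = moment_egf c w * ((1 - w\<^sup>2) * ?h)"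
    unfolding d by (simp only: mult.left_commute)
  also have "\<dots> = (of_real (c\<^sup>2) + 2 + 3 * w) * moment_egf c w - 2 * of_real c * w * (of_real c * moment_egf c w / (1 + w))"
    unfolding k by (simp add: algebra_simps)
  finally show ?thesis .
qed

text \<open>Rather than sum the moments, for which convergence would have to be known first, expand the
  explicit holomorphic function: its Taylor coefficients satisfy the same recursion.\<close>
lemma moment_egf_coeffs:
  fixes c defines "A \<equiv> fps_expansion (moment_egf c) 0"
  shows "fps_nth A n = of_real (second_moment c n / fact n)"
proof -
  define G where "G w = of_real c * moment_egf c w / (1 + w)" for w
  define B where "B = fps_expansion G 0"
  have GH: "G holomorphic_on ball 0 1" unfolding G_def
    by (intro holomorphic_intros moment_egf_holomorphic) (auto simp: unit_disc_nonpos)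
  have A: "moment_egf c has_fps_expansion A" unfolding A_def
    by (rule has_fps_expansion_fps_expansion[OF _ _ moment_egf_holomorphic]) auto
  have B: "G has_fps_expansion B" unfolding B_def
    by (rule has_fps_expansion_fps_expansion[OF _ _ GH]) auto
  have near: "\<forall>\<^sub>F w in nhds 0. norm (w :: complex) < 1"
    using eventually_nhds_in_open[of "ball 0 (1::real)" "0::complex"] by (simp add: dist_norm)
  have e1: "(1 + fps_X) * B = fps_const (of_real c) * A"
  proof (rule fps_expansion_unique_complex)
    show "(\<lambda>w. of_real c * moment_egf c w) has_fps_expansion fps_const (of_real c) * A"
      by (intro fps_expansion_intros A)
    have "(\<lambda>w. (1 + w) * G w) has_fps_expansion (1 + fps_X) * B" by (intro fps_expansion_intros B)
    moreover have ev: "\<forall>\<^sub>F w in nhds 0. (1 + w) * G w = of_real c * moment_egf c w"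
      using near by eventually_elim (auto simp: G_def unit_disc_nonpos)
    ultimately show "(\<lambda>w. of_real c * moment_egf c w) has_fps_expansion (1 + fps_X) * B"
      using has_fps_expansion_cong[OF ev refl] by simp
  qed
  have e2: "(1 - fps_X ^ 2) * fps_deriv A = (fps_const (of_real (c\<^sup>2) + 2) + 3 * fps_X) * A - fps_const (2 * of_real c) * fps_X * B"
  proof (rule fps_expansion_unique_complex)
    show "(\<lambda>w. (of_real (c\<^sup>2) + 2 + 3 * w) * moment_egf c w - 2 * of_real c * w * G w) has_fps_expansion
       (fps_const (of_real (c\<^sup>2) + 2) + 3 * fps_X) * A - fps_const (2 * of_real c) * fps_X * B"
      by (intro fps_expansion_intros A B)
    have "(\<lambda>w. (1 - w\<^sup>2) * deriv (moment_egf c) w) has_fps_expansion (1 - fps_X ^ 2) * fps_deriv A" by (intro fps_expansion_intros A)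
    moreover have ev: "\<forall>\<^sub>F w in nhds 0. (1 - w\<^sup>2) * deriv (moment_egf c) w = (of_real (c\<^sup>2) + 2 + 3 * w) * moment_egf c w - 2 * of_real c * w * G w"
      using near by eventually_elim (simp only: G_def moment_egf_deriv)
    ultimately show "(\<lambda>w. (of_real (c\<^sup>2) + 2 + 3 * w) * moment_egf c w - 2 * of_real c * w * G w) has_fps_expansion (1 - fps_X ^ 2) * fps_deriv A"
      using has_fps_expansion_cong[OF ev refl] by simp
  qed
  let ?a = "\<lambda>n. fps_nth A n" and ?b = "\<lambda>n. fps_nth B n"
  have b: "?b n = of_real c * ?a n - (if n = 0 then 0 else ?b (n - 1))" for n
    using arg_cong[OF e1, of "\<lambda>F. fps_nth F n"] by (cases n) (auto simp: distrib_right eq_diff_eq)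
  have a: "of_nat (Suc n) * ?a (Suc n) = (of_real (c\<^sup>2) + 2) * ?a n
      + (if n = 0 then 0 else of_nat (n + 2) * ?a (n - 1) - 2 * of_real c * ?b (n - 1))" for n
  proof -
    have "(1 - fps_X ^ 2) * fps_deriv A = fps_deriv A - fps_X ^ 2 * fps_deriv A" by (simp add: algebra_simps)
    moreover have "(fps_const (of_real (c\<^sup>2) + 2) + 3 * fps_X) * A - fps_const (2 * of_real c) * fps_X * B
       = fps_const (of_real (c\<^sup>2) + 2) * A + fps_const 3 * (fps_X * A) - fps_const (2 * of_real c) * (fps_X * B)"
      by (simp add: algebra_simps numeral_fps_const)
    ultimately have "fps_nth (fps_deriv A - fps_X ^ 2 * fps_deriv A) n =
      fps_nth (fps_const (of_real (c\<^sup>2) + 2) * A + fps_const 3 * (fps_X * A) - fps_const (2 * of_real c) * (fps_X * B)) n"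
      using e2 by simp
    then have "of_nat (Suc n) * ?a (Suc n) - (if n < 2 then 0 else of_nat (n - 1) * ?a (n - 1)) = (of_real (c\<^sup>2) + 2) * ?a n
      + (if n = 0 then 0 else 3 * ?a (n - 1) - 2 * of_real c * ?b (n - 1))"
      by (cases n) (auto simp: fps_X_power_mult_nth less_Suc_eq)
    moreover have "(if n < 2 then 0 else of_nat (n - 1) * ?a (n - 1)) = (if n = 0 then 0 else of_nat (n - 1) * ?a (n - 1))"
      by (cases "n = 1") auto
    ultimately show ?thesis by (cases n) (auto simp: algebra_simps)
  qed
  have "?a n = of_real (second_moment c n / fact n) \<and> (n > 0 \<longrightarrow> ?a (n - 1) = of_real (second_moment c (n - 1) / fact (n - 1)) \<and> ?b (n - 1) = of_real (mixed_moment c n / fact (n - 1)))"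
  proof (induction n)
    case 0
    have "?a 0 = moment_egf c 0" unfolding A_def fps_expansion_def by simp
    then show ?case by (simp add: moment_egf_def)
  next
    case (Suc n)
    have an: "?a n = of_real (second_moment c n / fact n)" using Suc by simp
    have bn: "?b n = of_real (mixed_moment c (Suc n) / fact n)"
    proof (cases n)
      case 0 then show ?thesis using b[of 0] an by simp
    next
      case (Suc m)
      have f: "fact n = real n * fact m" using Suc by (simp add: fact_Suc)
      have "?b n = of_real (c * (second_moment c n / fact n) - mixed_moment c n / fact m)"
        using b[of n] an \<open>?a n = _ \<and> _\<close> Suc by simp
      also have "c * (second_moment c n / fact n) - mixed_moment c n / fact m = mixed_moment c (Suc n) / fact n"
        unfolding f mixed_moment.simps(2) using Suc by (simp add: diff_divide_distrib del: second_moment.simps mixed_moment.simps)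
      finally show ?thesis .
    qed
    have "of_nat (Suc n) * ?a (Suc n) = of_real (second_moment c (Suc n) / fact n)"
    proof (cases n)
      case 0 then show ?thesis using a[of 0] an by simp
    next
      case (Suc m)
      have f: "fact n = real n * fact m" using Suc by (simp add: fact_Suc)
      have "of_nat (Suc n) * ?a (Suc n) = of_real ((c\<^sup>2 + 2) * (second_moment c n / fact n) + (real (n + 2) * (second_moment c m / fact m) - 2 * c * (mixed_moment c n / fact m)))"
        using a[of n] an \<open>?a n = _ \<and> _\<close> Suc by simp
      also have "(c\<^sup>2 + 2) * (second_moment c n / fact n) + (real (n + 2) * (second_moment c m / fact m) - 2 * c * (mixed_moment c n / fact m)) = second_moment c (Suc n) / fact n"
        unfolding f second_moment.simps(2) using Suc
        by (simp add: add_divide_distrib diff_divide_distrib del: second_moment.simps mixed_moment.simps)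
      finally show ?thesis .
    qed
    then have "?a (Suc n) = of_real (second_moment c (Suc n) / fact n) / of_nat (Suc n)" by (simp add: field_simps del: of_nat_Suc)
    also have "\<dots> = of_real (second_moment c (Suc n) / fact (Suc n))" by (simp del: second_moment.simps)
    finally show ?case using an bn by simp
  qed
  then show ?thesis by simp
qed

text \<open>On \<open>\<bar>w\<bar> = \<rho>\<close> the real part of \<open>w / (1 + w)\<close> is largest at \<open>w = \<rho>\<close>, and both \<open>1 - w\<close> and \<open>1 + w\<close> have
  modulus at least \<open>1 - \<rho>\<close>.\<close>
lemma moment_egf_bound:
  assumes w: "norm w = \<rho>" and r: "\<rho> < 1"
  shows "norm (moment_egf c w) \<le> exp (c\<^sup>2 * (\<rho> / (1 + \<rho>))) / (1 - \<rho>) ^ 3"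
proof -
  have r0: "\<rho> \<ge> 0" using w by auto
  have w1: "norm w < 1" using w r by simp
  note nz = unit_disc_nonpos[OF w1]
  have re: "Re (w / (1 + w)) \<le> \<rho> / (1 + \<rho>)"
  proof -
    have e: "w / (1 + w) = 1 - 1 / (1 + w)" using nz by (simp add: field_simps)
    have n2: "(norm (1 + w))\<^sup>2 = 1 + 2 * Re w + \<rho>\<^sup>2"
      unfolding w[symmetric] cmod_power2 by (simp add: power2_eq_square algebra_simps)
    have pos: "1 + 2 * Re w + \<rho>\<^sup>2 > 0" using n2 nz by (metis zero_less_power2 norm_eq_zero)
    have rw: "Re w \<le> \<rho>" using complex_Re_le_cmod[of w] w by simp
    have "Re (1 / (1 + w)) = (1 + Re w) / (1 + 2 * Re w + \<rho>\<^sup>2)"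
      using n2 by (simp add: Re_divide cmod_power2)
    also have "\<dots> \<ge> 1 / (1 + \<rho>)"
    proof -
      have "0 \<le> (\<rho> - Re w) * (1 - \<rho>)" using rw r by simp
      then have "1 + 2 * Re w + \<rho>\<^sup>2 \<le> (1 + Re w) * (1 + \<rho>)" by (simp add: algebra_simps power2_eq_square)
      then show ?thesis using pos r0 by (simp add: field_simps)
    qed
    finally have "Re (w / (1 + w)) \<le> 1 - 1 / (1 + \<rho>)" using e by simp
    also have "\<dots> = \<rho> / (1 + \<rho>)" using r0 by (simp add: field_simps)
    finally show ?thesis .
  qed
  have ee: "exp (c\<^sup>2 * Re (w / (1 + w))) \<le> exp (c\<^sup>2 * (\<rho> / (1 + \<rho>)))"
    unfolding exp_le_cancel_iff by (rule mult_left_mono[OF re]) simp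
  have lm: "norm (1 - w) \<ge> 1 - \<rho>" using norm_triangle_ineq2[of 1 w] w by simp
  have lp: "norm (1 + w) \<ge> 1 - \<rho>" using norm_triangle_ineq2[of 1 "-w"] w by simp
  have "norm (moment_egf c w) = exp (c\<^sup>2 * Re (w / (1 + w))) * exp (- (5/2) * ln (norm (1 - w))) * exp (- (1/2) * ln (norm (1 + w)))"
  proof -
    have "Re (of_real (c\<^sup>2) * (w / (1 + w))) = c\<^sup>2 * Re (w / (1 + w))"
      by (simp only: times_complex.sel Re_complex_of_real Im_complex_of_real mult_zero_left diff_zero)
    then show ?thesis using nz unfolding moment_egf_def norm_mult norm_exp_eq_Re by simp
  qed
  also have "\<dots> \<le> exp (c\<^sup>2 * (\<rho> / (1 + \<rho>))) * exp (- (5/2) * ln (1 - \<rho>)) * exp (- (1/2) * ln (1 - \<rho>))"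
    by (intro mult_mono ee) (use lm lp r nz in auto)
  also have "\<dots> = exp (c\<^sup>2 * (\<rho> / (1 + \<rho>))) * exp (- (of_nat 3 * ln (1 - \<rho>)))"
    by (simp flip: exp_add)
  also have "exp (- (of_nat 3 * ln (1 - \<rho>))) = 1 / (1 - \<rho>) ^ 3"
    using r unfolding exp_minus exp_of_nat_mult by (simp add: field_simps)
  finally show ?thesis by simp
qed

lemma second_moment_bound:
  assumes "0 < \<rho>" "\<rho> < 1"
  shows "second_moment c n \<le> fact n * (exp (c\<^sup>2 * (\<rho> / (1 + \<rho>))) / (1 - \<rho>) ^ 3) / \<rho> ^ n"
proof -
  have sub: "cball 0 \<rho> \<subseteq> ball (0::complex) 1" using assms by auto
  have "norm ((deriv ^^ n) (moment_egf c) 0) \<le> fact n * (exp (c\<^sup>2 * (\<rho> / (1 + \<rho>))) / (1 - \<rho>) ^ 3) / \<rho> ^ n"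
  proof (rule Cauchy_inequality)
    show "moment_egf c holomorphic_on ball 0 \<rho>" using moment_egf_holomorphic by (rule holomorphic_on_subset) (use assms in auto)
    show "continuous_on (cball 0 \<rho>) (moment_egf c)"
      using holomorphic_on_imp_continuous_on[OF moment_egf_holomorphic] sub continuous_on_subset by blast
  qed (use assms moment_egf_bound in auto)
  moreover have "(deriv ^^ n) (moment_egf c) 0 = of_real (second_moment c n)"
    using moment_egf_coeffs[of c n] by (simp add: fps_expansion_def)
  ultimately show ?thesis by (simp del: of_real_power) 
qed

text \<open>The radius \<open>m (1 - 1 / n)\<close> keeps distance \<open>1 / n\<close> from the singularity even for \<open>m = 1\<close>, at the cost
  of a bounded factor in \<open>\<rho>\<^sup>n\<close>.\<close>
lemma second_moment_upper:
  assumes n: "n \<ge> 2" and m: "0 < m" "m \<le> 1"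
  shows "second_moment c n \<le> fact n * (exp 2 * real n ^ 3) * exp (c\<^sup>2 * (m / (1 + m))) / m ^ n"
proof -
  define \<rho> where "\<rho> = m * (1 - 1 / real n)"
  have f: "0 < 1 - 1 / real n" "1 - 1 / real n < 1" using n by auto
  have "m * (1 - 1 / real n) \<le> 1 * (1 - 1 / real n)" using m f by (intro mult_right_mono) auto
  then have r: "0 < \<rho>" "\<rho> \<le> 1 - 1 / real n" "\<rho> \<le> m"
    using m f by (auto simp: \<rho>_def mult_le_cancel_left2)
  have r1: "\<rho> < 1" using r(2) f by linarith
  have d: "1 / (1 - \<rho>) ^ 3 \<le> real n ^ 3"
  proof -
    have "(1 / real n) ^ 3 \<le> (1 - \<rho>) ^ 3" using r r1 by (intro power_mono) auto
    then have "1 / (1 - \<rho>) ^ 3 \<le> 1 / (1 / real n) ^ 3" using n r r1 by (intro divide_left_mono) auto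
    then show ?thesis by (simp add: power_one_over)
  qed
  have p: "1 / \<rho> ^ n \<le> exp 2 / m ^ n"
  proof -
    have "1 / (1 - 1 / real n) = 1 + 1 / (real n - 1)" using n by (simp add: field_simps)
    also have "\<dots> \<le> exp (1 / (real n - 1))" by (rule exp_ge_add_one_self)
    also have "\<dots> \<le> exp (2 / real n)" using n by (simp add: field_simps)
    finally have "(1 / (1 - 1 / real n)) ^ n \<le> exp (2 / real n) ^ n" using f by (intro power_mono) auto
    also have "\<dots> = exp 2" using n by (simp flip: exp_of_nat_mult)
    finally have "1 / (1 - 1 / real n) ^ n \<le> exp 2" by (simp add: power_one_over)
    then have "1 / (1 - 1 / real n) ^ n / m ^ n \<le> exp 2 / m ^ n" using m by (intro divide_right_mono) auto
    then show ?thesis unfolding \<rho>_def power_mult_distrib by (simp add: mult.commute)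
  qed
  have e: "\<rho> / (1 + \<rho>) \<le> m / (1 + m)" using r m by (simp add: field_simps)
  have ee: "exp (c\<^sup>2 * (\<rho> / (1 + \<rho>))) \<le> exp (c\<^sup>2 * (m / (1 + m)))"
    unfolding exp_le_cancel_iff by (rule mult_left_mono[OF e]) simp
  have "second_moment c n \<le> fact n * (exp (c\<^sup>2 * (\<rho> / (1 + \<rho>))) / (1 - \<rho>) ^ 3) / \<rho> ^ n" by (rule second_moment_bound) (use r r1 in auto)
  also have "\<dots> = fact n * (exp (c\<^sup>2 * (\<rho> / (1 + \<rho>))) * (1 / (1 - \<rho>) ^ 3)) * (1 / \<rho> ^ n)" by simp
  also have "\<dots> \<le> fact n * (exp (c\<^sup>2 * (m / (1 + m))) * real n ^ 3) * (exp 2 / m ^ n)"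
    by (intro mult_mono d p ee order_refl) (use r r1 in auto)
  also have "\<dots> = fact n * (exp 2 * real n ^ 3) * exp (c\<^sup>2 * (m / (1 + m))) / m ^ n" by simp
  finally show ?thesis .
qed

section \<open>The logarithmic potential of the semicircle law\<close>

text \<open>On the unit circle \<open>sin\<^sup>2 \<theta> = - (w\<^sup>2 - 2 + w\<^bsup>-2\<^esup>) / 4\<close>, so the integral is a contour integral of
  \<open>f w = Ln (1 - v w)\<close> against \<open>w\<close>, \<open>1 / w\<close> and \<open>1 / w\<^sup>3\<close>.  The first vanishes by Cauchy's theorem, the
  second because \<open>f 0 = 0\<close>, and the third gives \<open>f'' 0 = - v\<^sup>2\<close>.\<close>
lemma circle_log_integral:
  assumes v: "norm (v :: complex) < 1"
  shows "((\<lambda>\<theta>. (sin \<theta>)\<^sup>2 * ln (norm (1 - v * cis \<theta>))) has_integral (pi / 4 * Re (v\<^sup>2))) {0..2 * pi}"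
proof -
  define f where "f w = Ln (1 - v * w)" for w
  define A where "A = {w. norm (v * w) < 1}"
  have A: "open A" unfolding A_def by (intro open_Collect_less continuous_intros)
  have zA: "0 \<in> A" by (simp add: A_def)
  have cA: "cball 0 1 \<subseteq> A"
  proof
    fix w :: complex assume "w \<in> cball 0 1"
    then have "norm (v * w) \<le> norm v * 1" by (simp add: norm_mult mult_left_le)
    then show "w \<in> A" using v by (simp add: A_def)
  qed
  have np: "1 - v * w \<notin> \<real>\<^sub>\<le>\<^sub>0" if "w \<in> A" for w
    using abs_Re_le_cmod[of "v * w"] that by (auto simp: A_def complex_nonpos_Reals_iff)
  have nz: "1 - v * w \<noteq> 0" if "w \<in> A" for w using np[OF that] by (metis nonpos_Reals_zero_I)
  have fd: "(f has_field_derivative - v / (1 - v * w)) (at w)" if "w \<in> A" for w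
    unfolding f_def[abs_def] by (rule derivative_eq_intros refl np[OF that] | simp add: divide_inverse mult.commute)+
  have fA: "f holomorphic_on A"
    using fd A holomorphic_on_open by blast
  have f1: "deriv f w = - v / (1 - v * w)" if "w \<in> A" for w using fd[OF that] by (rule DERIV_imp_deriv)
  have "(deriv ^^ 2) f 0 = deriv (\<lambda>w. - v / (1 - v * w)) 0"
  proof -
    have "\<forall>\<^sub>F w in nhds 0. deriv f w = - v / (1 - v * w)"
      using eventually_nhds_in_open[OF A zA] by eventually_elim (rule f1)
    then have "deriv (deriv f) 0 = deriv (\<lambda>w. - v / (1 - v * w)) 0" by (intro deriv_cong_ev) auto
    then show ?thesis by (simp add: numeral_2_eq_2)
  qed
  also have "\<dots> = - (v\<^sup>2)"
    by (rule DERIV_imp_deriv) (rule derivative_eq_intros refl | simp add: power2_eq_square)+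
  finally have f2: "(deriv ^^ 2) f 0 = - (v\<^sup>2)" .
  have hc: "f holomorphic_on cball 0 1" using fA cA by (rule holomorphic_on_subset)
  have hb: "f holomorphic_on ball 0 1" using hc by (rule holomorphic_on_subset) auto
  have cc: "continuous_on (cball 0 1) f" using hc by (rule holomorphic_on_imp_continuous_on)
  have i1: "((\<lambda>w. f w / w ^ 3) has_contour_integral (- (pi * \<i> * v\<^sup>2))) (circlepath 0 1)"
    using Cauchy_has_contour_integral_higher_derivative_circlepath[OF cc hb, of 0 2] by (simp add: f2)
  have i2: "((\<lambda>w. f w / w) has_contour_integral 0) (circlepath 0 1)"
    using Cauchy_integral_circlepath_simple[OF hc, of 0] by (simp add: f_def)
  have i3: "((\<lambda>w. f w * w) has_contour_integral 0) (circlepath 0 1)"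
  proof (rule Cauchy_theorem_convex_simple)
    show "(\<lambda>w. f w * w) holomorphic_on cball 0 1" by (intro holomorphic_intros hc)
  qed auto
  define S where "S w = (- 1 / (4 * \<i>)) * (f w * w - 2 * (f w / w) + f w / w ^ 3)" for w
  have "(S has_contour_integral ((- 1 / (4 * \<i>)) * (0 - 2 * 0 + (- (pi * \<i> * v\<^sup>2))))) (circlepath 0 1)"
    unfolding S_def by (intro has_contour_integral_lmul has_contour_integral_add has_contour_integral_diff i1 i2 i3)
  then have "(S has_contour_integral (pi / 4 * v\<^sup>2)) (circlepath 0 1)" by (simp add: field_simps)
  then have "((\<lambda>t. S (cis t) * \<i> * cis t) has_integral (pi / 4 * v\<^sup>2)) {0..2 * pi}"
    unfolding circlepath_def by (subst (asm) has_contour_integral_part_circlepath_iff) auto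
  moreover have "S (cis t) * \<i> * cis t = of_real ((sin t)\<^sup>2) * f (cis t)" for t
  proof -
    define w where "w = cis t"
    have w0: "w \<noteq> 0" by (simp add: w_def)
    have inv: "inverse w = cis (- t)" by (simp add: w_def)
    have s: "w - inverse w = 2 * \<i> * of_real (sin t)" unfolding inv w_def by (simp add: complex_eq_iff)
    have "S w * \<i> * w = - (1 / 4) * f w * (w - inverse w)\<^sup>2"
      unfolding S_def using w0 by (simp add: field_simps power2_eq_square power3_eq_cube)
    also have "\<dots> = of_real ((sin t)\<^sup>2) * f w" unfolding s by (simp add: power_mult_distrib)
    finally show ?thesis by (simp add: w_def)
  qed
  ultimately have "((\<lambda>t. of_real ((sin t)\<^sup>2) * f (cis t)) has_integral (pi / 4 * v\<^sup>2)) {0..2 * pi}" by simp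
  from has_integral_Re[OF this]
  have "((\<lambda>t. Re (of_real ((sin t)\<^sup>2) * f (cis t))) has_integral Re (of_real (pi / 4) * v\<^sup>2)) {0..2 * pi}" by simp
  moreover have "Re (of_real ((sin t)\<^sup>2) * f (cis t)) = (sin t)\<^sup>2 * ln (norm (1 - v * cis t))" for t
  proof -
    have "cis t \<in> A" using cA by (auto simp: subset_iff)
    then have "Re (f (cis t)) = ln (norm (1 - v * cis t))" unfolding f_def using nz by (simp add: Re_Ln)
    then show ?thesis by (simp only: times_complex.sel Re_complex_of_real Im_complex_of_real mult_zero_left diff_zero)
  qed
  moreover have "Re (of_real (pi / 4) * v\<^sup>2) = pi / 4 * Re (v\<^sup>2)" by simp
  ultimately show ?thesis by (simp only:)
qed

text \<open>Substitute \<open>y = 2 cos \<theta>\<close>.  The full circle covers the interval twice.\<close>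
lemma semicircle_integral:
  assumes h: "continuous_on UNIV (h :: real \<Rightarrow> real)"
    and I: "((\<lambda>\<theta>. (sin \<theta>)\<^sup>2 * h (2 * cos \<theta>)) has_integral I) {0..2 * pi}"
  shows "integrable mu_sc h" "(\<integral>y. h y \<partial>mu_sc) = I / pi"
proof -
  let ?d = "\<lambda>x. 1 / (2 * pi) * sqrt (4 - x\<^sup>2) * indicator {x. \<bar>x\<bar> \<le> 2} x :: real"
  let ?F = "\<lambda>y. sqrt (4 - y\<^sup>2) * h y"
  have hm [measurable]: "h \<in> borel_measurable borel" using h by (rule borel_measurable_continuous_onI)
  have sym: "{x::real. \<bar>x\<bar> \<le> 2} = {-2..2}" by auto
  have dn: "?d x \<ge> 0" for x
    by (auto simp: indicator_def abs_le_square_iff[of x 2, simplified])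
  have Fc: "continuous_on {-2..2} ?F"
    by (intro continuous_intros continuous_on_subset[OF h]) auto
  have e: "?d y * h y = (1 / (2 * pi)) * (indicator {-2..2} y * ?F y)" for y unfolding sym by simp
  have Fi: "integrable lborel (\<lambda>y. indicator {-2..2} y *\<^sub>R ?F y)"
    by (rule borel_integrable_compact[OF _ Fc, unfolded set_integrable_def]) auto
  have Fint: "(\<integral>y. indicator {-2..2} y * ?F y \<partial>lborel) = integral {-2..2} ?F"
    using set_borel_integral_eq_integral[of "{-2..2}" ?F] Fi by (simp add: set_integrable_def set_lebesgue_integral_def)
  have di: "integrable lborel (\<lambda>x. ?d x *\<^sub>R h x)"
    unfolding real_scaleR_def e using Fi by (intro integrable_mult_right) simp
  show "integrable mu_sc h" unfolding mu_sc_def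
    by (rule integrable_density[THEN iffD2, OF _ _ _ di]) (use dn in auto)
  have "(\<integral>y. h y \<partial>mu_sc) = (\<integral>x. ?d x *\<^sub>R h x \<partial>lborel)"
    unfolding mu_sc_def by (rule integral_density) (use dn in auto)
  also have "\<dots> = 1 / (2 * pi) * integral {-2..2} ?F"
    unfolding real_scaleR_def e Fint[symmetric] by (rule integral_mult_right_zero)
  finally have 1: "(\<integral>y. h y \<partial>mu_sc) = 1 / (2 * pi) * integral {-2..2} ?F" .
  have cd: "((\<lambda>x. 2 * cos x) has_field_derivative - (2 * sin x)) (at x within X)" for x X
    by (rule derivative_eq_intros refl | simp)+
  have rng: "(\<lambda>x. 2 * cos x) ` {a..b} \<subseteq> {-2..2}" for a b :: real
  proof safe
    fix x :: real
    show "2 * cos x \<in> {-2..2}" using cos_ge_minus_one[of x] cos_le_one[of x] by simp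
  qed
  have sq: "sqrt (4 - (2 * cos x)\<^sup>2) = 2 * \<bar>sin x\<bar>" for x :: real
  proof -
    have "4 - (2 * cos x)\<^sup>2 = (2 * \<bar>sin x\<bar>)\<^sup>2" by (simp add: power_mult_distrib sin_squared_eq)
    then show ?thesis by (simp only: real_sqrt_abs)
  qed
  have "((\<lambda>x. - (2 * sin x) *\<^sub>R ?F (2 * cos x)) has_integral (integral {2 * cos 0..2 * cos pi} ?F - integral {2 * cos pi..2 * cos 0} ?F)) {0..pi}"
    by (rule has_integral_substitution_general[of "{}" 0 pi "\<lambda>x. 2 * cos x" "-2" 2 ?F])
      (use rng Fc cd in \<open>auto intro!: continuous_intros\<close>)
  note A0 = has_integral_neg[OF this]
  have A1: "- (integral {2 * cos 0..2 * cos pi} ?F - integral {2 * cos pi..2 * cos 0} ?F) = integral {-2..2} ?F" by simp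
  have A2: "- (- (2 * sin x) *\<^sub>R ?F (2 * cos x)) = 4 * ((sin x)\<^sup>2 * h (2 * cos x))" if "x \<in> {0..pi}" for x
    unfolding sq using that sin_ge_zero[of x] by (simp add: power2_eq_square)
  have A: "((\<lambda>x. 4 * ((sin x)\<^sup>2 * h (2 * cos x))) has_integral integral {-2..2} ?F) {0..pi}"
    using has_integral_eq[OF A2 A0] unfolding A1 .
  have "((\<lambda>x. - (2 * sin x) *\<^sub>R ?F (2 * cos x)) has_integral (integral {2 * cos pi..2 * cos (2 * pi)} ?F - integral {2 * cos (2 * pi)..2 * cos pi} ?F)) {pi..2 * pi}"
    by (rule has_integral_substitution_general[of "{}" pi "2 * pi" "\<lambda>x. 2 * cos x" "-2" 2 ?F])
      (use rng Fc cd in \<open>auto intro!: continuous_intros\<close>)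
  note B0 = this
  have B1: "integral {2 * cos pi..2 * cos (2 * pi)} ?F - integral {2 * cos (2 * pi)..2 * cos pi} ?F = integral {-2..2} ?F" by simp
  have B2: "- (2 * sin x) *\<^sub>R ?F (2 * cos x) = 4 * ((sin x)\<^sup>2 * h (2 * cos x))" if "x \<in> {pi..2 * pi}" for x
  proof -
    have "sin x \<le> 0" using that sin_le_zero[of x] by (cases "x = 2 * pi") auto
    then show ?thesis unfolding sq by (simp add: power2_eq_square)
  qed
  have B: "((\<lambda>x. 4 * ((sin x)\<^sup>2 * h (2 * cos x))) has_integral integral {-2..2} ?F) {pi..2 * pi}"
    using has_integral_eq[OF B2 B0] unfolding B1 .
  have AB: "((\<lambda>x. 4 * ((sin x)\<^sup>2 * h (2 * cos x))) has_integral (integral {-2..2} ?F + integral {-2..2} ?F)) {0..2 * pi}"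
    by (rule has_integral_combine[OF _ _ A B]) auto
  have I4: "((\<lambda>x. 4 * ((sin x)\<^sup>2 * h (2 * cos x))) has_integral (4 * I)) {0..2 * pi}"
    by (rule has_integral_mult_right[OF I])
  have "4 * I = integral {-2..2} ?F + integral {-2..2} ?F" by (rule has_integral_unique[OF I4 AB])
  then show "(\<integral>y. h y \<partial>mu_sc) = I / pi" unfolding 1 by (simp add: field_simps)
qed

text \<open>Off the real axis the integrand is continuous and \<open>z - 2 cos \<theta> = (1 - v e\<^bsup>i\<theta>\<^esup>) (1 - v e\<^bsup>-i\<theta>\<^esup>) / v\<close>.  The
  second factor has the modulus of \<open>1 - cnj v e\<^bsup>i\<theta>\<^esup>\<close>, so \<open>circle_log_integral\<close> applies to both.\<close>
lemma log_potential_complex: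
  assumes v: "norm v < 1" "v \<noteq> 0" and z: "z = v + 1 / v" and im: "Im z \<noteq> 0"
  shows "integrable mu_sc (\<lambda>y. ln (norm (z - of_real y)))"
    "(\<integral>y. ln (norm (z - of_real y)) \<partial>mu_sc) = - ln (norm v) + Re (v\<^sup>2) / 2"
proof -
  have nz: "z - of_real y \<noteq> 0" for y using im by (auto simp: complex_eq_iff)
  have fac: "z - of_real (2 * cos \<theta>) = (1 - v * cis \<theta>) * (1 - v * cis (- \<theta>)) / v" for \<theta>
  proof -
    have "cis \<theta> + cis (- \<theta>) = of_real (2 * cos \<theta>)" by (simp add: complex_eq_iff)
    moreover have "cis \<theta> * cis (- \<theta>) = 1" by (simp add: cis_mult)
    ultimately have "(1 - v * cis \<theta>) * (1 - v * cis (- \<theta>)) = 1 - v * of_real (2 * cos \<theta>) + v * v"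
      by (simp add: algebra_simps) (metis distrib_left mult.commute mult.left_commute mult.right_neutral)
    then show ?thesis unfolding z using v(2) by (simp add: field_simps)
  qed
  have nv: "1 - u * cis \<theta> \<noteq> 0" if "norm u < 1" for u \<theta>
    using norm_triangle_ineq2[of 1 "u * cis \<theta>"] that by (auto simp: norm_mult)
  have cnv: "norm (1 - v * cis (- \<theta>)) = norm (1 - cnj v * cis \<theta>)" for \<theta>
  proof -
    have "cnj (1 - v * cis (- \<theta>)) = 1 - cnj v * cis \<theta>" by (simp add: cis_cnj)
    then show ?thesis by (metis complex_mod_cnj)
  qed
  have ln_fac: "ln (norm (z - of_real (2 * cos \<theta>))) = ln (norm (1 - v * cis \<theta>)) + ln (norm (1 - cnj v * cis \<theta>)) - ln (norm v)" for \<theta>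
    unfolding fac norm_divide norm_mult cnv using nv[of v \<theta>] nv[of "cnj v" \<theta>] v
    by (simp add: ln_div ln_mult)
  have s2: "((\<lambda>\<theta>. (sin \<theta>)\<^sup>2) has_integral pi) {0..2 * pi}"
  proof -
    have "((\<lambda>\<theta>. (sin \<theta>)\<^sup>2) has_integral ((2 * pi) / 2 - sin (2 * (2 * pi)) / 4 - (0 / 2 - sin (2 * 0) / 4))) {0..2 * pi}"
    proof (rule fundamental_theorem_of_calculus)
      fix x :: real assume "x \<in> {0..2 * pi}"
      have "((\<lambda>x. x / 2 - sin (2 * x) / 4) has_real_derivative (1 / 2 - cos (2 * x) * 2 / 4)) (at x within {0..2 * pi})"
        by (auto intro!: derivative_eq_intros)
      moreover have "1 / 2 - cos (2 * x) * 2 / 4 = (sin x)\<^sup>2" unfolding cos_double_sin by (simp add: field_simps)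
      ultimately show "((\<lambda>x. x / 2 - sin (2 * x) / 4) has_vector_derivative (sin x)\<^sup>2) (at x within {0..2 * pi})"
        by (simp add: has_real_derivative_iff_has_vector_derivative)
    qed simp
    moreover have "sin (2 * (2 * pi)) = 0" using sin_int_2pin[of 2] by (simp add: mult.commute)
    ultimately show ?thesis by simp
  qed
  have "((\<lambda>\<theta>. (sin \<theta>)\<^sup>2 * ln (norm (1 - v * cis \<theta>)) + (sin \<theta>)\<^sup>2 * ln (norm (1 - cnj v * cis \<theta>)) - (sin \<theta>)\<^sup>2 * ln (norm v))
     has_integral (pi / 4 * Re (v\<^sup>2) + pi / 4 * Re ((cnj v)\<^sup>2) - pi * ln (norm v))) {0..2 * pi}"
    by (intro has_integral_diff has_integral_add circle_log_integral has_integral_mult_left s2) (use v in auto)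
  moreover have "pi / 4 * Re (v\<^sup>2) + pi / 4 * Re ((cnj v)\<^sup>2) - pi * ln (norm v) = pi / 2 * Re (v\<^sup>2) - pi * ln (norm v)"
    by (simp add: power2_eq_square)
  ultimately have I: "((\<lambda>\<theta>. (sin \<theta>)\<^sup>2 * ln (norm (z - of_real (2 * cos \<theta>)))) has_integral (pi / 2 * Re (v\<^sup>2) - pi * ln (norm v))) {0..2 * pi}"
    unfolding ln_fac distrib_left right_diff_distrib by (simp only:)
  have cont: "continuous_on UNIV (\<lambda>y. ln (norm (z - of_real y)))"
    using nz by (intro continuous_intros) auto
  show "integrable mu_sc (\<lambda>y. ln (norm (z - of_real y)))" by (rule semicircle_integral(1)[OF cont I])
  show "(\<integral>y. ln (norm (z - of_real y)) \<partial>mu_sc) = - ln (norm v) + Re (v\<^sup>2) / 2"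
    unfolding semicircle_integral(2)[OF cont I] by (simp add: field_simps)
qed

lemma joukowski_root:
  assumes "Im z \<noteq> 0"
  obtains v where "norm v < 1" "v \<noteq> 0" "z = v + 1 / v"
proof -
  define s where "s = csqrt (z\<^sup>2 - 4)"
  define a where "a = (z + s) / 2"
  define b where "b = (z - s) / 2"
  have s2: "s\<^sup>2 = z\<^sup>2 - 4" by (simp add: s_def)
  have ab: "a * b = 1" "a + b = z" using s2 by (auto simp: a_def b_def field_simps power2_eq_square)
  have a0: "a \<noteq> 0" "b \<noteq> 0" using ab by auto
  have b: "b = 1 / a" using ab a0 by (simp add: field_simps)
  have n: "norm a * norm b = 1" using ab by (metis norm_mult norm_one)
  have "norm a \<noteq> 1"
  proof
    assume "norm a = 1"
    then have "b = cnj a" unfolding b using complex_norm_square[of a] a0 by (simp add: field_simps mult.commute)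
    then have "Im z = 0" using ab(2) by auto
    then show False using assms by simp
  qed
  then consider "norm a < 1" | "norm b < 1"
    using n by (metis linorder_neqE_linordered_idom mult_less_cancel_right2 norm_ge_zero mult.commute less_le_trans mult_cancel_left2 not_less norm_le_zero_iff a0(2) mult_le_cancel_left2)
  then show ?thesis
  proof cases
    case 1 then show ?thesis using that[of a] a0 b ab by auto
  next
    case 2
    have "a = 1 / b" using ab a0 by (simp add: field_simps)
    then show ?thesis using 2 that[of b] a0 ab by (auto simp: add.commute)
  qed
qed

text \<open>For \<open>\<bar>t\<bar> > 2\<close> the solution of \<open>u + 1 / u = \<bar>t\<bar>\<close> in \<open>(0, 1)\<close>.\<close>
definition small_root :: "real \<Rightarrow> real" where "small_root t = (\<bar>t\<bar> - sqrt (t\<^sup>2 - 4)) / 2"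

text \<open>The squared modulus of a solution \<open>v\<close> of \<open>v + 1 / v = t\<close> in the closed unit disc; for \<open>\<bar>t\<bar> \<le> 2\<close> the
  solutions lie on the unit circle.\<close>
definition root_sqnorm :: "real \<Rightarrow> real" where "root_sqnorm t = (if \<bar>t\<bar> \<le> 2 then 1 else (small_root t)\<^sup>2)"

text \<open>The common rate \<open>- ln \<bar>v\<bar> + Re (v\<^sup>2) / 2\<close> for \<open>v + 1 / v = t\<close>, written in terms of \<open>t\<close>.\<close>
definition semicircle_pot :: "real \<Rightarrow> real" where
  "semicircle_pot t = (if \<bar>t\<bar> \<le> 2 then t\<^sup>2 / 4 - 1 / 2 else - ln (small_root t) + (small_root t)\<^sup>2 / 2)"

lemma small_root_solves:
  assumes "\<bar>t\<bar> > 2"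
  shows "0 < small_root t" "small_root t < 1" "small_root t + 1 / small_root t = \<bar>t\<bar>"
proof -
  have t4: "t\<^sup>2 > 4" using power_strict_mono[of 2 "\<bar>t\<bar>" 2] assms by simp
  define s where "s = sqrt (t\<^sup>2 - 4)"
  have s: "s\<^sup>2 = t\<^sup>2 - 4" "s > 0" using t4 by (auto simp: s_def)
  have "s\<^sup>2 < \<bar>t\<bar>\<^sup>2" using s by simp
  then have st: "s < \<bar>t\<bar>" by (rule power2_less_imp_less) simp
  show p: "0 < small_root t" using st by (simp add: small_root_def s_def)
  have "small_root t * ((\<bar>t\<bar> + s) / 2) = 1" using s by (simp add: small_root_def flip: s_def) (simp add: field_simps power2_eq_square)
  then have i: "1 / small_root t = (\<bar>t\<bar> + s) / 2" using p by (simp add: field_simps)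
  show "small_root t + 1 / small_root t = \<bar>t\<bar>" unfolding i by (simp add: small_root_def field_simps flip: s_def)
  have "(\<bar>t\<bar> + s) / 2 > 1" using assms s by simp
  then have "1 / small_root t > 1" using i by simp
  then show "small_root t < 1" using p by simp
qed

text \<open>A solution on the real line is \<open>small_root\<close> up to sign (or \<open>1\<close> or \<open>- 1\<close>); any other one has modulus
  \<open>1\<close> and real part \<open>t / 2\<close>.\<close>
lemma semicircle_pot_from_root:
  assumes v: "norm v \<le> 1" "v \<noteq> 0" "complex_of_real t = v + 1 / v"
  shows "- ln (norm v) + Re (v\<^sup>2) / 2 = semicircle_pot t"
proof (cases "Im v = 0")
  case True
  define x where "x = Re v"
  have vx: "v = of_real x" using True by (simp add: complex_eq_iff x_def)
  have x: "x \<noteq> 0" "\<bar>x\<bar> \<le> 1" using v vx by auto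
  have "complex_of_real t = complex_of_real (x + 1 / x)" using v(3) vx by simp
  then have t: "t = x + 1 / x" by (simp only: of_real_eq_iff)
  have at: "\<bar>t\<bar> = \<bar>x\<bar> + 1 / \<bar>x\<bar>" 
  proof (cases "x > 0")
    case True
    then have "x + 1 / x > 0" by (simp add: add_pos_pos)
    then show ?thesis unfolding t using True by simp
  next
    case False
    then have "x < 0" using x by simp
    moreover then have "x + 1 / x < 0" by (simp add: add_neg_neg)
    ultimately show ?thesis unfolding t by simp
  qed
  show ?thesis
  proof (cases "\<bar>x\<bar> = 1")
    case True
    then have "\<bar>t\<bar> = 2" using at by simp
    moreover then have "t\<^sup>2 = 4" by (metis power2_abs power2_eq_square mult_2 numeral_Bit0 mult_numeral_1 numeral_One one_add_one numeral_plus_numeral semiring_norm(2))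
    moreover have "x\<^sup>2 = 1" using True by (metis power2_abs one_power2)
    ultimately show ?thesis using True by (simp add: semicircle_pot_def vx)
  next
    case False
    define a where "a = \<bar>x\<bar>"
    have a: "0 < a" "a < 1" using x False by (auto simp: a_def)
    have "\<bar>t\<bar> - 2 = (1 - a)\<^sup>2 / a" unfolding at a_def[symmetric] using a by (simp add: field_simps power2_eq_square)
    also have "\<dots> > 0" using a by simp
    finally have t2: "\<bar>t\<bar> > 2" by simp
    have "t\<^sup>2 = (a + 1 / a)\<^sup>2" using at unfolding a_def[symmetric] by (metis power2_abs)
    moreover have "(a + b)\<^sup>2 - 4 * (a * b) = (b - a)\<^sup>2" for b by (simp add: power2_eq_square algebra_simps)
    from this[of "1 / a"] have "(a + 1 / a)\<^sup>2 - 4 = (1 / a - a)\<^sup>2" using a by simp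
    ultimately have "t\<^sup>2 - 4 = (1 / a - a)\<^sup>2" by simp
    moreover have "1 / a - a > 0" using a mult_strict_mono[of a 1 a 1] by (simp add: field_simps)
    ultimately have "small_root t = a" unfolding small_root_def at a_def[symmetric] by simp
    then show ?thesis using t2 by (simp add: semicircle_pot_def vx a_def)
  qed
next
  case False
  have n0: "(norm v)\<^sup>2 > 0" using v by simp
  have "Im (v + 1 / v) = Im v - Im v / (norm v)\<^sup>2" using v by (simp add: Im_divide cmod_power2)
  then have "Im v = Im v / (norm v)\<^sup>2" using v(3) by (metis Im_complex_of_real eq_iff_diff_eq_0)
  then have "(norm v)\<^sup>2 = 1" using False n0 by (simp add: field_simps)
  then have n1: "norm v = 1" using norm_ge_zero[of v] by (auto simp: power2_eq_1_iff)
  have xy: "(Re v)\<^sup>2 + (Im v)\<^sup>2 = 1" using \<open>(norm v)\<^sup>2 = 1\<close> by (simp add: cmod_power2)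
  have "1 / v = cnj v" using complex_norm_square[of v] n1 v(2) by (simp add: field_simps mult.commute)
  then have t: "t = 2 * Re v" using arg_cong[OF v(3), of Re] by simp
  have "\<bar>Re v\<bar> \<le> 1" using abs_Re_le_cmod[of v] n1 by simp
  then have "\<bar>t\<bar> \<le> 2" using t by simp
  moreover have "Re (v\<^sup>2) = 2 * (Re v)\<^sup>2 - 1" using xy by (simp add: power2_eq_square)
  ultimately show ?thesis using n1 t by (simp add: semicircle_pot_def power_mult_distrib)
qed

text \<open>Let \<open>z\<close> descend to \<open>t\<close> vertically.  Then \<open>\<bar>z - y\<bar>\<close> decreases to \<open>\<bar>t - y\<bar>\<close> for every \<open>y\<close>, and monotone
  convergence gives both the integrability of the singular logarithm and the limit of the integrals.
  The roots \<open>v\<close> need not be followed continuously: a limit point of them solves \<open>v + 1 / v = t\<close>, and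
  by \<open>semicircle_pot_from_root\<close> every such solution in the disc gives the same value.\<close>
lemma Omega_eq_semicircle_pot: "Omega t = semicircle_pot t"
proof -
  define z where "z n = Complex t (1 / real (Suc n))" for n
  have im: "Im (z n) \<noteq> 0" for n by (simp add: z_def)
  have "\<exists>v. \<forall>n. norm (v n) < 1 \<and> v n \<noteq> 0 \<and> z n = v n + 1 / v n"
    by (intro choice allI) (metis joukowski_root[OF im])
  then obtain v where v: "\<And>n. norm (v n) < 1" "\<And>n. v n \<noteq> 0" "\<And>n. z n = v n + 1 / v n" by blast
  have zt: "z \<longlonglongrightarrow> of_real t"
  proof -
    have "(\<lambda>n. Complex t (1 / real (Suc n))) \<longlonglongrightarrow> Complex t 0"
      by (intro tendsto_Complex tendsto_const) (rule LIMSEQ_Suc[OF lim_1_over_n])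
    then show ?thesis unfolding z_def[abs_def] complex_of_real_def .
  qed
  have "compact (cball (0::complex) 1)" by simp
  then obtain l \<phi> where l: "l \<in> cball 0 1" and phi: "strict_mono (\<phi> :: nat \<Rightarrow> nat)" and lim: "(v \<circ> \<phi>) \<longlonglongrightarrow> l"
    using v(1) unfolding compact_def by (metis dist_0_norm less_imp_le mem_cball)
  have zp: "(\<lambda>n. z (\<phi> n)) \<longlonglongrightarrow> of_real t" using LIMSEQ_subseq_LIMSEQ[OF zt phi] by (simp add: o_def)
  have vl: "(\<lambda>n. v (\<phi> n)) \<longlonglongrightarrow> l" using lim by (simp add: o_def)
  have eq: "z n * v n = (v n)\<^sup>2 + 1" for n using v(2)[of n] v(3)[of n] by (simp add: power2_eq_square distrib_right)
  have "(\<lambda>n. z (\<phi> n) * v (\<phi> n)) \<longlonglongrightarrow> of_real t * l" by (intro tendsto_mult zp vl)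
  moreover have "(\<lambda>n. z (\<phi> n) * v (\<phi> n)) \<longlonglongrightarrow> l\<^sup>2 + 1" unfolding eq by (intro tendsto_intros vl)
  ultimately have leq: "of_real t * l = l\<^sup>2 + 1" by (rule LIMSEQ_unique)
  have l0: "l \<noteq> 0" using leq by auto
  have ltt: "complex_of_real t = l + 1 / l" using leq l0 by (simp add: field_simps power2_eq_square)
  define F where "F n y = ln (norm (z (\<phi> n) - of_real y))" for n y
  have Fi: "integrable mu_sc (F n)" and FI: "integral\<^sup>L mu_sc (F n) = - ln (norm (v (\<phi> n))) + Re ((v (\<phi> n))\<^sup>2) / 2" for n
    unfolding F_def using log_potential_complex[OF v(1) v(2) v(3) im, of "\<phi> n"] by auto
  have FL: "(\<lambda>n. integral\<^sup>L mu_sc (F n)) \<longlonglongrightarrow> semicircle_pot t"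
  proof -
    have "(\<lambda>n. - ln (norm (v (\<phi> n))) + Re ((v (\<phi> n))\<^sup>2) / 2) \<longlonglongrightarrow> - ln (norm l) + Re (l\<^sup>2) / 2"
      by (intro tendsto_intros vl) (use l0 in auto)
    then show ?thesis unfolding FI using semicircle_pot_from_root[OF _ l0 ltt] l by simp
  qed
  have nF: "norm (z n - of_real y) = sqrt ((t - y)\<^sup>2 + (1 / real (Suc n))\<^sup>2)" for n y
    by (simp add: z_def cmod_def)
  have dec: "F n y \<le> F m y" if "m \<le> n" for m n y
  proof -
    have "\<phi> m \<le> \<phi> n" using phi that by (simp add: strict_mono_less_eq)
    then have "1 / real (Suc (\<phi> n)) \<le> 1 / real (Suc (\<phi> m))" by (intro divide_left_mono) auto
    then have "norm (z (\<phi> n) - of_real y) \<le> norm (z (\<phi> m) - of_real y)"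
      unfolding nF by (intro real_sqrt_le_mono add_left_mono power_mono) auto
    moreover have "0 < norm (z (\<phi> n) - of_real y)" using im[of "\<phi> n"] by (auto simp: complex_eq_iff)
    ultimately show ?thesis unfolding F_def by (subst ln_le_cancel_iff) linarith+
  qed
  have ptw: "(\<lambda>n. F n y) \<longlonglongrightarrow> ln \<bar>t - y\<bar>" if "y \<noteq> t" for y
  proof -
    have "(\<lambda>n. ln (norm (z (\<phi> n) - of_real y))) \<longlonglongrightarrow> ln (norm (complex_of_real t - of_real y))"
      by (intro tendsto_intros zp) (use that in auto)
    then show ?thesis by (simp add: F_def flip: of_real_diff)
  qed
  have AE: "AE y in mu_sc. y \<noteq> t"
    unfolding mu_sc_def by (subst AE_density) (use AE_lborel_singleton[of t] in \<open>auto elim: eventually_mono\<close>)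
  have "integral\<^sup>L mu_sc (\<lambda>y. F 0 y - ln \<bar>t - y\<bar>) = integral\<^sup>L mu_sc (F 0) - semicircle_pot t"
    and int: "integrable mu_sc (\<lambda>y. F 0 y - ln \<bar>t - y\<bar>)"
  proof -
    have i: "integrable mu_sc (\<lambda>y. F 0 y - F n y)" for n using Fi by auto
    have m: "AE y in mu_sc. mono (\<lambda>n. F 0 y - F n y)" using dec by (auto simp: mono_def)
    have p: "AE y in mu_sc. 0 \<le> F 0 y - F n y" for n using dec by auto
    have lm: "AE y in mu_sc. (\<lambda>n. F 0 y - F n y) \<longlonglongrightarrow> F 0 y - ln \<bar>t - y\<bar>"
      using AE by eventually_elim (intro tendsto_intros ptw)
    have il: "(\<lambda>n. integral\<^sup>L mu_sc (\<lambda>y. F 0 y - F n y)) \<longlonglongrightarrow> integral\<^sup>L mu_sc (F 0) - semicircle_pot t"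
      using tendsto_diff[OF tendsto_const FL, of "integral\<^sup>L mu_sc (F 0)"] Fi by simp
    have F0m: "F 0 \<in> borel_measurable mu_sc" using Fi by auto
    have um: "(\<lambda>y. F 0 y - ln \<bar>t - y\<bar>) \<in> borel_measurable mu_sc"
      by (intro borel_measurable_diff F0m) (simp add: mu_sc_def)
    show "integral\<^sup>L mu_sc (\<lambda>y. F 0 y - ln \<bar>t - y\<bar>) = integral\<^sup>L mu_sc (F 0) - semicircle_pot t"
      "integrable mu_sc (\<lambda>y. F 0 y - ln \<bar>t - y\<bar>)"
      using integral_monotone_convergence_nonneg[OF i m p lm il um] by auto
  qed
  moreover have "integral\<^sup>L mu_sc (\<lambda>y. ln \<bar>t - y\<bar>) = integral\<^sup>L mu_sc (\<lambda>y. F 0 y - (F 0 y - ln \<bar>t - y\<bar>))" by simp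
  moreover have "\<dots> = integral\<^sup>L mu_sc (F 0) - integral\<^sup>L mu_sc (\<lambda>y. F 0 y - ln \<bar>t - y\<bar>)"
    by (rule Bochner_Integration.integral_diff[OF Fi int])
  ultimately show ?thesis unfolding Omega_def by simp
qed

section \<open>Two-sided bounds at exponential scale\<close>

lemma fact_lower: "real n ^ n * exp (- real n) \<le> fact n"
proof -
  have "(\<lambda>k. real n ^ k /\<^sub>R fact k) sums exp (real n)" by (rule exp_converges)
  then have "(\<Sum>k\<in>{n}. real n ^ k /\<^sub>R fact k) \<le> exp (real n)"
    using sum_le_suminf[of "\<lambda>k. real n ^ k /\<^sub>R fact k" "{n}"] by (auto simp: sums_iff)
  then show ?thesis by (simp add: exp_minus field_simps)
qed

lemma fact_upper: "n \<ge> 1 \<Longrightarrow> fact n \<le> real n ^ (n + 1) * exp (1 - real n)"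
proof (induction n rule: nat_induct_at_least)
  case base then show ?case by simp
next
  case (Suc n)
  have n: "real n \<ge> 1" using Suc by simp
  have "1 / (real n + 1) \<le> ln (1 + 1 / real n)"
  proof -
    have "ln (real n / (real n + 1)) \<le> real n / (real n + 1) - 1" using n by (intro ln_le_minus_one) auto
    also have "\<dots> = - (1 / (real n + 1))" using n by (simp add: field_simps)
    also have "ln (real n / (real n + 1)) = - ln (1 + 1 / real n)"
      using n by (subst ln_inverse[symmetric]) (auto simp: field_simps)
    finally show ?thesis by simp
  qed
  then have "1 \<le> real (n + 1) * ln (1 + 1 / real n)" using n by (simp add: field_simps)
  then have "exp 1 \<le> exp (real (n + 1) * ln (1 + 1 / real n))" by simp
  also have "\<dots> = (1 + 1 / real n) ^ (n + 1)"
    unfolding exp_of_nat_mult using n by (simp add: add_pos_pos)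
  finally have "exp 1 * real n ^ (n + 1) \<le> (1 + 1 / real n) ^ (n + 1) * real n ^ (n + 1)"
    by (intro mult_right_mono) auto
  also have "\<dots> = (real n + 1) ^ (n + 1)" 
    using n unfolding power_mult_distrib[symmetric] by (simp add: distrib_right)
  finally have key: "exp 1 * real n ^ (n + 1) \<le> (real n + 1) ^ (n + 1)" .
  have "fact (Suc n) = (real n + 1) * fact n" by simp
  also have "\<dots> \<le> (real n + 1) * (real n ^ (n + 1) * exp (1 - real n))" using Suc by (intro mult_left_mono) auto
  also have "\<dots> = (real n + 1) * (exp 1 * real n ^ (n + 1)) * exp (- real n)" by (simp add: exp_diff exp_minus field_simps)
  also have "\<dots> \<le> (real n + 1) * (real n + 1) ^ (n + 1) * exp (- real n)"
    using key by (intro mult_right_mono mult_left_mono) auto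
  also have "\<dots> = real (Suc n) ^ (Suc n + 1) * exp (1 - real (Suc n))" by (simp add: algebra_simps)
  finally show ?case .
qed

lemma root_sqnorm_range: "0 < root_sqnorm t" "root_sqnorm t \<le> 1"
  using small_root_solves[of t] by (auto simp: root_sqnorm_def power_le_one)

text \<open>The left-hand side is what the second moment bound produces with \<open>c\<^sup>2 = N t\<^sup>2\<close>, after division by
  \<open>N\<^sup>N\<close>.\<close>
lemma semicircle_pot_root_sqnorm: "t\<^sup>2 * (root_sqnorm t / (1 + root_sqnorm t)) - 1 - ln (root_sqnorm t) = 2 * semicircle_pot t"
proof (cases "\<bar>t\<bar> \<le> 2")
  case True then show ?thesis by (simp add: root_sqnorm_def semicircle_pot_def)
next
  case False
  define u where "u = small_root t"
  have u: "0 < u" "u < 1" "u + 1 / u = \<bar>t\<bar>" using small_root_solves[of t] False by (auto simp: u_def)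
  have "t\<^sup>2 = (u + 1 / u)\<^sup>2" using u(3) by (metis power2_abs)
  also have "\<dots> = (1 + u\<^sup>2)\<^sup>2 / u\<^sup>2" using u by (simp add: field_simps power2_eq_square)
  finally have t2: "t\<^sup>2 = (1 + u\<^sup>2)\<^sup>2 / u\<^sup>2" .
  have p: "1 + u\<^sup>2 > 0" by (simp add: add_pos_nonneg)
  have "t\<^sup>2 * (u\<^sup>2 / (1 + u\<^sup>2)) = 1 + u\<^sup>2" unfolding t2 using u p by (simp add: power2_eq_square[of "1 + u\<^sup>2"])
  moreover have "ln (u\<^sup>2) = 2 * ln u" using u by (simp add: ln_realpow)
  ultimately show ?thesis using False by (simp add: root_sqnorm_def semicircle_pot_def flip: u_def)
qed

context gaussian_matrix begin

text \<open>The constants \<open>18\<close> and \<open>exp 3\<close> and the powers of \<open>N\<close> only need to be independent of \<open>t\<close> and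
  polynomial in \<open>N\<close>; they collect the losses in Stirling's bounds, in the Sonin argument and in the
  Cauchy estimate.\<close>
lemma mean_abs_det_bounds:
  assumes N: "N \<ge> 2" and c: "\<bar>c\<bar> = sqrt (real N) * \<bar>t\<bar>"
  defines "E \<equiv> expectation (\<lambda>\<omega>. \<bar>sdet (\<lambda>_. c) {..<N} \<omega>\<bar>)"
  shows "real N ^ N * exp (2 * real N * semicircle_pot t) \<le> E\<^sup>2 * (18 * real N ^ 3)"
    "E\<^sup>2 \<le> real N ^ N * exp (2 * real N * semicircle_pot t) * (exp 3 * real N ^ 4)"
proof -
  have N0: "real N > 0" using N by simp
  have c2: "c\<^sup>2 = real N * t\<^sup>2"
  proof -
    have "c\<^sup>2 = \<bar>c\<bar>\<^sup>2" by simp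
    also have "\<dots> = real N * t\<^sup>2" unfolding c by (simp add: power_mult_distrib)
    finally show ?thesis .
  qed
  have E0: "E \<ge> 0" unfolding E_def by (intro integral_nonneg_AE) auto
  have H: "\<bar>hermite N c\<bar> \<le> E" "\<bar>hermite (N - 1) c\<bar> \<le> E" unfolding E_def using N by (auto intro!: hermite_le_mean_abs_sdet simp del: One_nat_def)
  show "real N ^ N * exp (2 * real N * semicircle_pot t) \<le> E\<^sup>2 * (18 * real N ^ 3)"
  proof (cases "\<bar>t\<bar> \<le> 2")
    case True
    then have "t\<^sup>2 \<le> 4" using power_mono[of "\<bar>t\<bar>" 2 2] by simp
    then have "c\<^sup>2 \<le> 4 * real N" unfolding c2 using N0 by simp
    then have *: "fact N * exp (c\<^sup>2 / 2) \<le> E\<^sup>2 * (9 * (real N)\<^sup>2) * (real N + 1)"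
      by (intro hermite_lower_bulk H) (use N in auto)
    have "exp (2 * real N * semicircle_pot t) = exp (- real N) * exp (c\<^sup>2 / 2)"
      using True by (simp add: semicircle_pot_def c2 field_simps flip: exp_add)
    then have "real N ^ N * exp (2 * real N * semicircle_pot t) = real N ^ N * exp (- real N) * exp (c\<^sup>2 / 2)" by simp
    also have "\<dots> \<le> fact N * exp (c\<^sup>2 / 2)" by (intro mult_right_mono fact_lower) auto
    also note *
    also have "E\<^sup>2 * (9 * (real N)\<^sup>2) * (real N + 1) \<le> E\<^sup>2 * (9 * (real N)\<^sup>2) * (2 * real N)"
      using N by (intro mult_left_mono) auto
    also have "\<dots> = E\<^sup>2 * (18 * real N ^ 3)" by (simp add: power2_eq_square power3_eq_cube)
    finally show ?thesis .
  next
    case False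
    define u where "u = small_root t"
    have u: "0 < u" "u < 1" "u + 1 / u = \<bar>t\<bar>" using small_root_solves[of t] False by (auto simp: u_def)
    have t2: "t\<^sup>2 = (u + 1 / u)\<^sup>2" using u(3) by (metis power2_abs)
    have t4: "t\<^sup>2 \<ge> 4" using False power_mono[of 2 "\<bar>t\<bar>" 2] by simp
    have cpos: "\<bar>c\<bar> > 0" unfolding c using False N0 by simp
    have large_root: "large_root \<bar>c\<bar> (real N) = sqrt (real N) / u"
    proof -
      have "\<bar>c\<bar>\<^sup>2 - 4 * real N = real N * (t\<^sup>2 - 4)" by (simp add: c2 algebra_simps)
      then have s1: "sqrt (\<bar>c\<bar>\<^sup>2 - 4 * real N) = sqrt (real N) * sqrt (t\<^sup>2 - 4)" by (simp only: real_sqrt_mult)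
      have s2: "sqrt (t\<^sup>2 - 4) = \<bar>t\<bar> - 2 * u" by (simp add: u_def small_root_def field_simps)
      have "large_root \<bar>c\<bar> (real N) = sqrt (real N) * (\<bar>t\<bar> - u)"
        unfolding large_root_def s1 s2 unfolding c by (simp add: field_simps)
      moreover have "\<bar>t\<bar> - u = 1 / u" using u(3) by linarith
      ultimately show ?thesis by simp
    qed
    have "hermite_rate \<bar>c\<bar> (real N) + \<bar>c\<bar>\<^sup>2 / 2 = real N * (ln (sqrt (real N)) + semicircle_pot t)"
    proof -
      have l: "ln (sqrt (real N) / u) = ln (sqrt (real N)) - ln u" using u N0 by (simp add: ln_div)
      have a: "\<bar>c\<bar> * (sqrt (real N) / u) = real N * (\<bar>t\<bar> / u)" unfolding c by (simp add: field_simps)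
      have b: "(sqrt (real N) / u)\<^sup>2 = real N * (1 / u\<^sup>2)" by (simp add: power_divide)
      have "hermite_rate \<bar>c\<bar> (real N) + \<bar>c\<bar>\<^sup>2 / 2 = real N * (ln (sqrt (real N)) - ln u) - real N * (\<bar>t\<bar> / u) + real N * (1 / u\<^sup>2) / 2 + real N * t\<^sup>2 / 2"
        unfolding hermite_rate_def large_root l a b by (simp add: c2)
      also have "\<dots> = real N * (ln (sqrt (real N)) - ln u + (- (\<bar>t\<bar> / u) + (1 / u\<^sup>2) / 2 + t\<^sup>2 / 2))"
        by (simp add: algebra_simps)
      also have "- (\<bar>t\<bar> / u) + (1 / u\<^sup>2) / 2 + t\<^sup>2 / 2 = u\<^sup>2 / 2"
        unfolding t2 u(3)[symmetric] using u(1) by (simp add: field_simps power2_eq_square)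
      finally show ?thesis using False by (simp add: semicircle_pot_def u_def)
    qed
    moreover have "exp (hermite_rate \<bar>c\<bar> (real N) + \<bar>c\<bar>\<^sup>2 / 2) \<le> hermite N \<bar>c\<bar>"
      by (rule hermite_lower_outside[OF cpos]) (use t4 N0 in \<open>simp add: c2\<close>)
    moreover have "\<bar>hermite N \<bar>c\<bar>\<bar> = \<bar>hermite N c\<bar>" by (cases "c \<ge> 0") (simp_all add: hermite_minus abs_mult)
    ultimately have "exp (real N * (ln (sqrt (real N)) + semicircle_pot t)) \<le> E" using H(1) by simp
    then have "(exp (real N * (ln (sqrt (real N)) + semicircle_pot t)))\<^sup>2 \<le> E\<^sup>2" by (intro power_mono) auto
    moreover have "(exp (real N * (ln (sqrt (real N)) + semicircle_pot t)))\<^sup>2 = real N ^ N * exp (2 * real N * semicircle_pot t)"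
    proof -
      have "real N ^ N = exp (real N * ln (real N))" using N0 by (simp add: exp_of_nat_mult)
      moreover have "ln (sqrt (real N)) = ln (real N) / 2" using N0 by (simp add: ln_sqrt)
      ultimately show ?thesis by (simp add: algebra_simps flip: exp_add exp_of_nat_mult exp_double)
    qed
    ultimately have "real N ^ N * exp (2 * real N * semicircle_pot t) \<le> E\<^sup>2 * 1" by simp
    also have "\<dots> \<le> E\<^sup>2 * (18 * real N ^ 3)"
    proof (intro mult_left_mono)
      show "1 \<le> 18 * real N ^ 3" using one_le_power[of "real N" 3] N by linarith
    qed simp
    finally show ?thesis .
  qed
  show "E\<^sup>2 \<le> real N ^ N * exp (2 * real N * semicircle_pot t) * (exp 3 * real N ^ 4)"
  proof -
    let ?m = "root_sqnorm t"
    have "E\<^sup>2 \<le> second_moment c N" unfolding E_def by (rule mean_abs_sdet_upper) simp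
    also have "\<dots> \<le> fact N * (exp 2 * real N ^ 3) * exp (c\<^sup>2 * (?m / (1 + ?m))) / ?m ^ N"
      by (rule second_moment_upper[OF N root_sqnorm_range])
    also have "\<dots> = fact N * (exp 2 * real N ^ 3) * exp (c\<^sup>2 * (?m / (1 + ?m)) - real N * ln ?m)"
      using root_sqnorm_range[of t] by (simp add: exp_diff exp_of_nat_mult)
    also have "\<dots> \<le> (real N ^ (N + 1) * exp (1 - real N)) * (exp 2 * real N ^ 3) * exp (c\<^sup>2 * (?m / (1 + ?m)) - real N * ln ?m)"
      by (intro mult_right_mono fact_upper) (use N in auto)
    also have "\<dots> = real N ^ N * real N ^ 4 * (exp (1 - real N) * exp 2 * exp (c\<^sup>2 * (?m / (1 + ?m)) - real N * ln ?m))"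
      by (simp add: eval_nat_numeral)
    also have "exp (1 - real N) * exp 2 * exp (c\<^sup>2 * (?m / (1 + ?m)) - real N * ln ?m) = exp 3 * exp (2 * real N * semicircle_pot t)"
    proof -
      have "(1 - real N) + 2 + (c\<^sup>2 * (?m / (1 + ?m)) - real N * ln ?m) = 3 + real N * (t\<^sup>2 * (?m / (1 + ?m)) - 1 - ln ?m)"
        unfolding c2 by (simp add: right_diff_distrib)
      also have "\<dots> = 3 + 2 * real N * semicircle_pot t" unfolding semicircle_pot_root_sqnorm by simp
      finally show ?thesis unfolding exp_add[symmetric] by simp
    qed
    finally show ?thesis by (simp add: mult_ac)
  qed
qed

lemma log_mean_abs_det_bounds:
  fixes t :: real
  assumes N: "N \<ge> 2" "r \<le> N" and B: "B \<ge> 0" and G: "\<And>i. i < r \<Longrightarrow> \<bar>\<gamma> i\<bar> \<le> B"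
  defines "E \<equiv> expectation (\<lambda>\<omega>. \<bar>sdet (\<lambda>i. sqrt (real N) * ((if i < r then \<gamma> i else 0) - t)) {..<N} \<omega>\<bar>)"
  shows "E > 0" "\<bar>(ln E - real N / 2 * ln (real N)) - real N * semicircle_pot t\<bar> \<le> (real r * ln (1 + B) + 5) + (real r + 2) * ln (real N)"
proof -
  let ?c = "- (sqrt (real N) * t)"
  let ?y = "\<lambda>i. sqrt (real N) * ((if i < r then \<gamma> i else 0) - t)"
  define E0 where "E0 = expectation (\<lambda>\<omega>. \<bar>sdet (\<lambda>_. ?c) {..<N} \<omega>\<bar>)"
  have N1: "real N \<ge> 1" and N0: "real N > 0" using N by auto
  have s1: "sqrt (real N) \<le> real N" 
    using real_sqrt_le_mono[OF mult_right_mono[OF N1, of "real N"]] by simp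
  define F where "F = (1 + B) * real N"
  have F1: "F \<ge> 1" using B N1 mult_mono[of 1 "1 + B" 1 "real N"] by (simp add: F_def)
  have BF: "1 + B * sqrt (real N) \<le> F"
    unfolding F_def using mult_left_mono[OF s1 B] N1 by (simp add: algebra_simps)
  have d: "\<bar>?y i - ?c\<bar> \<le> B * sqrt (real N)" if "i < r" for i
    using G[OF that] that mult_right_mono[of "\<bar>\<gamma> i\<bar>" B "sqrt (real N)"] by (simp add: algebra_simps abs_mult)
  have d': "\<bar>?c - ?y i\<bar> \<le> B * sqrt (real N)" if "i < r" for i
    using d[OF that] by (simp only: abs_minus_commute)
  have T: "{..<N} \<subseteq> {..<N}" "{..<r} \<subseteq> {..<N}" using N by auto
  have e1: "(\<lambda>i. if i < r then ?y i else ?c) = ?y" by (auto simp: fun_eq_iff algebra_simps)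
  have e2: "(\<lambda>i. if i < r then ?c else ?y i) = (\<lambda>_. ?c)" by (auto simp: fun_eq_iff algebra_simps)
  have E00: "E0 \<ge> 0" "E \<ge> 0" unfolding E0_def E_def by (auto intro!: integral_nonneg_AE)
  have pw: "(1 + B * sqrt (real N)) ^ r \<le> F ^ r" using BF B by (intro power_mono) auto
  have "E \<le> (1 + B * sqrt (real N)) ^ r * E0"
    unfolding E_def E0_def
    by (rule mean_abs_sdet_spikes[where z = ?y and y = "\<lambda>_. ?c" and B = "B * sqrt (real N)", OF T d, unfolded e1])
  also have "\<dots> \<le> F ^ r * E0" using pw E00 by (intro mult_right_mono)
  finally have up: "E \<le> F ^ r * E0" .
  have "E0 \<le> (1 + B * sqrt (real N)) ^ r * E"
    unfolding E_def E0_def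
    by (rule mean_abs_sdet_spikes[where z = "\<lambda>_. ?c" and y = ?y and B = "B * sqrt (real N)", OF T d', unfolded e2])
  also have "\<dots> \<le> F ^ r * E" using pw E00 by (intro mult_right_mono)
  finally have lo: "E0 \<le> F ^ r * E" .
  have ct: "\<bar>?c\<bar> = sqrt (real N) * \<bar>t\<bar>" by (simp add: abs_mult)
  note b = mean_abs_det_bounds[OF N(1) ct, folded E0_def]
  have Epos: "E0 > 0"
  proof (rule ccontr)
    assume "\<not> E0 > 0"
    then have "E0 = 0" using E00 by simp
    then have "real N ^ N * exp (2 * real N * semicircle_pot t) \<le> 0" using b(1) by simp
    moreover have "real N ^ N * exp (2 * real N * semicircle_pot t) > 0" using N0 by simp
    ultimately show False by simp
  qed
  show "E > 0" using lo Epos F1 E00 by (metis less_eq_real_def linorder_not_less mult_zero_right)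
  have L: "ln (real N ^ N * exp (2 * real N * semicircle_pot t)) = real N * ln (real N) + 2 * real N * semicircle_pot t"
    using N0 by (simp add: ln_mult ln_realpow)
  have lnE2: "ln (E0\<^sup>2) = 2 * ln E0" using Epos by (simp add: ln_realpow)
  have "ln (real N ^ N * exp (2 * real N * semicircle_pot t)) \<le> ln (E0\<^sup>2 * (18 * real N ^ 3))"
    using b(1) N0 by (intro ln_mono) auto
  also have "\<dots> = 2 * ln E0 + (ln 18 + 3 * ln (real N))" using Epos N0 by (simp add: ln_mult ln_realpow)
  finally have b1: "real N * ln (real N) + 2 * real N * semicircle_pot t \<le> 2 * ln E0 + (ln 18 + 3 * ln (real N))" unfolding L .
  have "ln (E0\<^sup>2) \<le> ln (real N ^ N * exp (2 * real N * semicircle_pot t) * (exp 3 * real N ^ 4))"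
    using b(2) Epos by (intro ln_mono) auto
  also have "\<dots> = real N * ln (real N) + 2 * real N * semicircle_pot t + (3 + 4 * ln (real N))"
    using N0 by (simp add: ln_mult ln_realpow)
  finally have b2: "2 * ln E0 \<le> real N * ln (real N) + 2 * real N * semicircle_pot t + (3 + 4 * ln (real N))" unfolding lnE2 .
  have lnF: "ln (F ^ r * x) = real r * (ln (1 + B) + ln (real N)) + ln x" if "x > 0" for x
    using that B N0 unfolding F_def by (simp add: ln_mult ln_realpow)
  have u': "ln E \<le> real r * (ln (1 + B) + ln (real N)) + ln E0"
    using up \<open>E > 0\<close> unfolding lnF[OF Epos, symmetric] by (intro ln_mono) auto
  have l': "ln E0 \<le> real r * (ln (1 + B) + ln (real N)) + ln E"
    using lo Epos unfolding lnF[OF \<open>E > 0\<close>, symmetric] by (intro ln_mono) auto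
  have l18: "ln (18::real) \<le> 10"
    using ln_le_minus_one[of "18 / 9 :: real"] ln_mult[of 2 9] ln_le_minus_one[of 9] by (simp add: ln_mult)
  have lN: "ln (real N) \<ge> 0" using N1 by simp
  show "\<bar>(ln E - real N / 2 * ln (real N)) - real N * semicircle_pot t\<bar> \<le> (real r * ln (1 + B) + 5) + (real r + 2) * ln (real N)"
    using b1 b2 u' l' l18 lN by (auto simp: abs_le_iff algebra_simps)
qed

end

lemma goe_gaussian_matrix:
  assumes W: "is_GOE M N W" and N: "N \<ge> 1"
  shows "gaussian_matrix M (\<lambda>(i, j) \<omega>. sqrt (real N) * W \<omega> $$ (i, j)) N"
proof -
  interpret prob_space M using W by (simp add: is_GOE_def)
  have ind: "indep_vars (\<lambda>_. borel) (\<lambda>(i, j) \<omega>. W \<omega> $$ (i, j)) {(i, j). i \<le> j \<and> j < N}"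
    using W by (simp add: is_GOE_def)
  have "indep_vars (\<lambda>_. borel) (\<lambda>e \<omega>. (\<lambda>x. sqrt (real N) * x) ((\<lambda>(i, j) \<omega>. W \<omega> $$ (i, j)) e \<omega>)) {(i, j). i \<le> j \<and> j < N}"
    by (rule indep_vars_compose2[OF ind]) auto
  then have 1: "indep_vars (\<lambda>_. borel) (\<lambda>(i, j) \<omega>. sqrt (real N) * W \<omega> $$ (i, j)) {(i, j). i \<le> j \<and> j < N}"
    by (simp add: case_prod_beta')
  show ?thesis
  proof (unfold_locales, rule 1)
    fix i j assume ij: "i \<le> j" "j < N"
    let ?s = "1 + (if i = j then 1 else 0) :: real"
    have "distributed M lborel (\<lambda>\<omega>. W \<omega> $$ (i, j)) (\<lambda>x. ennreal (normal_density 0 (sqrt (?s / real N)) x))"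
      using W ij unfolding is_GOE_def by blast
    from normal_density_affine[OF this, of "sqrt (real N)" 0]
    have "distributed M lborel (\<lambda>\<omega>. sqrt (real N) * W \<omega> $$ (i, j)) (\<lambda>x. ennreal (normal_density 0 (sqrt (real N) * sqrt (?s / real N)) x))"
      using N by simp
    moreover have "sqrt (real N) * sqrt (?s / real N) = sqrt ?s" using N by (simp flip: real_sqrt_mult)
    ultimately show "distributed M lborel ((\<lambda>(i, j) \<omega>. sqrt (real N) * W \<omega> $$ (i, j)) (i, j)) (\<lambda>x. ennreal (normal_density 0 (sqrt ?s) x))"
      by simp
  qed
qed

lemma spiked_det:
  assumes W: "is_GOE M N W" and N: "N \<ge> 1" "r \<le> N" and \<omega>: "\<omega> \<in> space M"
  shows "\<bar>gaussian_matrix.sdet (\<lambda>(i, j) \<omega>. sqrt (real N) * W \<omega> $$ (i, j)) (\<lambda>i. sqrt (real N) * ((if i < r then \<gamma> i else 0) - t)) {..<N} \<omega>\<bar>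
    = sqrt (real N) ^ N * \<bar>Determinant.det (spiked r N \<gamma> (W \<omega>) - t \<cdot>\<^sub>m 1\<^sub>m N)\<bar>"
proof -
  interpret gaussian_matrix M "\<lambda>(i, j) \<omega>. sqrt (real N) * W \<omega> $$ (i, j)" N by (rule goe_gaussian_matrix[OF W N(1)])
  have Wc: "W \<omega> \<in> carrier_mat N N" and Wt: "transpose_mat (W \<omega>) = W \<omega>" using W \<omega> by (auto simp: is_GOE_def)
  define A where "A = spiked r N \<gamma> (W \<omega>) - t \<cdot>\<^sub>m 1\<^sub>m N"
  have Ac: "A \<in> carrier_mat N N" unfolding A_def spiked_def using Wc by auto
  have Wsym: "W \<omega> $$ (i, j) = W \<omega> $$ (min i j, max i j)" if "i < N" "j < N" for i j
  proof -
    have "W \<omega> $$ (i, j) = W \<omega> $$ (j, i)" using Wc Wt that by (metis carrier_matD index_transpose_mat(1))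
    then show ?thesis by (auto simp: min_def max_def)
  qed
  have ent: "A $$ (i, j) = W \<omega> $$ (i, j) + (if i = j then (if i < r then \<gamma> i else 0) - t else 0)" if ij: "i < N" "j < N" for i j
  proof -
    have "(\<Sum>k<r. \<gamma> k * (vec_index (unit_vec N k) i * vec_index (unit_vec N k) j)) = (\<Sum>k<r. if k = i then (if i = j then \<gamma> i else 0) else 0)"
      using ij N by (intro sum.cong refl) (auto simp: unit_vec_def)
    also have "\<dots> = (if i = j then (if i < r then \<gamma> i else 0) else 0)" by auto
    finally show ?thesis using ij Wc unfolding A_def spiked_def by auto
  qed
  have "sdet (\<lambda>i. sqrt (real N) * ((if i < r then \<gamma> i else 0) - t)) {..<N} \<omega> = pdet (\<lambda>i j. sqrt (real N) * A $$ (i, j)) {..<N}"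
    unfolding sdet_def
  proof (rule pdet_cong)
    fix i j assume "i \<in> {..<N}" "j \<in> {..<N}"
    then have ij: "i < N" "j < N" by auto
    show "entry (\<lambda>i. sqrt (real N) * ((if i < r then \<gamma> i else 0) - t)) \<omega> i j = sqrt (real N) * A $$ (i, j)"
      unfolding ent[OF ij] Wsym[OF ij] entry_def edge_def by (cases "i = j") (simp_all add: algebra_simps)
  qed
  also have "\<dots> = sqrt (real N) ^ N * Determinant.det A"
    by (simp add: pdet_scale det_eq_pdet[OF Ac])
  finally show ?thesis by (simp add: A_def abs_mult)
qed

text \<open>The right-hand side depends neither on \<open>t\<close> nor on the spikes beyond their bound \<open>B\<close>, so the
  suprema and infima in the theorem are controlled by letting it tend to \<open>0\<close>.\<close>
lemma log_mean_det_bounds: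
  assumes W: "is_GOE M N W" and N: "N \<ge> 2" "r \<le> N" and B: "B \<ge> 0" and G: "\<And>i. i < r \<Longrightarrow> \<bar>\<gamma> i\<bar> \<le> B"
  shows "\<bar>log_mean_det M W r N \<gamma> t - Omega t\<bar> \<le> ((real r * ln (1 + B) + 5) + (real r + 2) * ln (real N)) / real N"
proof -
  have N1: "N \<ge> 1" and N0: "real N > 0" using N by auto
  interpret gaussian_matrix M "\<lambda>(i, j) \<omega>. sqrt (real N) * W \<omega> $$ (i, j)" N by (rule goe_gaussian_matrix[OF W N1])
  define E where "E = expectation (\<lambda>\<omega>. \<bar>sdet (\<lambda>i. sqrt (real N) * ((if i < r then \<gamma> i else 0) - t)) {..<N} \<omega>\<bar>)"
  define I where "I = expectation (\<lambda>\<omega>. \<bar>Determinant.det (spiked r N \<gamma> (W \<omega>) - t \<cdot>\<^sub>m 1\<^sub>m N)\<bar>)"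
  have b: "E > 0" "\<bar>(ln E - real N / 2 * ln (real N)) - real N * semicircle_pot t\<bar> \<le> (real r * ln (1 + B) + 5) + (real r + 2) * ln (real N)"
    unfolding E_def by (rule log_mean_abs_det_bounds[OF N B]; fact G)+
  have "E = expectation (\<lambda>\<omega>. sqrt (real N) ^ N * \<bar>Determinant.det (spiked r N \<gamma> (W \<omega>) - t \<cdot>\<^sub>m 1\<^sub>m N)\<bar>)"
    unfolding E_def by (intro Bochner_Integration.integral_cong refl spiked_det[OF W N1 N(2)])
  then have EI: "E = sqrt (real N) ^ N * I" unfolding I_def by simp
  then have I0: "I > 0" using b(1) N0 by (simp add: zero_less_mult_iff)
  have "ln E = real N / 2 * ln (real N) + ln I"
    unfolding EI using I0 N0 by (simp add: ln_mult ln_realpow ln_sqrt)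
  then have "\<bar>ln I - real N * semicircle_pot t\<bar> \<le> (real r * ln (1 + B) + 5) + (real r + 2) * ln (real N)" using b(2) by simp
  then have "\<bar>ln I - real N * semicircle_pot t\<bar> / real N \<le> ((real r * ln (1 + B) + 5) + (real r + 2) * ln (real N)) / real N"
    using N0 by (intro divide_right_mono) auto
  moreover have "\<bar>ln I - real N * semicircle_pot t\<bar> / real N = \<bar>log_mean_det M W r N \<gamma> t - Omega t\<bar>"
  proof -
    have "log_mean_det M W r N \<gamma> t - Omega t = (ln I - real N * semicircle_pot t) / real N"
      unfolding log_mean_det_def I_def[symmetric] Omega_eq_semicircle_pot using N0 by (simp add: diff_divide_distrib)
    then show ?thesis using N0 by simp
  qed
  ultimately show ?thesis by simp
qed

theorem lemma4p4:
  fixes r :: nat and U :: "nat \<Rightarrow> real set" and T :: "real set"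
    and M :: "nat \<Rightarrow> 'a measure" and W :: "nat \<Rightarrow> 'a \<Rightarrow> real mat"
  assumes "r \<ge> 1"
    and "\<And>i. i < r \<Longrightarrow> compact (U i)" and "\<And>i. i < r \<Longrightarrow> U i \<noteq> {}"
    and "compact T" and "T \<noteq> {}"
    and "\<And>N. N \<ge> r \<Longrightarrow> is_GOE (M N) N (W N)"
  shows "limsup (\<lambda>N. SUP (\<gamma>, t) \<in> (\<Pi>\<^sub>E i\<in>{..<r}. U i) \<times> T.
             ereal (log_mean_det (M N) (W N) r N \<gamma> t))
           \<le> (SUP t\<in>T. ereal (Omega t))
       \<and> liminf (\<lambda>N. INF (\<gamma>, t) \<in> (\<Pi>\<^sub>E i\<in>{..<r}. U i) \<times> T.
             ereal (log_mean_det (M N) (W N) r N \<gamma> t))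
           \<ge> (INF t\<in>T. ereal (Omega t))"
proof -
  let ?G = "\<Pi>\<^sub>E i\<in>{..<r}. U i"
  let ?S = "SUP t\<in>T. ereal (Omega t)" and ?I = "INF t\<in>T. ereal (Omega t)"
  have "bounded (\<Union>i<r. U i)" using assms(2) by (intro bounded_UN) (auto intro: compact_imp_bounded)
  then obtain B where B: "B > 0" "\<And>x. x \<in> (\<Union>i<r. U i) \<Longrightarrow> \<bar>x\<bar> \<le> B"
    unfolding bounded_pos real_norm_def by blast
  define eps where "eps N = ((real r * ln (1 + B) + 5) + (real r + 2) * ln (real N)) / real N" for N :: nat
  have eps0: "eps \<longlonglongrightarrow> 0"
  proof -
    have "(\<lambda>N. (real r * ln (1 + B) + 5) * (1 / real N) + (real r + 2) * (ln (real N) / real N)) \<longlonglongrightarrow> (real r * ln (1 + B) + 5) * 0 + (real r + 2) * 0"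
      by (intro tendsto_intros lim_1_over_n lim_ln_over_n)
    then show ?thesis by (simp add: eps_def[abs_def] add_divide_distrib)
  qed
  have bd: "\<bar>log_mean_det (M N) (W N) r N \<gamma> t - Omega t\<bar> \<le> eps N"
    if "N \<ge> max 2 r" "\<gamma> \<in> ?G" for N \<gamma> t
    unfolding eps_def by (rule log_mean_det_bounds) (use that B assms(6)[of N] in \<open>auto simp: PiE_iff\<close>)
  have ev: "\<forall>\<^sub>F N in sequentially. max 2 r \<le> N \<and> eps N < e" if "e > 0" for e
    using order_tendstoD(2)[OF eps0 that] eventually_ge_at_top[of "max 2 r"] by eventually_elim auto
  show ?thesis
  proof
    show "limsup (\<lambda>N. SUP (\<gamma>, t) \<in> ?G \<times> T. ereal (log_mean_det (M N) (W N) r N \<gamma> t)) \<le> ?S"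
    proof (rule ereal_le_epsilon2)
      fix e :: real assume "e > 0"
      show "limsup (\<lambda>N. SUP (\<gamma>, t) \<in> ?G \<times> T. ereal (log_mean_det (M N) (W N) r N \<gamma> t)) \<le> ?S + ereal e"
      proof (rule Limsup_bounded)
        show "\<forall>\<^sub>F N in sequentially. (SUP (\<gamma>, t) \<in> ?G \<times> T. ereal (log_mean_det (M N) (W N) r N \<gamma> t)) \<le> ?S + ereal e"
          using ev[OF \<open>e > 0\<close>]
        proof eventually_elim
          case (elim N)
          show ?case
          proof (rule SUP_least)
            fix p assume "p \<in> ?G \<times> T"
            then obtain \<gamma> t where p: "p = (\<gamma>, t)" "\<gamma> \<in> ?G" "t \<in> T" by auto
            have "log_mean_det (M N) (W N) r N \<gamma> t \<le> Omega t + e" using bd[OF conjunct1[OF elim] p(2), of t] conjunct2[OF elim] by linarith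
            then have "ereal (log_mean_det (M N) (W N) r N \<gamma> t) \<le> ereal (Omega t) + ereal e" by simp
            also have "\<dots> \<le> ?S + ereal e" by (intro add_right_mono SUP_upper p)
            finally show "(case p of (\<gamma>, t) \<Rightarrow> ereal (log_mean_det (M N) (W N) r N \<gamma> t)) \<le> ?S + ereal e" by (simp add: p)
          qed
        qed
      qed
    qed
    show "?I \<le> liminf (\<lambda>N. INF (\<gamma>, t) \<in> ?G \<times> T. ereal (log_mean_det (M N) (W N) r N \<gamma> t))"
    proof (rule ereal_le_epsilon2)
      fix e :: real assume "e > 0"
      have "?I - ereal e \<le> liminf (\<lambda>N. INF (\<gamma>, t) \<in> ?G \<times> T. ereal (log_mean_det (M N) (W N) r N \<gamma> t))"
      proof (rule Liminf_bounded)
        show "\<forall>\<^sub>F N in sequentially. ?I - ereal e \<le> (INF (\<gamma>, t) \<in> ?G \<times> T. ereal (log_mean_det (M N) (W N) r N \<gamma> t))"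
          using ev[OF \<open>e > 0\<close>]
        proof eventually_elim
          case (elim N)
          show ?case
          proof (rule INF_greatest)
            fix p assume "p \<in> ?G \<times> T"
            then obtain \<gamma> t where p: "p = (\<gamma>, t)" "\<gamma> \<in> ?G" "t \<in> T" by auto
            have "?I - ereal e \<le> ereal (Omega t) - ereal e" by (intro ereal_minus_mono INF_lower p order_refl)
            also have "Omega t - e \<le> log_mean_det (M N) (W N) r N \<gamma> t" using bd[OF conjunct1[OF elim] p(2), of t] conjunct2[OF elim] by linarith
            then have "ereal (Omega t) - ereal e \<le> ereal (log_mean_det (M N) (W N) r N \<gamma> t)" by simp
            finally show "?I - ereal e \<le> (case p of (\<gamma>, t) \<Rightarrow> ereal (log_mean_det (M N) (W N) r N \<gamma> t))" by (simp add: p)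
          qed
        qed
      qed
      then show "?I \<le> liminf (\<lambda>N. INF (\<gamma>, t) \<in> ?G \<times> T. ereal (log_mean_det (M N) (W N) r N \<gamma> t)) + ereal e"
        by (simp add: ereal_minus_le_iff)
    qed
  qed
qed

end
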